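(* Let $(g,\mu,J)$ be a driven cofactor system in adapted coordinates $(y^i,x^a)$, with $J$ and $J_1$ nonsingular. Assume that the equation $\det(J-\lambda P_2)=0$ has $n$ functionally independent solutions $u^a(y,x)$. Let $(y(t),p_i(t))$ be a solution of the driving system, and introduce for the driven system along this solution the canonical variables $(u^a,s_a)$ by $$u^a=u^a(y(t),x),\qquad \tilde p_a=s_b\frac{\partial u^b}{\partial x^a}(y(t),x),\qquad p_a=\tilde p_a+J^i_a(y(t),x)\,\tilde p_i(t),$$ where $\tilde p_i(t)$ is determined by $p_i(t)=J^j_i(y(t))\tilde p_j(t)$. Then the $n$ quadratic integrals $H_{(1)},\dots,H_{(n)}$ of the driven system along $(y(t),p_i(t))$, when expressed in the coordinates $(u^a,s_a)$, do not depend explicitly on time. Moreover, the Hamilton–Jacobi equation of the (autonomous) function $H_{(n)}(u,s)$ is separable, and the $u^a$ are orthogonal separation coordinates (St\"ackel separability).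
   Context: Everything is smooth and the summation convention is used; coordinate domains are taken such that closed 1-forms are exact. Type $(1,1)$ tensors act on 1-forms by their adjoint. Functional independence of the $u^a$ means that the matrix $(\partial u^a/\partial x^b)$ is nonsingular. "Orthogonal" means that the quadratic part of $H_{(n)}$ in the $s_a$ is diagonal; "separable" means that $H_{(n)}(u,\partial S/\partial u)=\text{const}$ has a complete solution of the form $S=\sum_aS_a(u^a,\alpha)$. Special conformal Killing tensor (scKt) for a Riemannian metric $g$: a type $(1,1)$ tensor field $J$, symmetric with respect to $g$, with $J_{\alpha\beta|\gamma}=\frac12(\alpha_\alpha g_{\beta\gamma}+\alpha_\beta g_{\alpha\gamma})$, where $J_{\alpha\beta}=g_{\alpha\gamma}J^\gamma_\beta$, the bar is the Levi-Civita covariant derivative of $g$, and (necessarily) $\alpha=d(\operatorname{tr}J)$. The cofactor tensor $\operatorname{cof}J$ is defined by $J(\operatorname{cof}J)=(\operatorname{cof}J)J=(\det J)I$ (in general: the adjugate). $d_J$ is the degree 1 derivation of forms anticommuting with $d$ with $d_Jf=J(df)$, and $D_J\rho=d_J\rho+d(\operatorname{tr}J)\wedge\rho$. A cofactor system $(g,\mu,J)$ consists of a Riemannian metric $g$, a 1-form $\mu$ and a nonsingular scKt $J$ for $g$ with $D_J\mu=0$; it represents the equations $\frac{d}{dt}(\partial T/\partial\dot q^\alpha)-\partial T/\partial q^\alpha=Q_\alpha$, with $T=\frac12g_{\alpha\beta}\dot q^\alpha\dot q^\beta$, $\mu=Q_\alpha dq^\alpha$. Driven cofactor system in adapted coordinates: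 a cofactor system on a manifold of dimension $N=m+n$ with coordinates $(y^i,x^a)$, $i=1,\dots,m$, $a=1,\dots,n$, such that $g=g_{ij}(y)dy^i\otimes dy^j+g_{ab}(x)dx^a\otimes dx^b$ (no mixed terms) and $\mu=\mu_1+\mu_2$ with $\mu_1=Q_i(y)dy^i$, $\mu_2=Q_a(x,y)dx^a$, $Q_a=-\partial V/\partial x^a$ for a function $V(x,y)$, and the $\partial Q_a/\partial y^i$ are not all zero. The driving system consists of the equations for the $y^i$, the driven system of those for the $x^a$; momenta are $p_i=g_{ij}\dot y^j$, $p_a=g_{ab}\dot x^b$. $P_1,P_2$ are the complementary projectors onto $K^\perp=\mathrm{span}\{\partial/\partial y^i\}$ and $K=\mathrm{span}\{\partial/\partial x^a\}$; $J_1=P_1JP_1$ has components $J^i_j$ (depending on $y$ only); its nonsingularity refers to its restriction to $K^\perp$. Let $A(a)=\operatorname{cof}(J+aP_2)=\sum_{i=1}^{n+1}A_{(i)}a^{i-1}$. Each $A_{(i)}\mu$ is closed; $W_{(i)}$ is defined (up to a constant) by $A_{(i)}\mu=-dW_{(i)}$, and $H_{(i)}=\frac12A_{(i)}^{\alpha\beta}p_\alpha p_\beta+W_{(i)}$ (index raised with $g$), which along $(y(t),p_i(t))$ becomes a function of $(x^a,p_a,t)$. *)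

theory Defs
  imports "HOL-Analysis.Analysis"
begin

section \<open>Smooth functions and forms in coordinates\<close>

primrec Ck_on :: "nat \<Rightarrow> 'a::euclidean_space set \<Rightarrow> ('a \<Rightarrow> 'b::real_normed_vector) \<Rightarrow> bool" where
  "Ck_on 0 U f \<longleftrightarrow> continuous_on U f"
| "Ck_on (Suc k) U f \<longleftrightarrow> (\<forall>x\<in>U. f differentiable (at x)) \<and>
     (\<forall>e\<in>Basis. Ck_on k U (\<lambda>x. frechet_derivative f (at x) e))"

text \<open>Meaningful for open \<open>U\<close> only, which is how it is used.\<close>

definition smooth_on :: "'a::euclidean_space set \<Rightarrow> ('a \<Rightarrow> 'b::real_normed_vector) \<Rightarrow> bool" where
  "smooth_on U f \<longleftrightarrow> (\<forall>k. Ck_on k U f)"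

definition pd :: "'k::finite \<Rightarrow> (real^'k \<Rightarrow> real) \<Rightarrow> real^'k \<Rightarrow> real" where
  "pd k f q = frechet_derivative f (at q) (axis k 1)"

text \<open>1-forms are given by their component vectors and 2-forms by their antisymmetric component
  matrices: \<open>\<omega> = 1/2 \<omega>\<^sub>\<alpha>\<^sub>\<beta> dq\<^sup>\<alpha> \<and> dq\<^sup>\<beta>\<close>.\<close>

definition df :: "(real^'k \<Rightarrow> real) \<Rightarrow> real^'k \<Rightarrow> real^'k::finite" where
  "df f q = (\<chi> \<alpha>. pd \<alpha> f q)"

definition ext_d :: "(real^'k \<Rightarrow> real^'k) \<Rightarrow> real^'k \<Rightarrow> real^'k^'k::finite" where
  "ext_d \<rho> q = (\<chi> \<alpha> \<beta>. pd \<alpha> (\<lambda>z. \<rho> z $ \<beta>) q - pd \<beta> (\<lambda>z. \<rho> z $ \<alpha>) q)"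

definition wedge :: "real^'k \<Rightarrow> real^'k \<Rightarrow> real^'k^'k::finite" where
  "wedge \<rho> \<sigma> = (\<chi> \<alpha> \<beta>. \<rho> $ \<alpha> * \<sigma> $ \<beta> - \<rho> $ \<beta> * \<sigma> $ \<alpha>)"

definition coordinate_domain :: "(real^'k::finite) set \<Rightarrow> bool" where
  "coordinate_domain U \<longleftrightarrow> open U \<and>
     (\<forall>\<rho>. smooth_on U \<rho> \<and> (\<forall>q\<in>U. ext_d \<rho> q = 0) \<longrightarrow>
        (\<exists>f. smooth_on U f \<and> (\<forall>q\<in>U. \<rho> q = df f q)))"

section \<open>Special conformal Killing tensors and cofactor systems\<close>

definition riemannian_metric :: "(real^'k::finite) set \<Rightarrow> (real^'k \<Rightarrow> real^'k^'k) \<Rightarrow> bool" where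
  "riemannian_metric U g \<longleftrightarrow> smooth_on U g \<and>
     (\<forall>q\<in>U. transpose (g q) = g q \<and> (\<forall>v. v \<noteq> 0 \<longrightarrow> v \<bullet> (g q *v v) > 0))"

definition christoffel ::
  "(real^'k \<Rightarrow> real^'k^'k) \<Rightarrow> real^'k \<Rightarrow> 'k \<Rightarrow> 'k \<Rightarrow> 'k::finite \<Rightarrow> real" where
  "christoffel g q \<delta> \<alpha> \<beta> = (1/2) * (\<Sum>\<epsilon>\<in>UNIV. matrix_inv (g q) $ \<delta> $ \<epsilon> *
     (pd \<alpha> (\<lambda>z. g z $ \<epsilon> $ \<beta>) q + pd \<beta> (\<lambda>z. g z $ \<epsilon> $ \<alpha>) q - pd \<epsilon> (\<lambda>z. g z $ \<alpha> $ \<beta>) q))"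

text \<open>\<open>cov_deriv g b q \<alpha> \<beta> \<gamma>\<close> is \<open>b\<^sub>\<alpha>\<^sub>\<beta>\<^sub>|\<^sub>\<gamma>\<close> for a type (0,2) tensor field \<open>b\<close>.\<close>

definition cov_deriv ::
  "(real^'k \<Rightarrow> real^'k^'k) \<Rightarrow> (real^'k \<Rightarrow> real^'k^'k) \<Rightarrow> real^'k \<Rightarrow> 'k \<Rightarrow> 'k \<Rightarrow> 'k::finite \<Rightarrow> real" where
  "cov_deriv g b q \<alpha> \<beta> \<gamma> = pd \<gamma> (\<lambda>z. b z $ \<alpha> $ \<beta>) q
     - (\<Sum>\<delta>\<in>UNIV. christoffel g q \<delta> \<alpha> \<gamma> * b q $ \<delta> $ \<beta>)
     - (\<Sum>\<delta>\<in>UNIV. christoffel g q \<delta> \<beta> \<gamma> * b q $ \<alpha> $ \<delta>)"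

text \<open>A type (1,1) tensor \<open>J\<close> has the matrix \<open>J $ \<alpha> $ \<beta> = J\<^sup>\<alpha>\<^sub>\<beta>\<close>. It maps a vector \<open>v\<close> to \<open>J *v v\<close> and,
  by its adjoint, a 1-form \<open>\<rho>\<close> to \<open>\<rho> v* J\<close>. Lowering its upper index gives \<open>g ** J\<close>.\<close>

definition scKt :: "(real^'k::finite) set \<Rightarrow> (real^'k \<Rightarrow> real^'k^'k) \<Rightarrow> (real^'k \<Rightarrow> real^'k^'k) \<Rightarrow> bool" where
  "scKt U g J \<longleftrightarrow> smooth_on U J \<and>
     (\<forall>q\<in>U. transpose (g q ** J q) = g q ** J q \<and>
        (\<forall>\<alpha> \<beta> \<gamma>. cov_deriv g (\<lambda>z. g z ** J z) q \<alpha> \<beta> \<gamma> =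
           (1/2) * (df (\<lambda>z. trace (J z)) q $ \<alpha> * g q $ \<beta> $ \<gamma> +
                    df (\<lambda>z. trace (J z)) q $ \<beta> * g q $ \<alpha> $ \<gamma>)))"

text \<open>On a 1-form \<open>\<rho> = \<rho>\<^sub>\<beta> dq\<^sup>\<beta>\<close> the derivation property, \<open>d\<^sub>J f = J(df)\<close> and
  \<open>d\<^sub>J dq\<^sup>\<beta> = - d (d\<^sub>J q\<^sup>\<beta>) = - d (J dq\<^sup>\<beta>)\<close> give
  \<open>d\<^sub>J \<rho> = J(d\<rho>\<^sub>\<beta>) \<and> dq\<^sup>\<beta> - \<rho>\<^sub>\<beta> d (J dq\<^sup>\<beta>)\<close>. The 1-form \<open>dq\<^sup>\<beta>\<close> is \<open>axis \<beta> 1\<close>.\<close>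

definition dJ :: "(real^'k \<Rightarrow> real^'k^'k) \<Rightarrow> (real^'k \<Rightarrow> real^'k) \<Rightarrow> real^'k \<Rightarrow> real^'k^'k::finite" where
  "dJ J \<rho> q = (\<Sum>\<beta>\<in>UNIV. wedge (df (\<lambda>z. \<rho> z $ \<beta>) q v* J q) (axis \<beta> 1)
                     - \<rho> q $ \<beta> *\<^sub>R ext_d (\<lambda>z. axis \<beta> 1 v* J z) q)"

definition DJ :: "(real^'k \<Rightarrow> real^'k^'k) \<Rightarrow> (real^'k \<Rightarrow> real^'k) \<Rightarrow> real^'k \<Rightarrow> real^'k^'k::finite" where
  "DJ J \<rho> q = dJ J \<rho> q + wedge (df (\<lambda>z. trace (J z)) q) (\<rho> q)"

definition cofactor_system ::
  "(real^'k::finite) set \<Rightarrow> (real^'k \<Rightarrow> real^'k^'k) \<Rightarrow> (real^'k \<Rightarrow> real^'k) \<Rightarrow> (real^'k \<Rightarrow> real^'k^'k) \<Rightarrow> bool" where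
  "cofactor_system U g \<mu> J \<longleftrightarrow> riemannian_metric U g \<and> smooth_on U \<mu> \<and>
     scKt U g J \<and> (\<forall>q\<in>U. det (J q) \<noteq> 0) \<and> (\<forall>q\<in>U. DJ J \<mu> q = 0)"

text \<open>The entry \<open>(i, j)\<close> is the cofactor of \<open>M $ j $ i\<close>: column \<open>i\<close> of \<open>M\<close> is replaced by the
  \<open>j\<close>-th unit vector.\<close>

definition cof :: "'a::comm_ring_1^'k^'k \<Rightarrow> 'a^'k^'k::finite" where
  "cof M = (\<chi> i j. det (\<chi> k l. if l = i then (if k = j then 1 else 0) else M $ k $ l))"

lemma cof_mult_left: "cof M ** M = mat (det M)" for M :: "real^'k^'k"
proof -
  have "(cof M ** M) $ i $ k = (mat (det M) :: real^'k^'k) $ i $ k" for i k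
  proof -
    have row: "det (\<chi> l. if l = i then \<Sum>j\<in>UNIV. M $ j $ k *s axis j 1 else transpose M $ l)
      = (\<Sum>j\<in>UNIV. M $ j $ k * det (\<chi> l. if l = i then axis j 1 else transpose M $ l))"
      by (subst det_linear_row_sum) (simp_all add: det_row_mul)
    have tr: "det (\<chi> a l. if l = i then v $ a else M $ a $ l)
       = det (\<chi> l. if l = i then v else transpose M $ l)" for v :: "real^'k"
      by (subst det_transpose[symmetric])
         (rule arg_cong[where f = det], auto simp: transpose_def vec_eq_iff)
    have e: "(\<Sum>j\<in>UNIV. M $ j $ k *s axis j 1) = M *v axis k 1"
      by (simp add: vec_eq_iff matrix_vector_mult_def axis_def if_distrib cong: if_cong)
    have "(cof M ** M) $ i $ k = (\<Sum>j\<in>UNIV. M $ j $ k *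
            det (\<chi> a l. if l = i then (axis j 1 :: real^'k) $ a else M $ a $ l))"
      unfolding cof_def matrix_matrix_mult_def axis_def vec_lambda_beta
      by (rule sum.cong[OF refl]) (rule mult.commute)
    also have "\<dots> = det (\<chi> a l. if l = i then (M *v axis k 1) $ a else M $ a $ l)"
      by (simp add: tr row[unfolded e])
    also have "\<dots> = axis k 1 $ i * det M"
      by (rule cramer_lemma)
    finally show ?thesis
      by (simp add: mat_def axis_def)
  qed
  then show ?thesis
    by (simp add: vec_eq_iff)
qed

lemma cof_transpose: "cof (transpose M) = transpose (cof M)" for M :: "real^'k^'k"
proof -
  have pz: "(\<Prod>k\<in>UNIV. f k) = 0" if "f k0 = 0" for f :: "'k \<Rightarrow> real" and k0
    using that by (intro prod_zero) auto
  have "cof (transpose M) $ i $ j = cof M $ j $ i" for i j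
  proof -
    let ?R = "(\<chi> k l. if k = i then axis j 1 $ l else M $ k $ l) :: real^'k^'k"
    let ?C = "(\<chi> k l. if l = j then axis i 1 $ k else M $ k $ l) :: real^'k^'k"
    let ?B = "(\<chi> k l. if k = i then axis j 1 $ l else if l = j then 0 else M $ k $ l) :: real^'k^'k"
    have "cof (transpose M) $ i $ j = det (transpose ?R)"
      unfolding cof_def transpose_def axis_def vec_lambda_beta by (rule refl)
    also have "\<dots> = det ?R"
      by (rule det_transpose)
    also have "det ?R = det ?B"
    proof -
      have *: "(\<Prod>k\<in>UNIV. ?R $ k $ p k) = (\<Prod>k\<in>UNIV. ?B $ k $ p k)" if p: "p permutes UNIV" for p
      proof (cases "p i = j")
        case True
        then have "p k \<noteq> j" if "k \<noteq> i" for k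
          using that inj_eq[OF permutes_inj[OF p], of k i] True by simp
        then show ?thesis
          by (intro prod.cong) auto
      next
        case False
        then have "?R $ i $ p i = 0" "?B $ i $ p i = 0"
          by (auto simp: axis_def)
        then have "(\<Prod>k\<in>UNIV. ?R $ k $ p k) = 0" "(\<Prod>k\<in>UNIV. ?B $ k $ p k) = 0"
          by - (erule pz)+
        then show ?thesis by (simp only:)
      qed
      show ?thesis
        unfolding det_def by (rule sum.cong[OF refl]) (simp only: mem_Collect_eq *)
    qed
    also have "det ?B = det ?C"
    proof -
      have *: "(\<Prod>k\<in>UNIV. ?B $ k $ p k) = (\<Prod>k\<in>UNIV. ?C $ k $ p k)" if p: "p permutes UNIV" for p
      proof (cases "p i = j")
        case True
        then have "p k \<noteq> j" if "k \<noteq> i" for k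
          using that inj_eq[OF permutes_inj[OF p], of k i] True by simp
        then show ?thesis
          using True by (intro prod.cong) (auto simp: axis_def)
      next
        case False
        obtain k where k: "p k = j"
          using permutes_surj[OF p] by (rule surjE) (rule that, rule sym)
        then have "?C $ k $ p k = 0" "?B $ i $ p i = 0"
          using False by (auto simp: axis_def)
        then have "(\<Prod>k\<in>UNIV. ?C $ k $ p k) = 0" "(\<Prod>k\<in>UNIV. ?B $ k $ p k) = 0"
          by - (erule pz)+
        then show ?thesis by (simp only:)
      qed
      show ?thesis
        unfolding det_def by (rule sum.cong[OF refl]) (simp only: mem_Collect_eq *)
    qed
    also have "det ?C = cof M $ j $ i"
      unfolding cof_def axis_def vec_lambda_beta by (rule refl)
    finally show ?thesis .
  qed
  then show ?thesis
    by (simp add: vec_eq_iff transpose_def)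
qed

lemma cof_mult_right: "M ** cof M = mat (det M)" for M :: "real^'k^'k"
proof -
  have "transpose (M ** cof M) = mat (det M)"
    using cof_mult_left[of "transpose M"] by (simp add: cof_transpose matrix_transpose_mul)
  then have "transpose (transpose (M ** cof M)) = transpose (mat (det M))"
    by simp
  then show ?thesis
    by (simp add: transpose_mat)
qed

section \<open>Driven cofactor systems in adapted coordinates\<close>

text \<open>The coordinates \<open>(y\<^sup>i, x\<^sup>a)\<close> are indexed by the sum type \<open>'m + 'n\<close>, with
  \<open>m = CARD('m)\<close> and \<open>n = CARD('n)\<close>. \<open>join\<close> is used for points and for momenta.\<close>

definition join :: "real^'m::finite \<Rightarrow> real^'n::finite \<Rightarrow> real^('m + 'n)" where
  "join y x = (\<chi> k. case k of Inl i \<Rightarrow> y $ i | Inr a \<Rightarrow> x $ a)"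

definition ypart :: "real^('m::finite + 'n::finite) \<Rightarrow> real^'m" where
  "ypart q = (\<chi> i. q $ Inl i)"

definition xpart :: "real^('m::finite + 'n::finite) \<Rightarrow> real^'n" where
  "xpart q = (\<chi> a. q $ Inr a)"

definition P2 :: "real^('m::finite + 'n::finite)^('m + 'n)" where
  "P2 = (\<chi> \<alpha> \<beta>. case \<alpha> of Inl i \<Rightarrow> 0 | Inr a \<Rightarrow> (if \<beta> = Inr a then 1 else 0))"

definition driven_cofactor_system ::
  "(real^('m::finite + 'n::finite)) set \<Rightarrow> (real^('m + 'n) \<Rightarrow> real^('m + 'n)^('m + 'n)) \<Rightarrow>
   (real^('m + 'n) \<Rightarrow> real^('m + 'n)) \<Rightarrow> (real^('m + 'n) \<Rightarrow> real^('m + 'n)^('m + 'n)) \<Rightarrow>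
   (real^'m \<Rightarrow> real^'m^'m) \<Rightarrow> (real^'n \<Rightarrow> real^'n^'n) \<Rightarrow> (real^'m \<Rightarrow> real^'m) \<Rightarrow>
   (real^('m + 'n) \<Rightarrow> real) \<Rightarrow> bool" where
  "driven_cofactor_system U g \<mu> J g1 g2 Q1 V \<longleftrightarrow>
     coordinate_domain U \<and> cofactor_system U g \<mu> J \<and> smooth_on U V \<and>
     (\<forall>q\<in>U. (\<forall>i j. g q $ Inl i $ Inl j = g1 (ypart q) $ i $ j) \<and>
            (\<forall>a b. g q $ Inr a $ Inr b = g2 (xpart q) $ a $ b) \<and>
            (\<forall>i a. g q $ Inl i $ Inr a = 0 \<and> g q $ Inr a $ Inl i = 0) \<and>
            (\<forall>i. \<mu> q $ Inl i = Q1 (ypart q) $ i) \<and>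
            (\<forall>a. \<mu> q $ Inr a = - pd (Inr a) V q)) \<and>
     (\<exists>q\<in>U. \<exists>a i. pd (Inl i) (\<lambda>z. \<mu> z $ Inr a) q \<noteq> 0)"

text \<open>A motion \<open>y\<close> with momenta \<open>p\<close> on the time set \<open>T\<close> of the Lagrange equations with kinetic energy
  \<open>1/2 g\<^sub>i\<^sub>j v\<^sup>i v\<^sup>j\<close> and force \<open>Q\<close>. Since the metric of a driven system has no mixed terms and \<open>Q\<^sub>i\<close>
  depends on \<open>y\<close> only, the driving equations are these equations for \<open>g\<^sub>i\<^sub>j\<close>, \<open>Q\<^sub>i\<close>.\<close>

definition kinetic :: "(real^'k \<Rightarrow> real^'k^'k) \<Rightarrow> real^'k \<Rightarrow> real^'k::finite \<Rightarrow> real" where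
  "kinetic g z v = (1/2) * (v \<bullet> (g z *v v))"

definition lagrange_solution ::
  "real set \<Rightarrow> (real^'k::finite) set \<Rightarrow> (real^'k \<Rightarrow> real^'k^'k) \<Rightarrow> (real^'k \<Rightarrow> real^'k) \<Rightarrow>
   (real \<Rightarrow> real^'k) \<Rightarrow> (real \<Rightarrow> real^'k) \<Rightarrow> bool" where
  "lagrange_solution T Y g Q y p \<longleftrightarrow> (\<exists>v. \<forall>t\<in>T. y t \<in> Y \<and>
     (y has_vector_derivative v t) (at t) \<and> p t = g (y t) *v v t \<and>
     (\<forall>i. ((\<lambda>\<tau>. pd i (\<lambda>w. kinetic g (y \<tau>) w) (v \<tau>)) has_real_derivative
            pd i (\<lambda>z. kinetic g z (v t)) (y t) + Q (y t) $ i) (at t)))"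

definition quadratic_integral ::
  "(real^'k \<Rightarrow> real^'k^'k) \<Rightarrow> (real^'k \<Rightarrow> real^'k^'k) \<Rightarrow> (real^'k \<Rightarrow> real) \<Rightarrow>
   real^'k \<Rightarrow> real^'k::finite \<Rightarrow> real" where
  "quadratic_integral g A W q p = (1/2) * (p \<bullet> ((A q ** matrix_inv (g q)) *v p)) + W q"

text \<open>\<open>p\<^sub>a\<close> as a function of \<open>(q, s)\<close>, given \<open>p_i = J^j_i p'_j\<close>, where \<open>p'\<close> is the argument \<open>pt\<close>.\<close>

definition driven_momentum ::
  "(real^('m + 'n) \<Rightarrow> real^('m + 'n)^('m + 'n)) \<Rightarrow> (real^('m + 'n) \<Rightarrow> real^'n) \<Rightarrow>
   real^'m \<Rightarrow> real^('m::finite + 'n::finite) \<Rightarrow> real^'n \<Rightarrow> real^'n" where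
  "driven_momentum J u pt q s =
     (\<chi> a. (\<Sum>b\<in>UNIV. s $ b * pd (Inr a) (\<lambda>z. u z $ b) q) + (\<Sum>i\<in>UNIV. J q $ Inl i $ Inr a * pt $ i))"

text \<open>A set \<open>N\<close> of points \<open>(t, x)\<close> on which \<open>(t, u)\<close> are coordinates. A function of \<open>(u, s, t)\<close> on such
  a set without explicit time dependence (vanishing partial derivative in \<open>t\<close> at fixed
  \<open>(u, s)\<close>) is a function of \<open>(u, s)\<close>, because its domain at fixed \<open>(u, s)\<close> is an interval.\<close>

definition moving_chart ::
  "real set \<Rightarrow> (real^('m + 'n)) set \<Rightarrow> (real^('m + 'n) \<Rightarrow> real^'n) \<Rightarrow> (real \<Rightarrow> real^'m::finite) \<Rightarrow>
   (real \<times> (real^'n::finite)) set \<Rightarrow> bool" where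
  "moving_chart T U u y N \<longleftrightarrow> open N \<and> (\<forall>(t, x)\<in>N. t \<in> T \<and> join (y t) x \<in> U) \<and>
     inj_on (\<lambda>(t, x). (t, u (join (y t) x))) N \<and>
     (\<forall>v. connected {t. \<exists>x. (t, x) \<in> N \<and> u (join (y t) x) = v})"

section \<open>Separation of the Hamilton--Jacobi equation\<close>

text \<open>The variables \<open>v\<close> range over the open set \<open>B\<close> and the \<open>n\<close> parameters over the open set \<open>P\<close>.\<close>

definition complete_solution ::
  "(real^'n::finite) set \<Rightarrow> (real^'n) set \<Rightarrow> (real^'n \<Rightarrow> real^'n \<Rightarrow> real) \<Rightarrow> (real^'n \<Rightarrow> real^'n \<Rightarrow> real) \<Rightarrow> bool" where
  "complete_solution B P h S \<longleftrightarrow> smooth_on (B \<times> P) (\<lambda>(v, \<alpha>). S v \<alpha>) \<and>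
     (\<forall>\<alpha>\<in>P. \<exists>E. \<forall>v\<in>B. h v (df (\<lambda>w. S w \<alpha>) v) = E) \<and>
     (\<forall>v\<in>B. \<forall>\<alpha>\<in>P. det (\<chi> a b. pd b (\<lambda>\<beta>. pd a (\<lambda>w. S w \<beta>) v) \<alpha>) \<noteq> 0)"

text \<open>As usual, existence of a complete solution is local: around every point of \<open>V\<close>, on a box.\<close>

definition HJ_separable :: "(real^'n::finite) set \<Rightarrow> (real^'n \<Rightarrow> real^'n \<Rightarrow> real) \<Rightarrow> bool" where
  "HJ_separable V h \<longleftrightarrow> (\<forall>v0\<in>V. \<exists>B P S. (\<exists>l r. B = box l r) \<and> v0 \<in> B \<and> B \<subseteq> V \<and>
     open P \<and> P \<noteq> {} \<and> complete_solution B P h (\<lambda>v \<alpha>. \<Sum>a\<in>UNIV. S a (v $ a) \<alpha>))"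

definition orthogonal_on :: "(real^'n::finite) set \<Rightarrow> (real^'n \<Rightarrow> real^'n \<Rightarrow> real) \<Rightarrow> bool" where
  "orthogonal_on V h \<longleftrightarrow> (\<exists>G b c. \<forall>v\<in>V. \<forall>s.
     h v s = (\<Sum>a\<in>UNIV. G a v * (s $ a)\<^sup>2) + (\<Sum>a\<in>UNIV. b a v * s $ a) + c v)"

end

theory Submission
  imports Defs
begin

text \<open>
  Write \<open>w\<^sub>b = du\<^sup>b\<close>, \<open>C(l) = cof (J - l P2)\<close>, \<open>\<Delta> = det J\<^sub>1\<close> and \<open>\<alpha> = d (tr J)\<close>. Differentiating
  \<open>det (J - u\<^sup>b P2) = 0\<close> covariantly gives \<open>\<alpha> C(u\<^sup>b) = tr (C(u\<^sup>b) P2) w\<^sub>b\<close>, hence \<open>w\<^sub>b J = u\<^sup>b w\<^sub>b P2\<close>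
  where the roots are distinct, which is a dense set, and so everywhere; the covariant derivative of
  this equation then excludes coinciding roots. Consequently \<open>det (J - l P2) = \<Delta> \<Prod>\<^sub>b (u\<^sup>b - l)\<close>, and
  \<open>\<Sum>\<^sub>i a\<^sup>i\<^sup>-\<^sup>1 H\<^sub>i\<close> at \<open>a = - u\<^sup>b\<close> becomes \<open>1/2 s\<^sub>b\<^sup>2 \<Phi>\<^sub>b + \<phi>\<^sub>b\<close>. The differentials of \<open>\<Phi>\<^sub>b\<close> and \<open>\<phi>\<^sub>b\<close> vanish on
  the kernel of \<open>w\<^sub>b\<close>, so both are functions of \<open>u\<^sup>b\<close> alone. The top coefficient \<open>H\<^sub>n\<^sub>+\<^sub>1\<close> involves only
  the driving system and is one of its constants of motion. Lagrange interpolation at the nodes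
  \<open>- u\<^sup>b\<close> expresses \<open>H\<^sub>1, \<dots>, H\<^sub>n\<close> by \<open>u\<close> and \<open>s\<close>, and solving
  \<open>1/2 s\<^sub>b\<^sup>2 \<Phi>\<^sub>b + \<phi>\<^sub>b = q(- u\<^sup>b)\<close> for \<open>s\<^sub>b\<close>, with a polynomial \<open>q\<close> whose lower coefficients are free, separates the
  Hamilton--Jacobi equation.
\<close>

section \<open>Smooth functions\<close>

text \<open>The metric has no mixed terms and each block depends on its own coordinates, so
  \<open>P2\<close> is parallel. Hence for constant \<open>l\<close> the pencil has the same
  covariant derivative as \<open>J\<close>, namely \<open>killing_part\<close>, of rank at most two.
  The kernel of \<open>w b\<close> is tractable because it consists of the vectors
  \<open>R q *v (\<xi> v* pencil (u q $ b) q)\<close>: in such directions the logarithmic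
  derivatives of \<open>\<tau> b\<close> and \<open>n b\<close>, the factors of
  \<open>\<Phi> b\<close>, are opposite, and \<open>\<mu> q v* C (u q $ b) q\<close> meets the
  pencil and leaves its determinant, which is 0. All this happens where the pencil is singular, so
  its cofactor matrix is no multiple of an inverse; the symmetry of that matrix and its link to the
  gradient of the determinant come from Jacobi's formula. Being a function of one root is at first a
  local property. The connected time sets of a moving chart extend it, and the conservation of the
  driving energy, to whole fibres of \<open>u\<close>. A complete solution must be smooth jointly in
  position and parameters, which is why differentiation under the integral sign is
  developed.\<close>

abbreviation dd :: "('a::real_normed_vector \<Rightarrow> 'b::real_normed_vector) \<Rightarrow> 'a \<Rightarrow> 'a \<Rightarrow> 'b" where
  "dd f q v \<equiv> frechet_derivative f (at q) v"

lemma Ck_on_cong: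
  assumes "open U" "\<And>x. x \<in> U \<Longrightarrow> f x = g x" "Ck_on k U f"
  shows "Ck_on k U g"
  using assms
proof (induction k arbitrary: f g)
  case 0
  then show ?case by (metis Ck_on.simps(1) continuous_on_cong)
next
  case (Suc k)
  have d: "f differentiable (at x)" if "x \<in> U" for x
    using Suc.prems that by simp
  have eq: "frechet_derivative f (at x) = frechet_derivative g (at x)" if "x \<in> U" for x
    by (rule frechet_derivative_transform_within_open[OF d]) (use Suc.prems that in auto)
  have "g differentiable (at x)" if "x \<in> U" for x
    using d[OF that] Suc.prems that
    by (meson differentiable_def has_derivative_transform_within_open)
  moreover have "Ck_on k U (\<lambda>x. dd g x e)" if "e \<in> Basis" for e
    by (rule Suc.IH[where f = "\<lambda>x. dd f x e"]) (use Suc.prems that eq in auto)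
  ultimately show ?case by simp
qed

text \<open>Any explicit derivative may stand for the \<open>frechet_derivative\<close> in
  \<open>Ck_on\<close>; the inductions on the order of differentiability below go through this
  rule.\<close>

lemma Ck_on_SucI:
  assumes "open U" "\<And>x. x \<in> U \<Longrightarrow> (f has_derivative f' x) (at x)"
    "\<And>e. e \<in> Basis \<Longrightarrow> Ck_on k U (\<lambda>x. f' x e)"
  shows "Ck_on (Suc k) U f"
proof -
  have "Ck_on k U (\<lambda>x. dd f x e)" if "e \<in> Basis" for e
    by (rule Ck_on_cong[OF assms(1) _ assms(3)[OF that]])
       (metis assms(2) frechet_derivative_at)
  then show ?thesis using assms(2) by (auto simp: differentiable_def)
qed

lemma Ck_on_Suc_has_derivative:
  "Ck_on (Suc k) U f \<Longrightarrow> x \<in> U \<Longrightarrow> (f has_derivative frechet_derivative f (at x)) (at x)"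
  by (simp add: frechet_derivative_works)

lemma Ck_on_SucD: "Ck_on (Suc k) U f \<Longrightarrow> Ck_on k U f"
proof (induction k arbitrary: f)
  case 0
  then show ?case
    by (auto intro!: continuous_at_imp_continuous_on differentiable_imp_continuous_within)
next
  case (Suc k)
  then show ?case by simp
qed

lemma Ck_on_subset: "Ck_on k U f \<Longrightarrow> V \<subseteq> U \<Longrightarrow> Ck_on k V f"
  by (induction k arbitrary: f) (auto intro: continuous_on_subset)

lemma Ck_on_const: "open U \<Longrightarrow> Ck_on k U (\<lambda>x. c)"
proof (induction k arbitrary: c)
  case (Suc k)
  then show ?case by (intro Ck_on_SucI[where f' = "\<lambda>x v. 0"]) auto
qed simp

lemma Ck_on_linear:
  assumes "open U" "bounded_linear L"
  shows "Ck_on k U L"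
proof (cases k)
  case 0
  then show ?thesis using assms by (simp add: linear_continuous_on)
next
  case (Suc j)
  show ?thesis unfolding Suc
    by (rule Ck_on_SucI[where f' = "\<lambda>x. L"])
       (use assms in \<open>auto intro: bounded_linear_imp_has_derivative Ck_on_const\<close>)
qed

lemma Ck_on_add:
  assumes "open U" "Ck_on k U f" "Ck_on k U g"
  shows "Ck_on k U (\<lambda>x. f x + g x)"
  using assms(2,3)
proof (induction k arbitrary: f g)
  case 0
  then show ?case by (simp add: continuous_on_add)
next
  case (Suc k)
  show ?case
    by (rule Ck_on_SucI[OF assms(1) has_derivative_add[OF Ck_on_Suc_has_derivative Ck_on_Suc_has_derivative]])
       (use Suc in auto)
qed

lemma Ck_on_sum:
  assumes "open U" "\<And>i. i \<in> I \<Longrightarrow> Ck_on k U (f i)"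
  shows "Ck_on k U (\<lambda>x. \<Sum>i\<in>I. f i x)"
  using assms(2)
  by (induction I rule: infinite_finite_induct) (auto intro!: Ck_on_const Ck_on_add assms(1))

text \<open>The product rule yields values of the same \<open>B\<close> again, so the induction
  closes, with \<open>Ck_on_SucD\<close> lowering the order of the undifferentiated factor. This
  covers products, scalings, inner products and matrix products at once.\<close>

lemma Ck_on_bilinear:
  assumes "open U" "bounded_bilinear B" "Ck_on k U f" "Ck_on k U g"
  shows "Ck_on k U (\<lambda>x. B (f x) (g x))"
  using assms(3,4)
proof (induction k arbitrary: f g)
  case 0
  then show ?case using bounded_bilinear.continuous_on[OF assms(2)] by simp
next
  case (Suc k)
  show ?case
  proof (rule Ck_on_SucI[OF assms(1) bounded_bilinear.FDERIV[OF assms(2) Ck_on_Suc_has_derivative Ck_on_Suc_has_derivative]])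
    fix e :: 'a assume e: "e \<in> Basis"
    have "Ck_on k U (\<lambda>x. dd f x e)" "Ck_on k U (\<lambda>x. dd g x e)"
      using Suc.prems e by simp_all
    then show "Ck_on k U (\<lambda>x. B (f x) (dd g x e) + B (dd f x e) (g x))"
      by (intro Ck_on_add[OF assms(1)] Suc.IH) (use Suc.prems Ck_on_SucD in blast)+
  qed (use Suc.prems in blast)+
qed

lemma Ck_on_bounded_linear:
  assumes "open U" "bounded_linear L" "Ck_on k U f"
  shows "Ck_on k U (\<lambda>x. L (f x))"
  using assms(3)
proof (induction k arbitrary: f)
  case 0
  then show ?case using bounded_linear.continuous_on[OF assms(2)] by simp
next
  case (Suc k)
  show ?case
    by (rule Ck_on_SucI[OF assms(1) bounded_linear.has_derivative[OF assms(2) Ck_on_Suc_has_derivative]])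
       (use Suc in auto)
qed

lemma Ck_on_componentwise:
  fixes f :: "'a::euclidean_space \<Rightarrow> 'b::euclidean_space"
  assumes "open U" "\<And>b. b \<in> Basis \<Longrightarrow> Ck_on k U (\<lambda>x. f x \<bullet> b)"
  shows "Ck_on k U f"
proof -
  have "Ck_on k U (\<lambda>x. \<Sum>b\<in>Basis. (f x \<bullet> b) *\<^sub>R b)"
    by (intro Ck_on_sum[OF assms(1)] Ck_on_bounded_linear[OF assms(1) bounded_linear_scaleR_left] assms(2))
  then show ?thesis by (simp add: euclidean_representation)
qed

lemma has_derivative_basis_expansion:
  fixes f' :: "'c::euclidean_space \<Rightarrow> 'b::real_normed_vector"
  assumes "linear f'"
  shows "f' v = (\<Sum>b\<in>Basis. (v \<bullet> b) *\<^sub>R f' b)"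
proof -
  have "f' v = f' (\<Sum>b\<in>Basis. (v \<bullet> b) *\<^sub>R b)" by (simp add: euclidean_representation)
  also have "\<dots> = (\<Sum>b\<in>Basis. (v \<bullet> b) *\<^sub>R f' b)"
    using assms by (simp add: linear_sum linear_scale)
  finally show ?thesis .
qed

lemma Ck_on_compose:
  fixes f :: "'c::euclidean_space \<Rightarrow> 'b::real_normed_vector"
  assumes "open U" "open V" "Ck_on k V f" "Ck_on k U g" "\<And>x. x \<in> U \<Longrightarrow> g x \<in> V"
  shows "Ck_on k U (\<lambda>x. f (g x))"
  using assms(3,4)
proof (induction k arbitrary: f)
  case 0
  then show ?case using assms(5) by (auto intro: continuous_on_compose2)
next
  case (Suc k)
  have df: "(f has_derivative frechet_derivative f (at (g x))) (at (g x))"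
    and dg: "(g has_derivative frechet_derivative g (at x)) (at x)" if "x \<in> U" for x
    using that Suc.prems assms(5) by (blast intro: Ck_on_Suc_has_derivative)+
  \<comment> \<open>The direction \<open>dd g x e\<close> moves with \<open>x\<close>, whereas
    \<open>Ck_on\<close> speaks of fixed basis directions only. Expanding in the basis turns it into
    scalar coefficients of class \<open>k\<close>.\<close>
  show ?case
  proof (rule Ck_on_SucI[OF assms(1), where
        f' = "\<lambda>x e. \<Sum>b\<in>Basis. (dd g x e \<bullet> b) *\<^sub>R dd f (g x) b"])
    fix x assume x: "x \<in> U"
    have "((\<lambda>x. f (g x)) has_derivative (\<lambda>e. dd f (g x) (dd g x e))) (at x)"
      by (rule has_derivative_compose[OF dg[OF x] df[OF x]])
    also have "(\<lambda>e. dd f (g x) (dd g x e)) = (\<lambda>e. \<Sum>b\<in>Basis. (dd g x e \<bullet> b) *\<^sub>R dd f (g x) b)"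
      using has_derivative_basis_expansion[OF has_derivative_linear[OF df[OF x]]] by (rule ext)
    finally show "((\<lambda>x. f (g x)) has_derivative (\<lambda>e. \<Sum>b\<in>Basis. (dd g x e \<bullet> b) *\<^sub>R dd f (g x) b)) (at x)" .
  next
    fix e :: 'a assume e: "e \<in> Basis"
    show "Ck_on k U (\<lambda>x. \<Sum>b\<in>Basis. (dd g x e \<bullet> b) *\<^sub>R dd f (g x) b)"
    proof (intro Ck_on_sum[OF assms(1)] Ck_on_bilinear[OF assms(1) bounded_bilinear_scaleR])
      fix b :: 'c assume b: "b \<in> Basis"
      have "Ck_on k U (\<lambda>x. dd g x e)" using Suc.prems(2) e by simp
      then show "Ck_on k U (\<lambda>x. dd g x e \<bullet> b)"
        by (rule Ck_on_bounded_linear[OF assms(1) bounded_linear_inner_left])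
      have "Ck_on k V (\<lambda>z. dd f z b)" using Suc.prems(1) b by simp
      then show "Ck_on k U (\<lambda>x. dd f (g x) b)"
        by (rule Suc.IH[OF _ Ck_on_SucD[OF Suc.prems(2)]])
    qed
  qed
qed

lemma smooth_on_Ck: "smooth_on U f \<Longrightarrow> Ck_on k U f"
  by (simp add: smooth_on_def)

lemma smooth_on_has_derivative:
  "smooth_on U f \<Longrightarrow> x \<in> U \<Longrightarrow> (f has_derivative frechet_derivative f (at x)) (at x)"
  by (meson Ck_on_Suc_has_derivative smooth_on_def)

lemma smooth_on_differentiable: "smooth_on U f \<Longrightarrow> x \<in> U \<Longrightarrow> f differentiable (at x)"
  using smooth_on_has_derivative differentiable_def by blast

lemma smooth_on_continuous_on: "smooth_on U f \<Longrightarrow> continuous_on U f"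
  by (metis Ck_on.simps(1) smooth_on_def)

lemma smooth_on_cong:
  "open U \<Longrightarrow> (\<And>x. x \<in> U \<Longrightarrow> f x = g x) \<Longrightarrow> smooth_on U f \<Longrightarrow> smooth_on U g"
  unfolding smooth_on_def using Ck_on_cong by blast

lemma smooth_on_subset: "smooth_on U f \<Longrightarrow> V \<subseteq> U \<Longrightarrow> smooth_on V f"
  unfolding smooth_on_def using Ck_on_subset by blast

lemma smooth_on_const: "open U \<Longrightarrow> smooth_on U (\<lambda>x. c)"
  by (simp add: smooth_on_def Ck_on_const)

lemma smooth_on_linear: "open U \<Longrightarrow> bounded_linear L \<Longrightarrow> smooth_on U L"
  by (simp add: smooth_on_def Ck_on_linear)

lemma smooth_on_add:
  "open U \<Longrightarrow> smooth_on U f \<Longrightarrow> smooth_on U g \<Longrightarrow> smooth_on U (\<lambda>x. f x + g x)"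
  by (simp add: smooth_on_def Ck_on_add)

lemma smooth_on_sum:
  "open U \<Longrightarrow> (\<And>i. i \<in> I \<Longrightarrow> smooth_on U (f i)) \<Longrightarrow> smooth_on U (\<lambda>x. \<Sum>i\<in>I. f i x)"
  unfolding smooth_on_def by (auto intro: Ck_on_sum)

lemma smooth_on_bilinear:
  "open U \<Longrightarrow> bounded_bilinear B \<Longrightarrow> smooth_on U f \<Longrightarrow> smooth_on U g \<Longrightarrow> smooth_on U (\<lambda>x. B (f x) (g x))"
  by (simp add: smooth_on_def Ck_on_bilinear)

lemma smooth_on_bounded_linear:
  "open U \<Longrightarrow> bounded_linear L \<Longrightarrow> smooth_on U f \<Longrightarrow> smooth_on U (\<lambda>x. L (f x))"
  by (simp add: smooth_on_def Ck_on_bounded_linear)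

lemma smooth_on_componentwise:
  fixes f :: "'a::euclidean_space \<Rightarrow> 'b::euclidean_space"
  shows "open U \<Longrightarrow> (\<And>b. b \<in> Basis \<Longrightarrow> smooth_on U (\<lambda>x. f x \<bullet> b)) \<Longrightarrow> smooth_on U f"
  unfolding smooth_on_def by (auto intro: Ck_on_componentwise)

lemma smooth_on_compose:
  fixes f :: "'c::euclidean_space \<Rightarrow> 'b::real_normed_vector"
  shows "open U \<Longrightarrow> open V \<Longrightarrow> smooth_on V f \<Longrightarrow> smooth_on U g \<Longrightarrow> (\<And>x. x \<in> U \<Longrightarrow> g x \<in> V)
    \<Longrightarrow> smooth_on U (\<lambda>x. f (g x))"
  unfolding smooth_on_def by (auto intro: Ck_on_compose)

lemma smooth_on_mult:
  fixes f g :: "'a::euclidean_space \<Rightarrow> real"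
  shows "open U \<Longrightarrow> smooth_on U f \<Longrightarrow> smooth_on U g \<Longrightarrow> smooth_on U (\<lambda>x. f x * g x)"
  by (rule smooth_on_bilinear[OF _ bounded_bilinear_mult])

lemma smooth_on_uminus: "open U \<Longrightarrow> smooth_on U f \<Longrightarrow> smooth_on U (\<lambda>x. - f x)"
  by (rule smooth_on_bounded_linear[OF _ bounded_linear_minus[OF bounded_linear_ident]])

lemma smooth_on_diff:
  "open U \<Longrightarrow> smooth_on U f \<Longrightarrow> smooth_on U g \<Longrightarrow> smooth_on U (\<lambda>x. f x - g x)"
  using smooth_on_add[OF _ _ smooth_on_uminus, of U f g] by simp

lemma smooth_on_prod:
  fixes f :: "'i \<Rightarrow> 'a::euclidean_space \<Rightarrow> real"
  shows "open U \<Longrightarrow> (\<And>i. i \<in> I \<Longrightarrow> smooth_on U (f i)) \<Longrightarrow> smooth_on U (\<lambda>x. \<Prod>i\<in>I. f i x)"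
  by (induction I rule: infinite_finite_induct) (auto intro!: smooth_on_const smooth_on_mult)

lemma smooth_on_power:
  fixes f :: "'a::euclidean_space \<Rightarrow> real"
  shows "open U \<Longrightarrow> smooth_on U f \<Longrightarrow> smooth_on U (\<lambda>x. f x ^ j)"
  by (induction j) (auto intro: smooth_on_const smooth_on_mult)

lemma smooth_on_dd:
  assumes "open U" "smooth_on U f"
  shows "smooth_on U (\<lambda>x. dd f x v)"
proof -
  have "smooth_on U (\<lambda>x. dd f x e)" if "e \<in> Basis" for e
    using assms(2) that unfolding smooth_on_def by (metis Ck_on.simps(2))
  then have *: "smooth_on U (\<lambda>x. \<Sum>e\<in>Basis. (v \<bullet> e) *\<^sub>R dd f x e)"
    by (intro smooth_on_sum smooth_on_bounded_linear[OF _ bounded_linear_scaleR_right] assms(1))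
  show ?thesis
    by (rule smooth_on_cong[OF assms(1) _ *])
       (simp add: has_derivative_basis_expansion[OF has_derivative_linear[OF smooth_on_has_derivative[OF assms(2)]], symmetric])
qed

text \<open>The derivative is polynomial in \<open>inverse\<close> itself, so class \<open>k\<close>
  of \<open>inverse\<close> gives class \<open>k + 1\<close>.\<close>

lemma smooth_on_inverse: "smooth_on (- {0::real}) inverse"
proof -
  have o: "open (- {0::real})" by (rule open_Compl) simp
  have "Ck_on k (- {0::real}) inverse" for k
  proof (induction k)
    case 0
    show ?case by (simp add: continuous_on_inverse continuous_on_id)
  next
    case (Suc k)
    note mult = Ck_on_bilinear[OF o bounded_bilinear_mult]
    show ?case
    proof (rule Ck_on_SucI[OF o, where f' = "\<lambda>x h. - (inverse x * h * inverse x)"])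
      show "(inverse has_derivative (\<lambda>h. - (inverse x * h * inverse x))) (at x)" if "x \<in> - {0::real}" for x
        using that has_derivative_inverse'[of x UNIV] by simp
      show "Ck_on k (- {0::real}) (\<lambda>x. - (inverse x * e * inverse x))" for e
        by (rule Ck_on_bounded_linear[OF o bounded_linear_minus[OF bounded_linear_ident]
              mult[OF mult[OF Suc Ck_on_const[OF o]] Suc]])
    qed
  qed
  then show ?thesis by (simp add: smooth_on_def)
qed

lemma smooth_on_divide:
  fixes f g :: "'a::euclidean_space \<Rightarrow> real"
  assumes "open U" "smooth_on U f" "smooth_on U g" "\<And>x. x \<in> U \<Longrightarrow> g x \<noteq> 0"
  shows "smooth_on U (\<lambda>x. f x / g x)"
proof -
  have o: "open (- {0::real})" by (rule open_Compl) simp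
  have "smooth_on U (\<lambda>x. inverse (g x))"
    by (rule smooth_on_compose[OF assms(1) o smooth_on_inverse assms(3)]) (simp add: assms(4))
  from smooth_on_mult[OF assms(1,2) this] show ?thesis
    by (simp only: divide_inverse)
qed

text \<open>The derivative is a constant times \<open>inverse (sqrt x)\<close>, so each order
  follows from the previous one by composition.\<close>

lemma smooth_on_sqrt: "smooth_on {0::real<..} sqrt"
proof -
  have o: "open {0::real<..}" by simp
  have "Ck_on k {0::real<..} sqrt" for k
  proof (induction k)
    case 0
    show ?case by (simp add: continuous_on_real_sqrt continuous_on_id)
  next
    case (Suc k)
    have nz: "open (- {0::real})" by (rule open_Compl) simp
    have i: "Ck_on k {0::real<..} (\<lambda>x. inverse (sqrt x))"
      by (rule Ck_on_compose[OF o nz smooth_on_Ck[OF smooth_on_inverse] Suc]) auto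
    show ?case
    proof (rule Ck_on_SucI[OF o, where f' = "\<lambda>x h. h * (inverse (sqrt x) * (1/2))"])
      show "(sqrt has_derivative (\<lambda>h. h * (inverse (sqrt x) * (1/2)))) (at x)" if "x \<in> {0<..}" for x
      proof -
        have "(\<lambda>h. h * (inverse (sqrt x) * (1/2))) = (*) (inverse (sqrt x) / 2)"
          by (simp add: fun_eq_iff)
        then show ?thesis
          using that DERIV_real_sqrt[of x] by (simp only: has_field_derivative_def) simp
      qed
    qed (intro Ck_on_bilinear[OF o bounded_bilinear_mult] Ck_on_const o i)
  qed
  then show ?thesis by (simp add: smooth_on_def)
qed

section \<open>Smoothness of vector-valued and matrix-valued maps\<close>

lemma Basis_vec: "b \<in> (Basis :: (real^'k) set) \<Longrightarrow> \<exists>i. b = axis i 1"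
  by (auto simp: Basis_vec_def)

lemma Basis_mat: "b \<in> (Basis :: (real^'k^'j) set) \<Longrightarrow> \<exists>i j. b = axis i (axis j 1)"
  by (auto simp: Basis_vec_def)

lemma smooth_on_vecI:
  fixes f :: "'a::euclidean_space \<Rightarrow> real^'k"
  assumes "open U" "\<And>i. smooth_on U (\<lambda>x. f x $ i)"
  shows "smooth_on U f"
  by (rule smooth_on_componentwise[OF assms(1)])
     (use assms(2) in \<open>auto dest!: Basis_vec simp: inner_axis\<close>)

lemma smooth_on_matI:
  fixes f :: "'a::euclidean_space \<Rightarrow> real^'k^'j"
  assumes "open U" "\<And>i j. smooth_on U (\<lambda>x. f x $ i $ j)"
  shows "smooth_on U f"
  by (rule smooth_on_componentwise[OF assms(1)])
     (use assms(2) in \<open>auto dest!: Basis_mat simp: inner_axis\<close>)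

lemma smooth_on_vec_nth:
  fixes f :: "'a::euclidean_space \<Rightarrow> 'b::euclidean_space^'k"
  shows "open U \<Longrightarrow> smooth_on U f \<Longrightarrow> smooth_on U (\<lambda>x. f x $ i)"
  by (rule smooth_on_bounded_linear[OF _ bounded_linear_vec_nth])

lemma smooth_on_mat_nth:
  fixes f :: "'a::euclidean_space \<Rightarrow> real^'k^'j"
  shows "open U \<Longrightarrow> smooth_on U f \<Longrightarrow> smooth_on U (\<lambda>x. f x $ i $ j)"
  by (intro smooth_on_vec_nth)

lemma smooth_on_det:
  fixes M :: "'a::euclidean_space \<Rightarrow> real^'k^'k"
  shows "open U \<Longrightarrow> smooth_on U M \<Longrightarrow> smooth_on U (\<lambda>x. det (M x))"
  unfolding det_def
  by (intro smooth_on_sum smooth_on_mult smooth_on_const smooth_on_prod smooth_on_mat_nth)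

lemma smooth_on_cof:
  fixes M :: "'a::euclidean_space \<Rightarrow> real^'k^'k"
  assumes "open U" "smooth_on U M"
  shows "smooth_on U (\<lambda>x. cof (M x))"
proof (rule smooth_on_matI[OF assms(1)])
  fix i j
  have *: "smooth_on U (\<lambda>x. (\<chi> k l. if l = i then (if k = j then 1 else 0) else M x $ k $ l)::real^'k^'k)"
  proof (rule smooth_on_matI[OF assms(1)])
    show "smooth_on U (\<lambda>x. (\<chi> k l. if l = i then if k = j then 1 else 0 else M x $ k $ l) $ a $ b)" for a b
      by (cases "b = i") (simp_all add: smooth_on_const smooth_on_mat_nth assms)
  qed
  show "smooth_on U (\<lambda>x. cof (M x) $ i $ j)"
    unfolding cof_def by (simp add: smooth_on_det[OF assms(1) *])
qed

lemma mat_mult: "mat d ** M = d *\<^sub>R M" "M ** mat d = d *\<^sub>R M" for M :: "real^'k^'k"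
  by (simp_all add: vec_eq_iff matrix_matrix_mult_def mat_def if_distrib if_distribR sum.delta sum.delta' mult.commute
      cong: if_cong)

lemma matrix_inv_mult:
  fixes M :: "real^'k^'k"
  assumes "det M \<noteq> 0"
  shows "M ** matrix_inv M = mat 1" "matrix_inv M ** M = mat 1"
proof -
  have "\<exists>A'. M ** A' = mat 1 \<and> A' ** M = mat 1"
    using assms invertible_det_nz[of M] by (simp add: invertible_def)
  from someI_ex[OF this] show "M ** matrix_inv M = mat 1" "matrix_inv M ** M = mat 1"
    by (simp_all add: matrix_inv_def)
qed

lemma matrix_inv_eq_cof:
  fixes M :: "real^'k^'k"
  assumes "det M \<noteq> 0"
  shows "matrix_inv M = (1 / det M) *\<^sub>R cof M"
proof -
  have "cof M = cof M ** (M ** matrix_inv M)"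
    using assms by (simp add: matrix_inv_mult)
  also have "\<dots> = det M *\<^sub>R matrix_inv M"
    by (simp add: matrix_mul_assoc cof_mult_left mat_mult)
  finally show ?thesis using assms by simp
qed

lemma smooth_on_matrix_inv:
  fixes M :: "'a::euclidean_space \<Rightarrow> real^'k^'k"
  assumes "open U" "smooth_on U M" "\<And>x. x \<in> U \<Longrightarrow> det (M x) \<noteq> 0"
  shows "smooth_on U (\<lambda>x. matrix_inv (M x))"
proof -
  have *: "smooth_on U (\<lambda>x. (1 / det (M x)) *\<^sub>R cof (M x))"
    by (intro smooth_on_bilinear[OF _ bounded_bilinear_scaleR] smooth_on_divide smooth_on_const
        smooth_on_det smooth_on_cof assms)
  show ?thesis
    by (rule smooth_on_cong[OF assms(1) _ *]) (simp add: matrix_inv_eq_cof assms(3))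
qed

lemma smooth_on_df:
  fixes f :: "real^'k \<Rightarrow> real"
  shows "open U \<Longrightarrow> smooth_on U f \<Longrightarrow> smooth_on U (df f)"
  by (rule smooth_on_vecI) (simp_all add: df_def pd_def smooth_on_dd)

lemma smooth_on_matrix_vector_mult:
  fixes M :: "'a::euclidean_space \<Rightarrow> real^'k^'j" and w :: "'a \<Rightarrow> real^'k"
  assumes "open U" "smooth_on U M" "smooth_on U w"
  shows "smooth_on U (\<lambda>x. M x *v w x)"
  by (rule smooth_on_vecI[OF assms(1)])
     (auto simp: matrix_vector_mult_def intro!: smooth_on_sum smooth_on_mult smooth_on_vec_nth smooth_on_mat_nth assms)

lemma smooth_on_vector_matrix_mult:
  fixes M :: "'a::euclidean_space \<Rightarrow> real^'k^'j" and w :: "'a \<Rightarrow> real^'j"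
  assumes "open U" "smooth_on U w" "smooth_on U M"
  shows "smooth_on U (\<lambda>x. w x v* M x)"
  by (rule smooth_on_vecI[OF assms(1)])
     (auto simp: vector_matrix_mult_def intro!: smooth_on_sum smooth_on_mult smooth_on_vec_nth smooth_on_mat_nth assms)

lemma smooth_on_matrix_mult:
  fixes M :: "'a::euclidean_space \<Rightarrow> real^'k^'j" and N :: "'a \<Rightarrow> real^'l^'k"
  assumes "open U" "smooth_on U M" "smooth_on U N"
  shows "smooth_on U (\<lambda>x. M x ** N x)"
  by (rule smooth_on_matI[OF assms(1)])
     (auto simp: matrix_matrix_mult_def intro!: smooth_on_sum smooth_on_mult smooth_on_mat_nth assms)

lemma smooth_on_inner:
  fixes f h :: "'a::euclidean_space \<Rightarrow> 'b::real_inner"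
  shows "open U \<Longrightarrow> smooth_on U f \<Longrightarrow> smooth_on U h \<Longrightarrow> smooth_on U (\<lambda>x. f x \<bullet> h x)"
  by (rule smooth_on_bilinear[OF _ bounded_bilinear_inner])

section \<open>Derivatives along curves, mixed derivatives and the inverse function\<close>

interpretation mm: bounded_bilinear "(**) :: real^'k::finite^'j::finite \<Rightarrow> real^'l::finite^'k \<Rightarrow> real^'l^'j"
  by (simp add: bilinear_conv_bounded_bilinear[symmetric] bilinear_def linear_iff vec_eq_iff
      matrix_matrix_mult_def sum.distrib algebra_simps sum_distrib_left)

interpretation mv: bounded_bilinear "(*v) :: real^'k::finite^'j::finite \<Rightarrow> real^'k \<Rightarrow> real^'j"
  by (simp add: bilinear_conv_bounded_bilinear[symmetric] bilinear_def linear_iff vec_eq_iff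
      matrix_vector_mult_def sum.distrib algebra_simps sum_distrib_left)

interpretation vm: bounded_bilinear "(v*) :: real^'j::finite \<Rightarrow> real^'k::finite^'j \<Rightarrow> real^'k"
  by (simp add: bilinear_conv_bounded_bilinear[symmetric] bilinear_def linear_iff vec_eq_iff
      vector_matrix_mult_def sum.distrib algebra_simps sum_distrib_left)

section \<open>Differentiation along curves and lines\<close>

lemma has_vector_derivative_compose:
  assumes "(f has_derivative f') (at (\<gamma> t))" "(\<gamma> has_vector_derivative v) (at t)"
  shows "((\<lambda>\<tau>. f (\<gamma> \<tau>)) has_vector_derivative f' v) (at t)"
proof -
  have "((\<lambda>\<tau>. f (\<gamma> \<tau>)) has_derivative (\<lambda>h. f' (h *\<^sub>R v))) (at t)"
    by (rule has_derivative_compose[OF assms(2)[unfolded has_vector_derivative_def] assms(1)])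
  then show ?thesis
    using has_derivative_linear[OF assms(1)] by (simp add: has_vector_derivative_def linear_scale)
qed

lemma dd_curve:
  assumes "smooth_on U f" "\<gamma> t \<in> U" "(\<gamma> has_vector_derivative v) (at t)"
  shows "((\<lambda>\<tau>. f (\<gamma> \<tau>)) has_vector_derivative dd f (\<gamma> t) v) (at t)"
  using has_vector_derivative_compose[OF smooth_on_has_derivative[OF assms(1,2)] assms(3)] .

lemma line_has_vector_derivative: "((\<lambda>r. q + r *\<^sub>R v) has_vector_derivative v) (at r)"
  by (auto intro!: derivative_eq_intros simp: has_vector_derivative_def)

lemma dd_line:
  fixes f :: "'a::euclidean_space \<Rightarrow> real"
  assumes "smooth_on U f" "q + r *\<^sub>R v \<in> U"
  shows "((\<lambda>r. f (q + r *\<^sub>R v)) has_real_derivative dd f (q + r *\<^sub>R v) v) (at r)"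
  using dd_curve[OF assms line_has_vector_derivative]
  by (simp add: has_real_derivative_iff_has_vector_derivative)

lemma dd_eqI:
  assumes "smooth_on U f" "q \<in> U" "((\<lambda>r. f (q + r *\<^sub>R v)) has_vector_derivative d) (at 0)"
  shows "dd f q v = d"
  using dd_curve[OF assms(1) _ line_has_vector_derivative, of q 0 v] assms(2,3)
  by (auto dest: vector_derivative_unique_at)

text \<open>Two applications of the mean value theorem: first in the direction \<open>a\<close> to
  the difference of \<open>f\<close> over a step in the direction \<open>b\<close>, then in the
  direction \<open>b\<close>. The second difference on the left is symmetric in \<open>a\<close> and
  \<open>b\<close>, which the right side does not show.\<close>

lemma mixed_difference:
  fixes f :: "'a::euclidean_space \<Rightarrow> real"
  assumes U: "open U" "smooth_on U f" and h: "0 < h"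
    and box: "\<And>s t. s \<in> {0..h} \<Longrightarrow> t \<in> {0..h} \<Longrightarrow> q + s *\<^sub>R a + t *\<^sub>R b \<in> U"
  shows "\<exists>s\<in>{0..h}. \<exists>t\<in>{0..h}. f (q + h *\<^sub>R a + h *\<^sub>R b) - f (q + h *\<^sub>R a) - f (q + h *\<^sub>R b) + f q
    = h * h * dd (\<lambda>z. dd f z a) (q + s *\<^sub>R a + t *\<^sub>R b) b"
proof -
  define G where "G = (\<lambda>s. f (q + h *\<^sub>R b + s *\<^sub>R a) - f (q + s *\<^sub>R a))"
  have "DERIV G s :> dd f (q + h *\<^sub>R b + s *\<^sub>R a) a - dd f (q + s *\<^sub>R a) a" if "0 \<le> s" "s \<le> h" for s
    unfolding G_def
    by (intro DERIV_diff dd_line[OF U(2)]) (use box[of s h] box[of s 0] that h in \<open>auto simp: algebra_simps\<close>)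
  from MVT2[OF h this] obtain s where s: "0 < s" "s < h"
    and G: "G h - G 0 = h * (dd f (q + h *\<^sub>R b + s *\<^sub>R a) a - dd f (q + s *\<^sub>R a) a)"
    by auto
  have "DERIV (\<lambda>t. dd f (q + s *\<^sub>R a + t *\<^sub>R b) a) t :> dd (\<lambda>z. dd f z a) (q + s *\<^sub>R a + t *\<^sub>R b) b"
    if "0 \<le> t" "t \<le> h" for t
    by (rule dd_line[OF smooth_on_dd[OF U]]) (use box[of s t] s that in auto)
  from MVT2[OF h this] obtain t where t: "0 < t" "t < h"
    and "dd f (q + s *\<^sub>R a + h *\<^sub>R b) a - dd f (q + s *\<^sub>R a + 0 *\<^sub>R b) a
      = h * dd (\<lambda>z. dd f z a) (q + s *\<^sub>R a + t *\<^sub>R b) b"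
    by auto
  then have "G h - G 0 = h * (h * dd (\<lambda>z. dd f z a) (q + s *\<^sub>R a + t *\<^sub>R b) b)"
    using G by (simp add: algebra_simps)
  then show ?thesis
    using s t unfolding G_def
    by (intro bexI[of _ s] bexI[of _ t]) (auto simp: algebra_simps)
qed

text \<open>If the two mixed derivatives differed, continuity would keep them apart on a small
  parallelogram, where \<open>mixed_difference\<close>, read in both orders, produces a common
  value.\<close>

lemma dd_commute:
  fixes f :: "'a::euclidean_space \<Rightarrow> real"
  assumes U: "open U" "smooth_on U f" and q: "q \<in> U"
  shows "dd (\<lambda>z. dd f z a) q b = dd (\<lambda>z. dd f z b) q a"
proof (rule ccontr)
  define A where "A = (\<lambda>z. dd (\<lambda>z. dd f z a) z b)"
  define B where "B = (\<lambda>z. dd (\<lambda>z. dd f z b) z a)"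
  assume "\<not> ?thesis"
  then have e: "\<bar>A q - B q\<bar> / 2 > 0" by (simp add: A_def B_def)
  have "continuous_on U A" "continuous_on U B"
    unfolding A_def B_def using U by (auto intro!: smooth_on_continuous_on smooth_on_dd)
  then have "isCont A q" "isCont B q"
    using U(1) q by (auto simp: continuous_on_eq_continuous_at)
  then obtain d1 d2 where d1: "d1 > 0" "\<And>z. dist z q < d1 \<Longrightarrow> dist (A z) (A q) < \<bar>A q - B q\<bar> / 2"
    and d2: "d2 > 0" "\<And>z. dist z q < d2 \<Longrightarrow> dist (B z) (B q) < \<bar>A q - B q\<bar> / 2"
    using e unfolding continuous_at_eps_delta by (metis dist_commute)
  obtain d3 where d3: "d3 > 0" "ball q d3 \<subseteq> U" using U(1) q openE by blast
  define d where "d = min d1 (min d2 d3)"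
  \<comment> \<open>The summand 1 keeps the denominator positive if both \<open>a\<close> and
    \<open>b\<close> vanish.\<close>
  define h where "h = d / (2 * (norm a + norm b + 1))"
  have d: "d > 0" using d1 d2 d3 by (simp add: d_def)
  then have h: "h > 0" unfolding h_def by (intro divide_pos_pos) (auto intro: add_nonneg_pos)
  have "h * (norm a + norm b) < d"
  proof -
    have n: "norm a + norm b + 1 > 0" by (simp add: add_nonneg_pos)
    have "h * (norm a + norm b) \<le> h * (norm a + norm b + 1)" using h by simp
    also have "\<dots> = d / 2"
      using n unfolding h_def by (simp only: times_divide_eq_left mult.commute[of 2]
        mult_divide_mult_cancel_left_if[of "norm a + norm b + 1" d 2, symmetric]) (simp add: mult_ac)
    finally show ?thesis using d by simp
  qed
  then have near: "dist (q + s *\<^sub>R a + t *\<^sub>R b) q < d" if "s \<in> {0..h}" "t \<in> {0..h}" for s t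
  proof -
    have "dist (q + s *\<^sub>R a + t *\<^sub>R b) q \<le> norm (s *\<^sub>R a) + norm (t *\<^sub>R b)"
      by (simp add: dist_norm) (metis norm_scaleR norm_triangle_ineq)
    also have "\<dots> \<le> h * norm a + h * norm b"
      using that by (auto intro!: add_mono mult_right_mono)
    finally show ?thesis using \<open>h * (norm a + norm b) < d\<close> by (simp add: algebra_simps)
  qed
  have in_U: "q + s *\<^sub>R a + t *\<^sub>R b \<in> U" if "s \<in> {0..h}" "t \<in> {0..h}" for s t
    using near[OF that] d3(2) by (auto simp: d_def dist_commute)
  obtain s t where st: "s \<in> {0..h}" "t \<in> {0..h}"
    and 1: "f (q + h *\<^sub>R a + h *\<^sub>R b) - f (q + h *\<^sub>R a) - f (q + h *\<^sub>R b) + f q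
      = h * h * A (q + s *\<^sub>R a + t *\<^sub>R b)"
    using mixed_difference[OF U h in_U] unfolding A_def by auto
  have swap: "q + s *\<^sub>R b + t *\<^sub>R a = q + t *\<^sub>R a + s *\<^sub>R b" for s t
    by simp
  have in_U': "q + s *\<^sub>R b + t *\<^sub>R a \<in> U" if "s \<in> {0..h}" "t \<in> {0..h}" for s t
    unfolding swap by (rule in_U[OF that(2,1)])
  obtain s' t' where st': "s' \<in> {0..h}" "t' \<in> {0..h}"
    and 2: "f (q + h *\<^sub>R b + h *\<^sub>R a) - f (q + h *\<^sub>R b) - f (q + h *\<^sub>R a) + f q
      = h * h * B (q + t' *\<^sub>R a + s' *\<^sub>R b)"
    using mixed_difference[OF U h in_U'] unfolding B_def swap by auto
  have "h * h * A (q + s *\<^sub>R a + t *\<^sub>R b) = h * h * B (q + t' *\<^sub>R a + s' *\<^sub>R b)"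
    using 1 2 unfolding swap by linarith
  then have "A (q + s *\<^sub>R a + t *\<^sub>R b) = B (q + t' *\<^sub>R a + s' *\<^sub>R b)"
    using h by simp
  moreover have "dist (A (q + s *\<^sub>R a + t *\<^sub>R b)) (A q) < \<bar>A q - B q\<bar> / 2"
    using near[OF st] by (intro d1) (simp add: d_def)
  moreover have "dist (B (q + t' *\<^sub>R a + s' *\<^sub>R b)) (B q) < \<bar>A q - B q\<bar> / 2"
    using near[OF st'(2,1)] by (intro d2) (simp add: d_def)
  ultimately show False unfolding dist_real_def by (smt (verit) field_sum_of_halves)
qed

text \<open>Cramer's rule without division, hence also for singular \<open>M\<close>:
  \<open>c\<close> is expanded in unit vectors and the determinant is linear in the replaced
  column.\<close>

lemma cof_mult_vec:
  fixes M :: "real^'k^'k"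
  shows "(cof M *v c) $ k = det (\<chi> i l. if l = k then c $ i else M $ i $ l)"
proof -
  have tr: "det (\<chi> a l. if l = k then v $ a else M $ a $ l)
       = det (\<chi> l. if l = k then v else transpose M $ l)" for v :: "real^'k"
    by (subst det_transpose[symmetric])
       (rule arg_cong[where f = det], auto simp: transpose_def vec_eq_iff)
  have c: "c = (\<Sum>j\<in>UNIV. c $ j *s axis j 1)"
    by (simp add: vec_eq_iff axis_def if_distrib cong: if_cong)
  have "det (\<chi> i l. if l = k then c $ i else M $ i $ l)
    = det (\<chi> l. if l = k then \<Sum>j\<in>UNIV. c $ j *s axis j 1 else transpose M $ l)"
    unfolding tr by (subst (1) c) (rule refl)
  also have "\<dots> = (\<Sum>j\<in>UNIV. c $ j * det (\<chi> l. if l = k then axis j 1 else transpose M $ l))"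
    by (subst det_linear_row_sum) (simp_all add: det_row_mul)
  also have "\<dots> = (\<Sum>j\<in>UNIV. c $ j * cof M $ k $ j)"
    unfolding tr[symmetric] cof_def axis_def vec_lambda_beta by (rule refl)
  finally show ?thesis
    by (simp add: matrix_vector_mult_def mult.commute)
qed

lemma trace_cof_mult:
  fixes M :: "real^'k^'k"
  shows "trace (cof M ** X) = (\<Sum>k\<in>UNIV. det (\<chi> i l. if l = k then X $ i $ l else M $ i $ l))"
proof -
  have "(cof M ** X) $ k $ k = det (\<chi> i l. if l = k then X $ i $ l else M $ i $ l)" for k
  proof -
    have "(cof M ** X) $ k $ k = (cof M *v column k X) $ k"
      by (simp add: matrix_matrix_mult_def matrix_vector_mult_def column_def)
    also have "\<dots> = det (\<chi> i l. if l = k then X $ i $ l else M $ i $ l)"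
      unfolding cof_mult_vec by (rule arg_cong[where f = det]) (simp add: vec_eq_iff column_def)
    finally show ?thesis .
  qed
  then show ?thesis by (simp add: trace_def)
qed

text \<open>Jacobi's formula. The product rule in the Leibniz expansion differentiates one column at
  a time, and \<open>trace_cof_mult\<close> collects these determinants. No invertibility enters, as
  is essential at the roots of the pencil.\<close>

lemma has_derivative_det:
  fixes M :: "real \<Rightarrow> real^'k^'k"
  assumes "(M has_vector_derivative M') (at t)"
  shows "((\<lambda>t. det (M t)) has_real_derivative trace (cof (M t) ** M')) (at t)"
proof -
  have nth: "((\<lambda>t. M t $ i $ j) has_derivative (\<lambda>h. h * M' $ i $ j)) (at t)" for i j
    using bounded_linear.has_vector_derivative[OF bounded_linear_vec_nth,
        OF bounded_linear.has_vector_derivative[OF bounded_linear_vec_nth], OF assms, of i j]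
    by (simp add: has_vector_derivative_def)
  \<comment> \<open>Transposed, so that the factor with index \<open>k\<close> comes from column
    \<open>k\<close>, the one that \<open>trace_cof_mult\<close> replaces.\<close>
  have det_cols: "det X = (\<Sum>p | p permutes UNIV. of_int (sign p) * (\<Prod>k\<in>UNIV. X $ p k $ k))" for X :: "real^'k^'k"
    using det_transpose[of X] unfolding det_def by (simp add: transpose_def)
  have rep: "(\<Prod>l\<in>UNIV. (\<chi> i l. if l = k then M' $ i $ l else M t $ i $ l) $ p l $ l)
     = M' $ p k $ k * (\<Prod>l\<in>UNIV - {k}. M t $ p l $ l)" for p :: "'k \<Rightarrow> 'k" and k
    by (subst prod.remove[of UNIV k]) (auto intro!: prod.cong)
  have "((\<lambda>t. \<Sum>p | p permutes UNIV. of_int (sign p) * (\<Prod>k\<in>UNIV. M t $ p k $ k)) has_derivative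
     (\<lambda>h. \<Sum>p | p permutes UNIV. of_int (sign p) *
        (\<Sum>k\<in>UNIV. h * M' $ p k $ k * (\<Prod>l\<in>UNIV - {k}. M t $ p l $ l)))) (at t)"
    by (intro has_derivative_sum has_derivative_mult_right has_derivative_prod nth)
  also have "(\<lambda>h. \<Sum>p | p permutes UNIV. of_int (sign p) *
        (\<Sum>k\<in>UNIV. h * M' $ p k $ k * (\<Prod>l\<in>UNIV - {k}. M t $ p l $ l)))
     = (\<lambda>h. trace (cof (M t) ** M') * h)"
  proof
    fix h :: real
    have "trace (cof (M t) ** M') = (\<Sum>k\<in>UNIV. \<Sum>p | p permutes UNIV. of_int (sign p) *
        (M' $ p k $ k * (\<Prod>l\<in>UNIV - {k}. M t $ p l $ l)))"
      unfolding trace_cof_mult det_cols rep by (rule refl)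
    also have "\<dots> = (\<Sum>p | p permutes UNIV. of_int (sign p) *
        (\<Sum>k\<in>UNIV. M' $ p k $ k * (\<Prod>l\<in>UNIV - {k}. M t $ p l $ l)))"
      by (subst sum.swap) (simp add: sum_distrib_left)
    finally show "(\<Sum>p | p permutes UNIV. of_int (sign p) *
        (\<Sum>k\<in>UNIV. h * M' $ p k $ k * (\<Prod>l\<in>UNIV - {k}. M t $ p l $ l)))
      = trace (cof (M t) ** M') * h"
      by (simp add: sum_distrib_left mult_ac)
  qed
  finally show ?thesis
    unfolding has_field_derivative_def det_cols .
qed

lemma has_vector_derivative_matrix_inv:
  fixes M :: "real \<Rightarrow> real^'k^'k"
  assumes M: "(M has_vector_derivative M') (at t)" and N: "(N has_vector_derivative N') (at t)"
    and T: "open T" "t \<in> T" and inv: "\<And>\<tau>. \<tau> \<in> T \<Longrightarrow> N \<tau> ** M \<tau> = mat 1"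
  shows "N' = - (N t ** M' ** N t)"
proof -
  have "((\<lambda>\<tau>. N \<tau> ** M \<tau>) has_vector_derivative (N t ** M' + N' ** M t)) (at t)"
    by (rule mm.has_vector_derivative[OF N M])
  moreover have "((\<lambda>\<tau>. N \<tau> ** M \<tau>) has_vector_derivative 0) (at t)"
    by (rule has_vector_derivative_transform_within_open[where f = "\<lambda>_. mat 1", OF _ T])
       (auto simp: inv intro: has_vector_derivative_const)
  ultimately have "N t ** M' + N' ** M t = 0"
    by (rule vector_derivative_unique_at)
  then have "N t ** M' ** N t + N' ** (M t ** N t) = 0"
    by (metis mm.add_left mm.zero_left matrix_mul_assoc)
  moreover have "M t ** N t = mat 1"
    using inv[OF T(2)] matrix_left_right_inverse by blast
  ultimately show ?thesis by (simp add: eq_neg_iff_add_eq_0 add.commute)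
qed

lemma continuous_on_Blinfun_derivative:
  fixes f :: "'a::euclidean_space \<Rightarrow> 'b::real_normed_vector"
  assumes "open U" "smooth_on U f"
  shows "continuous_on U (\<lambda>q. Blinfun (frechet_derivative f (at q)))"
proof (rule continuous_on_blinfun_componentwise)
  fix e :: 'a
  have "continuous_on U (\<lambda>q. dd f q e)"
    by (rule smooth_on_continuous_on[OF smooth_on_dd[OF assms]])
  then show "continuous_on U (\<lambda>q. blinfun_apply (Blinfun (frechet_derivative f (at q))) e)"
    by (rule continuous_on_eq)
       (simp add: bounded_linear_Blinfun_apply has_derivative_bounded_linear[OF smooth_on_has_derivative[OF assms(2)]])
qed

abbreviation jac :: "(real^'k \<Rightarrow> real^'k) \<Rightarrow> real^'k \<Rightarrow> real^'k^'k::finite" where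
  "jac f q \<equiv> matrix (frechet_derivative f (at q))"

text \<open>Smoothness of the inverse is bootstrapped: its derivative at \<open>y\<close> is the
  inverse matrix of \<open>jac f (g y)\<close>, a smooth function of \<open>g y\<close>, so class
  \<open>k\<close> of \<open>g\<close> gives class \<open>k + 1\<close>.\<close>

lemma smooth_local_inverse:
  fixes f :: "real^'k::finite \<Rightarrow> real^'k"
  assumes U: "open U" "smooth_on U f" and nz: "\<And>q. q \<in> U \<Longrightarrow> det (jac f q) \<noteq> 0" and q0: "q0 \<in> U"
  obtains Q B g where "open Q" "Q \<subseteq> U" "q0 \<in> Q" "open B" "f q0 \<in> B" "homeomorphism Q B f g" "smooth_on B g"
proof -
  define f' where "f' = (\<lambda>q. Blinfun (frechet_derivative f (at q)))"
  have bl: "bounded_linear (frechet_derivative f (at q))" if "q \<in> U" for q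
    using smooth_on_has_derivative[OF U(2) that] by (rule has_derivative_bounded_linear)
  have f': "blinfun_apply (f' q) v = jac f q *v v" if "q \<in> U" for q v
    using bl[OF that] by (simp add: f'_def bounded_linear_Blinfun_apply)
  have der: "(f has_derivative blinfun_apply (f' q)) (at q)" if "q \<in> U" for q
    using smooth_on_has_derivative[OF U(2) that] bl[OF that]
    by (simp add: f'_def bounded_linear_Blinfun_apply)
  have "continuous_on U f'"
    unfolding f'_def by (rule continuous_on_Blinfun_derivative[OF U])
  moreover have "Blinfun (\<lambda>v. matrix_inv (jac f q0) *v v) o\<^sub>L f' q0 = id_blinfun"
    by (rule blinfun_eqI)
       (simp add: bounded_linear_Blinfun_apply f'[OF q0] matrix_vector_mul_assoc matrix_inv_mult nz q0
         matrix_vector_mul_bounded_linear)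
  ultimately obtain Q B g g' where Q: "open Q" "Q \<subseteq> U" "q0 \<in> Q" "open B" "f q0 \<in> B" "homeomorphism Q B f g"
    and g: "\<And>y. y \<in> B \<Longrightarrow> (g has_derivative g' y) (at y)"
      "\<And>y. y \<in> B \<Longrightarrow> g' y = inv (blinfun_apply (f' (g y)))"
    using inverse_function_theorem[OF U(1) der _ q0] by metis
  have gU: "g y \<in> U" if "y \<in> B" for y
    using Q(2,6) that unfolding homeomorphism_def by blast
  have inv_jac: "inv (blinfun_apply (f' q)) = (\<lambda>v. matrix_inv (jac f q) *v v)" if "q \<in> U" for q
    using that by (intro inv_unique_comp)
      (auto simp: fun_eq_iff f' matrix_vector_mul_assoc matrix_inv_mult nz)
  have jac: "smooth_on U (jac f)"
  proof (rule smooth_on_matI[OF U(1)])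
    fix i j
    show "smooth_on U (\<lambda>q. jac f q $ i $ j)"
      by (simp add: matrix_def smooth_on_vec_nth U smooth_on_dd)
  qed
  have inv_smooth: "smooth_on U (\<lambda>q. matrix_inv (jac f q) *v e)" for e
    by (intro smooth_on_matrix_vector_mult smooth_on_matrix_inv smooth_on_const U jac nz)
  have "Ck_on k B g" for k
  proof (induction k)
    case 0
    show ?case using Q(6) by (simp add: homeomorphism_def)
  next
    case (Suc k)
    show ?case
    proof (rule Ck_on_SucI[OF Q(4) g(1)])
      fix e :: "real^'k"
      show "Ck_on k B (\<lambda>y. g' y e)"
      proof (rule Ck_on_cong[OF Q(4)])
        show "Ck_on k B (\<lambda>y. matrix_inv (jac f (g y)) *v e)"
          by (rule Ck_on_compose[OF Q(4) U(1) smooth_on_Ck[OF inv_smooth] Suc gU])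
      qed (simp add: g(2) gU inv_jac)
    qed
  qed
  then have "smooth_on B g" by (simp add: smooth_on_def)
  with Q show thesis using that by blast
qed

text \<open>Leibniz's rule turns a derivative of the integral into an integral of the same kind,
  with \<open>h\<close> replaced by one of its partial derivatives, so the order rises by induction
  over all \<open>h\<close>.\<close>

lemma smooth_on_integral:
  fixes h :: "real \<times> 'a::euclidean_space \<Rightarrow> real"
  assumes X: "open X" "smooth_on X h" and Z: "open Z" and sub: "{0..1} \<times> Z \<subseteq> X"
  shows "smooth_on Z (\<lambda>z. integral {0..1} (\<lambda>\<theta>. h (\<theta>, z)))"
proof -
  have der: "((\<lambda>z. integral {0..1} (\<lambda>\<theta>. h (\<theta>, z))) has_derivative
      (\<lambda>e. integral {0..1} (\<lambda>\<theta>. dd h (\<theta>, z) (0, e)))) (at z)"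
    if h: "smooth_on X h" and z: "z \<in> Z" for h :: "real \<times> 'a \<Rightarrow> real" and z
  proof -
    obtain r where r: "r > 0" "ball z r \<subseteq> Z" using Z z openE by blast
    \<comment> \<open>The partial derivative in \<open>z\<close> as a bounded linear map: the full
      derivative after the embedding of the \<open>z\<close>-directions.\<close>
    define h' where "h' = (\<lambda>z \<theta>. Blinfun (frechet_derivative h (at (\<theta>, z))) o\<^sub>L Blinfun (Pair (0::real)))"
    have P: "bounded_linear (Pair (0::real) :: 'a \<Rightarrow> _)"
      by (rule bounded_linear_Pair[OF bounded_linear_zero bounded_linear_ident])
    have h': "blinfun_apply (h' z \<theta>) = (\<lambda>e. dd h (\<theta>, z) (0, e))" if "(\<theta>, z) \<in> X" for z \<theta>
      using has_derivative_bounded_linear[OF smooth_on_has_derivative[OF h that]] P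
      by (simp add: h'_def fun_eq_iff bounded_linear_Blinfun_apply)
    have in_X: "(\<theta>, w) \<in> X" if "\<theta> \<in> {0..1}" "w \<in> ball z r" for \<theta> w
      using that r(2) sub by blast
    have "continuous_on (ball z r \<times> {0..1}) (\<lambda>x. Blinfun (frechet_derivative h (at (snd x, fst x))))"
      by (rule continuous_on_compose2[OF continuous_on_Blinfun_derivative[OF X(1) h],
            where f = "\<lambda>x. (snd x, fst x)", simplified]) (use in_X in \<open>auto intro!: continuous_intros\<close>)
    then have cont: "continuous_on (ball z r \<times> cbox 0 1) (\<lambda>(z, \<theta>). h' z \<theta>)"
      unfolding h'_def case_prod_beta
      by (intro bounded_bilinear.continuous_on[OF bounded_bilinear_blinfun_compose]) (auto intro: continuous_on_const)
    have hc: "continuous_on {0..1} (\<lambda>\<theta>. h (\<theta>, w))" if "w \<in> ball z r" for w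
      by (rule continuous_on_compose2[OF smooth_on_continuous_on[OF h], where f = "\<lambda>\<theta>. (\<theta>, w)"])
         (use in_X that in \<open>auto intro!: continuous_intros\<close>)
    have "((\<lambda>z. integral (cbox 0 1) (\<lambda>\<theta>. h (\<theta>, z))) has_derivative blinfun_apply (integral (cbox 0 1) (h' z)))
        (at z within ball z r)"
    proof (rule leibniz_rule[where fx = h' and f = "\<lambda>z \<theta>. h (\<theta>, z)"])
      fix w \<theta> assume w: "w \<in> ball z r" and t: "\<theta> \<in> cbox (0::real) 1"
      have "((\<lambda>w. h (\<theta>, w)) has_derivative (\<lambda>e. dd h (\<theta>, w) (0, e))) (at w)"
        by (rule has_derivative_compose[where f = "Pair \<theta>", OF _ smooth_on_has_derivative[OF h]])
           (use in_X w t in \<open>auto intro!: derivative_eq_intros\<close>)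
      then show "((\<lambda>w. h (\<theta>, w)) has_derivative blinfun_apply (h' w \<theta>)) (at w within ball z r)"
        using h'[OF in_X] w t by (auto intro: has_derivative_at_withinI)
    qed (use r hc cont in \<open>auto intro: integrable_continuous_interval\<close>)
    moreover have "blinfun_apply (integral (cbox 0 1) (h' z)) e = integral {0..1} (\<lambda>\<theta>. dd h (\<theta>, z) (0, e))" for e
    proof -
      have "continuous_on (cbox 0 1) (h' z)"
        using continuous_on_compose2[OF cont, of "cbox 0 1" "Pair z"] r by (fastforce intro: continuous_on_Pair continuous_on_const continuous_on_id)
      then have "h' z integrable_on cbox 0 1" by (rule integrable_continuous)
      then have "blinfun_apply (integral (cbox 0 1) (h' z)) e = integral (cbox 0 1) (\<lambda>\<theta>. blinfun_apply (h' z \<theta>) e)"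
        by (rule blinfun_apply_integral)
      also have "\<dots> = integral {0..1} (\<lambda>\<theta>. dd h (\<theta>, z) (0, e))"
        unfolding cbox_interval by (rule integral_cong) (use h'[OF in_X] r in auto)
      finally show ?thesis .
    qed
    ultimately show ?thesis
      using r by (simp add: at_within_open[of z "ball z r"] fun_eq_iff[symmetric] cbox_interval)
        (metis (no_types, lifting) ext)
  qed
  have "Ck_on (Suc k) Z (\<lambda>z. integral {0..1} (\<lambda>\<theta>. h (\<theta>, z)))" if "smooth_on X h" for k and h :: "real \<times> 'a \<Rightarrow> real"
    using that
  proof (induction k arbitrary: h)
    case 0
    have "Ck_on 0 Z (\<lambda>z. integral {0..1} (\<lambda>\<theta>. h (\<theta>, z)))" if "smooth_on X h" for h :: "real \<times> 'a \<Rightarrow> real"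
      unfolding Ck_on.simps
      by (rule has_derivative_continuous_on[OF has_derivative_at_withinI[OF der[OF that]]])
    from Ck_on_SucI[OF Z der[OF 0] this[OF smooth_on_dd[OF X(1) 0]]] show ?case .
  next
    case (Suc k)
    show ?case
      by (rule Ck_on_SucI[OF Z der[OF Suc.prems] Suc.IH[OF smooth_on_dd[OF X(1) Suc.prems]]])
  qed
  with X(2) show ?thesis unfolding smooth_on_def using Ck_on_SucD by blast
qed

section \<open>Matrices\<close>

definition outer :: "real^'k \<Rightarrow> real^'l \<Rightarrow> real^'l^'k" where
  "outer a b = (\<chi> i j. a $ i * b $ j)"

lemma outer_mult:
  "outer a b *v x = (b \<bullet> x) *\<^sub>R a" "x v* outer a b = (x \<bullet> a) *\<^sub>R b"
  "M ** outer a b = outer (M *v a) b" "outer a b ** N = outer a (b v* N)"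
  by (simp_all add: outer_def vec_eq_iff matrix_vector_mult_def vector_matrix_mult_def
      matrix_matrix_mult_def inner_vec_def sum_distrib_left sum_distrib_right mult_ac)

lemma trace_outer: "trace (outer a b) = a \<bullet> b"
  by (simp add: outer_def trace_def inner_vec_def)

lemma trace_scaleR: "trace (c *\<^sub>R M) = c * trace M" for M :: "real^'k^'k"
  by (simp add: trace_def sum_distrib_left)

text \<open>Testing with the matrix units recovers every entry.\<close>

lemma matrix_eqI_trace:
  fixes A B :: "real^'k^'k"
  assumes "\<And>X. trace (A ** X) = trace (B ** X)"
  shows "A = B"
proof -
  have "trace (M ** outer (axis j 1) (axis i 1)) = M $ i $ j" for M :: "real^'k^'k" and i j
    by (simp add: outer_mult trace_outer inner_axis matrix_vector_mult_basis column_def)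
  then show ?thesis using assms by (metis vec_eq_iff)
qed

text \<open>By Jacobi's formula both sides represent the differential of the determinant, which is
  invariant under conjugation. The argument covers singular \<open>M\<close>.\<close>

lemma cof_conj:
  fixes M N S :: "real^'k^'k"
  assumes NS: "N ** S = mat 1"
  shows "cof (N ** M ** S) = N ** cof M ** S"
proof (rule matrix_eqI_trace)
  fix Y :: "real^'k^'k"
  have SN: "S ** N = mat 1" using NS matrix_left_right_inverse by blast
  define X where "X = S ** Y ** N"
  have Y: "Y = N ** X ** S"
    unfolding X_def matrix_mul_assoc NS
    by (simp add: NS matrix_mul_assoc[symmetric])
  have "det N * det S = 1" using NS by (metis det_I det_mul)
  then have "det (N ** (M + t *\<^sub>R X) ** S) = det (M + t *\<^sub>R X)" for t
    by (simp add: det_mul algebra_simps)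
  then have e: "det (N ** M ** S + t *\<^sub>R Y) = det (M + t *\<^sub>R X)" for t
    unfolding Y by (simp add: mm.add_left mm.add_right mm.scaleR_left mm.scaleR_right)
  have "((\<lambda>t. det (N ** M ** S + t *\<^sub>R Y)) has_real_derivative trace (cof (N ** M ** S) ** Y)) (at 0)"
    using has_derivative_det[OF line_has_vector_derivative, of "N ** M ** S" Y 0] by simp
  moreover have "((\<lambda>t. det (M + t *\<^sub>R X)) has_real_derivative trace (cof M ** X)) (at 0)"
    using has_derivative_det[OF line_has_vector_derivative, of M X 0] by simp
  ultimately have "trace (cof (N ** M ** S) ** Y) = trace (cof M ** X)"
    unfolding e by (rule DERIV_unique)
  also have "\<dots> = trace (N ** (cof M ** S ** Y))"
    unfolding X_def by (simp add: matrix_mul_assoc trace_mul_sym[of _ N])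
  finally show "trace (cof (N ** M ** S) ** Y) = trace (N ** cof M ** S ** Y)"
    by (simp add: matrix_mul_assoc)
qed

lemma det_eq_0_left_kernel:
  fixes M :: "real^'k^'k"
  assumes "det M = 0"
  obtains z where "z \<noteq> 0" "z v* M = 0"
proof -
  have "\<not> invertible (transpose M)" using assms by (simp add: invertible_det_nz)
  then have "\<not> (\<exists>B. B ** transpose M = mat 1)" by (simp add: invertible_left_inverse)
  then obtain z where "transpose M *v z = 0" "z \<noteq> 0"
    unfolding matrix_left_invertible_ker by blast
  then show thesis using that by simp
qed

lemma det_nz_left_kernel:
  fixes M :: "real^'k^'k"
  assumes "\<And>z. z v* M = 0 \<Longrightarrow> z = 0"
  shows "det M \<noteq> 0"
  using assms det_eq_0_left_kernel by blast

lemma left_kernel_det_nz: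
  fixes M :: "real^'k^'k"
  shows "det M \<noteq> 0 \<Longrightarrow> z v* M = 0 \<Longrightarrow> z = 0"
  by (metis matrix_inv_mult(1) vector_matrix_mul_assoc vector_matrix_mul_rid vector_matrix_mult_0)

section \<open>The complementary projectors and block matrices\<close>

definition P1 :: "real^('m::finite + 'n::finite)^('m + 'n)" where
  "P1 = mat 1 - P2"

lemma P2_nth: "P2 $ Inl i $ k = 0" "P2 $ Inr a $ k = (if k = Inr a then 1 else 0)"
  by (simp_all add: P2_def)

lemma sum_sum_type: "(\<Sum>k\<in>UNIV. f k) = (\<Sum>i\<in>UNIV. f (Inl i)) + (\<Sum>a\<in>UNIV. f (Inr a))"
  for f :: "'m::finite + 'n::finite \<Rightarrow> real"
  by (subst UNIV_Plus_UNIV[symmetric], subst sum.Plus) simp_all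

lemma prod_sum_type: "(\<Prod>k\<in>UNIV. f k) = (\<Prod>i\<in>UNIV. f (Inl i)) * (\<Prod>a\<in>UNIV. f (Inr a))"
  for f :: "'m::finite + 'n::finite \<Rightarrow> real"
  by (subst UNIV_Plus_UNIV[symmetric], subst prod.Plus) simp_all

lemma P2_mult_vec: "(P2 *v x) $ Inl i = 0" "(P2 *v x) $ Inr a = x $ Inr a"
  by (simp_all add: matrix_vector_mult_def P2_nth sum_sum_type if_distribR cong: if_cong)
     (simp add: if_distrib[of "\<lambda>z. z * _"] cong: if_cong)

lemma P2_mult: "(P2 ** M) $ Inl i = 0" "(P2 ** M) $ Inr a = M $ Inr a"
  by (simp_all add: vec_eq_iff matrix_matrix_mult_def P2_nth sum_sum_type if_distrib[of "\<lambda>z. z * _"] cong: if_cong)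

lemma mult_P2: "(M ** P2) $ k $ Inl i = 0" "(M ** P2) $ k $ Inr a = M $ k $ Inr a"
  by (simp_all add: matrix_matrix_mult_def P2_nth sum_sum_type if_distrib[of "(*) _"] cong: if_cong)

lemma sum_eqI: "(\<And>i. x $ Inl i = y $ Inl i) \<Longrightarrow> (\<And>a. x $ Inr a = y $ Inr a) \<Longrightarrow> x = y"
  for x y :: "'c^('m::finite + 'n::finite)"
  unfolding vec_eq_iff by (metis sum.exhaust)

lemma P2_P2: "P2 ** P2 = (P2 :: real^('m::finite + 'n::finite)^('m + 'n))"
  by (intro sum_eqI) (simp_all add: P2_mult vec_eq_iff P2_nth)

lemma P1_P2: "P1 ** P2 = (0 :: real^('m::finite + 'n::finite)^('m + 'n))"
  "P2 ** P1 = (0 :: real^('m::finite + 'n::finite)^('m + 'n))"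
  "P1 ** P1 = (P1 :: real^('m::finite + 'n::finite)^('m + 'n))"
  by (simp_all add: P1_def mm.diff_left mm.diff_right P2_P2)

lemma P2_P2_vec [simp]: "P2 *v (P2 *v x) = P2 *v (x :: real^('m::finite + 'n::finite))"
  by (simp add: matrix_vector_mul_assoc P2_P2)

lemma P2_commutesI:
  fixes M :: "real^('m::finite + 'n::finite)^('m + 'n)"
  assumes "\<And>i a. M $ Inl i $ Inr a = 0" "\<And>i a. M $ Inr a $ Inl i = 0"
  shows "P2 ** M = M ** P2"
  by (intro sum_eqI) (auto intro!: sum_eqI simp: P2_mult mult_P2 assms)

lemma transpose_P2: "transpose P2 = P2"
  by (intro sum_eqI) (auto intro!: sum_eqI simp: transpose_def P2_nth)

text \<open>Conjugation with \<open>P1 + 2 P2\<close> maps \<open>1 + N\<close> to \<open>1 + 2 N = (1 + N)\<^sup>2\<close> for \<open>N = P1 X P2\<close>.\<close>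

lemma det_unipotent:
  fixes N :: "real^('m::finite + 'n::finite)^('m + 'n)"
  assumes "P1 ** N = N" "N ** P2 = N"
  shows "det (mat 1 + N) = 1" and "det (mat 1 + transpose N) = 1"
proof -
  have P1N: "P2 ** N = 0" using assms(1) P1_P2 by (metis matrix_mul_assoc mm.zero_left)
  have NP: "N ** P1 = 0" using assms(2) P1_P2 by (metis matrix_mul_assoc mm.zero_right)
  have NN: "N ** N = 0" by (metis P1N assms(2) matrix_mul_assoc mm.zero_right)
  define D E :: "real^('m + 'n)^('m + 'n)" where "D = P1 + (1/2) *\<^sub>R P2" and "E = P1 + 2 *\<^sub>R P2"
  have DE: "D ** E = mat 1"
    unfolding D_def E_def by (simp add: mm.add_left mm.add_right mm.scaleR_left mm.scaleR_right P1_P2 P2_P2) (simp add: P1_def)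
  have "D ** (mat 1 + N) ** E = mat 1 + 2 *\<^sub>R N"
    unfolding mm.add_right mm.add_left matrix_mul_rid DE
    unfolding D_def E_def by (simp add: mm.add_left mm.add_right mm.scaleR_left mm.scaleR_right assms P1N NP)
  also have "\<dots> = (mat 1 + N) ** (mat 1 + N)"
    by (simp add: mm.add_left mm.add_right NN) (simp add: scaleR_2)
  finally have "det D * det (mat 1 + N) * det E = det (mat 1 + N) * det (mat 1 + N)"
    by (metis det_mul)
  moreover have "det D * det E = 1" using DE by (metis det_I det_mul)
  moreover have "(mat 1 + N) ** (mat 1 - N) = mat 1"
    by (simp add: mm.add_left mm.add_right mm.diff_right NN)
  then have "det (mat 1 + N) \<noteq> 0" by (metis det_I det_mul mult_zero_left zero_neq_one)
  ultimately show *: "det (mat 1 + N) = 1" by (simp add: mult.commute mult.left_commute)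
  have "mat 1 + transpose N = transpose (mat 1 + N)"
    by (simp add: transpose_def vec_eq_iff mat_def)
  then show "det (mat 1 + transpose N) = 1" using * by simp
qed

section \<open>The Levi-Civita connection of a driven cofactor system\<close>

lemma dd_eq_df: 
  fixes f :: "real^'k::finite \<Rightarrow> real"
  assumes "smooth_on U f" "q \<in> U"
  shows "dd f q v = df f q \<bullet> v"
proof -
  note der = smooth_on_has_derivative[OF assms]
  have "dd f q v = (\<Sum>b\<in>Basis. (v \<bullet> b) *\<^sub>R dd f q b)"
    by (rule has_derivative_basis_expansion[OF has_derivative_linear[OF der]])
  also have "\<dots> = (\<Sum>i\<in>UNIV. v $ i * dd f q (axis i 1))"
    unfolding Basis_vec_def
    by (simp add: UNION_singleton_eq_range sum.reindex inj_on_def axis_eq_axis inner_axis)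
  finally show ?thesis by (simp add: df_def pd_def inner_vec_def mult.commute)
qed

lemma dd_bounded_linear:
  assumes "smooth_on U f" "q \<in> U" "bounded_linear L"
  shows "dd (\<lambda>z. L (f z)) q v = L (dd f q v)"
  by (rule fun_cong[OF frechet_derivative_at[OF
        bounded_linear.has_derivative[OF assms(3) smooth_on_has_derivative[OF assms(1,2)]], symmetric]])

lemma dd_bilinear:
  assumes "bounded_bilinear B" "smooth_on U f" "smooth_on U h" "q \<in> U"
  shows "dd (\<lambda>z. B (f z) (h z)) q v = B (f q) (dd h q v) + B (dd f q v) (h q)"
  by (rule fun_cong[OF frechet_derivative_at[OF bounded_bilinear.FDERIV[OF assms(1)
        smooth_on_has_derivative[OF assms(2,4)] smooth_on_has_derivative[OF assms(3,4)]], symmetric]])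

lemma dd_vec_nth:
  fixes f :: "'a::euclidean_space \<Rightarrow> 'b::euclidean_space^'k"
  shows "smooth_on U f \<Longrightarrow> q \<in> U \<Longrightarrow> dd (\<lambda>z. f z $ i) q v = dd f q v $ i"
  by (rule dd_bounded_linear[OF _ _ bounded_linear_vec_nth])

lemma dd_mat_nth:
  fixes f :: "'a::euclidean_space \<Rightarrow> real^'k^'j"
  assumes "open U" "smooth_on U f" "q \<in> U"
  shows "dd (\<lambda>z. f z $ i $ j) q v = dd f q v $ i $ j"
  using dd_vec_nth[OF smooth_on_vec_nth[OF assms(1,2)] assms(3)] dd_vec_nth[OF assms(2,3)] by metis

lemma dd_mat_pd:
  fixes f :: "real^'l::finite \<Rightarrow> real^'k^'j"
  assumes "open U" "smooth_on U f" "q \<in> U"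
  shows "dd f q v $ i $ j = (\<Sum>\<gamma>\<in>UNIV. v $ \<gamma> * pd \<gamma> (\<lambda>z. f z $ i $ j) q)"
  using dd_eq_df[OF smooth_on_mat_nth[OF assms(1,2)] assms(3), of i j v] dd_mat_nth[OF assms, of i j v]
  by (simp add: df_def inner_vec_def mult.commute)

text \<open>The connection matrix in the direction \<open>v\<close>; with it covariant derivatives
  of (1,1) tensors become matrix commutators instead of index sums.\<close>

definition conn :: "(real^'k \<Rightarrow> real^'k^'k) \<Rightarrow> real^'k \<Rightarrow> real^'k \<Rightarrow> real^'k^'k::finite" where
  "conn g q v = (\<chi> \<delta> \<alpha>. \<Sum>\<gamma>\<in>UNIV. christoffel g q \<delta> \<alpha> \<gamma> * v $ \<gamma>)"

lemma pos_def_det_nz: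
  fixes G :: "real^'k^'k"
  assumes "\<And>v. v \<noteq> 0 \<Longrightarrow> v \<bullet> (G *v v) > 0"
  shows "det G \<noteq> 0"
proof (rule det_nz_left_kernel)
  fix z assume "z v* G = 0"
  then have "z \<bullet> (G *v z) = 0" by (metis dot_lmul_matrix inner_zero_left)
  then show "z = 0" using assms[of z] by fastforce
qed

locale riemannian =
  fixes U :: "(real^'k::finite) set" and g :: "real^'k \<Rightarrow> real^'k^'k"
  assumes open_U: "open U" and metric: "riemannian_metric U g"
begin

abbreviation R :: "real^'k \<Rightarrow> real^'k^'k" where "R q \<equiv> matrix_inv (g q)"

text \<open>The inner product that the metric induces on 1-forms.\<close>

abbreviation ip :: "real^'k \<Rightarrow> real^'k \<Rightarrow> real^'k \<Rightarrow> real" where "ip q a b \<equiv> a \<bullet> (R q *v b)"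

lemma smooth_g: "smooth_on U g"
  and g_sym: "q \<in> U \<Longrightarrow> transpose (g q) = g q"
  and g_pos: "q \<in> U \<Longrightarrow> v \<noteq> 0 \<Longrightarrow> v \<bullet> (g q *v v) > 0"
  using metric by (auto simp: riemannian_metric_def)

lemma g_nth_sym: "q \<in> U \<Longrightarrow> g q $ i $ j = g q $ j $ i"
  using g_sym[of q] by (simp add: transpose_def vec_eq_iff)

lemma det_g: "q \<in> U \<Longrightarrow> det (g q) \<noteq> 0"
  using g_pos by (rule pos_def_det_nz)

lemma gR: "q \<in> U \<Longrightarrow> g q ** R q = mat 1" and Rg: "q \<in> U \<Longrightarrow> R q ** g q = mat 1"
  by (simp_all add: matrix_inv_mult det_g)

lemma gR_vec: "q \<in> U \<Longrightarrow> g q *v (R q *v v) = v" and Rg_vec: "q \<in> U \<Longrightarrow> R q *v (g q *v v) = v"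
  by (simp_all add: matrix_vector_mul_assoc gR Rg)

lemma R_sym: "q \<in> U \<Longrightarrow> transpose (R q) = R q"
  by (metis Rg g_sym gR matrix_mul_assoc matrix_mul_lid matrix_mul_rid matrix_transpose_mul transpose_mat)

lemma smooth_R: "smooth_on U R"
  by (rule smooth_on_matrix_inv[OF open_U smooth_g det_g])

lemma vec_g: "q \<in> U \<Longrightarrow> v v* g q = g q *v v" and vec_R: "q \<in> U \<Longrightarrow> v v* R q = R q *v v"
  by (metis transpose_matrix_vector g_sym, metis transpose_matrix_vector R_sym)

lemma ip_commute: "q \<in> U \<Longrightarrow> ip q a b = ip q b a"
  by (metis dot_lmul_matrix inner_commute vec_R)

lemma ip_pos: "q \<in> U \<Longrightarrow> a \<noteq> 0 \<Longrightarrow> ip q a a > 0"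
  by (metis gR_vec g_pos inner_commute mv.zero_right)

text \<open>Christoffel symbols of the first kind: multiplication by the metric cancels the inverse
  metric in \<open>christoffel\<close>.\<close>

lemma g_conn_nth:
  assumes q: "q \<in> U"
  shows "(g q ** conn g q v) $ \<epsilon> $ \<alpha> = (\<Sum>\<gamma>\<in>UNIV. v $ \<gamma> * (1/2) *
    (pd \<alpha> (\<lambda>z. g z $ \<epsilon> $ \<gamma>) q + pd \<gamma> (\<lambda>z. g z $ \<epsilon> $ \<alpha>) q - pd \<epsilon> (\<lambda>z. g z $ \<alpha> $ \<gamma>) q))"
proof -
  define C where "C = (\<chi> \<epsilon> \<alpha>. \<Sum>\<gamma>\<in>UNIV. v $ \<gamma> * (1/2) *
    (pd \<alpha> (\<lambda>z. g z $ \<epsilon> $ \<gamma>) q + pd \<gamma> (\<lambda>z. g z $ \<epsilon> $ \<alpha>) q - pd \<epsilon> (\<lambda>z. g z $ \<alpha> $ \<gamma>) q))"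
  have "conn g q v = R q ** C"
    unfolding conn_def christoffel_def C_def matrix_matrix_mult_def
    by (simp add: vec_eq_iff sum_distrib_left sum_distrib_right mult_ac) (intro allI sum.swap)
  then have "g q ** conn g q v = C"
    by (simp add: matrix_mul_assoc gR q)
  then show ?thesis by (simp add: C_def)
qed

lemma pd_g_sym:
  assumes q: "q \<in> U"
  shows "pd \<gamma> (\<lambda>z. g z $ i $ j) q = pd \<gamma> (\<lambda>z. g z $ j $ i) q"
proof -
  have "frechet_derivative (\<lambda>z. g z $ i $ j) (at q) = frechet_derivative (\<lambda>z. g z $ j $ i) (at q)"
    by (rule frechet_derivative_transform_within_open[OF
          smooth_on_differentiable[OF smooth_on_mat_nth[OF open_U smooth_g] q] open_U q g_nth_sym])
  then show ?thesis by (simp add: pd_def)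
qed

text \<open>Metric compatibility: in the sum of the two first-kind symbols all but one derivative of
  the metric cancel.\<close>

lemma dd_g:
  assumes q: "q \<in> U"
  shows "dd g q v = g q ** conn g q v + transpose (conn g q v) ** g q"
proof -
  have "transpose (conn g q v) ** g q = transpose (g q ** conn g q v)"
    by (simp add: matrix_transpose_mul g_sym q)
  then have "(g q ** conn g q v + transpose (conn g q v) ** g q) $ i $ j = dd g q v $ i $ j" for i j
    by (simp add: transpose_def g_conn_nth[OF q] dd_mat_pd[OF open_U smooth_g q] sum.distrib[symmetric])
       (rule sum.cong[OF refl], simp add: pd_g_sym[OF q, of _ j i] field_simps)
  then show ?thesis by (simp add: vec_eq_iff)
qed

text \<open>Vanishing torsion, one source of the symmetry of the covariant Hessian.\<close>

lemma conn_commute: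
  assumes q: "q \<in> U"
  shows "conn g q v *v x = conn g q x *v v"
proof -
  have c: "christoffel g q \<delta> \<alpha> \<gamma> = christoffel g q \<delta> \<gamma> \<alpha>" for \<delta> \<alpha> \<gamma>
    by (simp add: christoffel_def pd_g_sym[OF q, of _ \<alpha> \<gamma>] algebra_simps)
  have "(\<Sum>\<alpha>\<in>UNIV. \<Sum>\<gamma>\<in>UNIV. christoffel g q i \<alpha> \<gamma> * v $ \<gamma> * x $ \<alpha>)
     = (\<Sum>\<alpha>\<in>UNIV. \<Sum>\<gamma>\<in>UNIV. christoffel g q i \<alpha> \<gamma> * x $ \<gamma> * v $ \<alpha>)" for i
    by (subst sum.swap) (simp add: c mult_ac)
  then show ?thesis
    by (simp add: conn_def vec_eq_iff matrix_vector_mult_def sum_distrib_right)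
qed

text \<open>The position gradient of the kinetic energy, as it occurs in Lagrange's equations. After
  contraction with \<open>v\<close> twice, the other two terms of the Christoffel symbol cancel by
  symmetry.\<close>

lemma geodesic_term:
  assumes q: "q \<in> U"
  shows "(g q *v v v* conn g q v) $ \<alpha> = (1/2) * (v \<bullet> (dd g q (axis \<alpha> 1) *v v))"
proof -
  have "g q *v v v* conn g q v = v v* (g q ** conn g q v)"
    by (metis vec_g[OF q] vector_matrix_mul_assoc)
  then have "(g q *v v v* conn g q v) $ \<alpha> = (\<Sum>\<epsilon>\<in>UNIV. \<Sum>\<gamma>\<in>UNIV. v $ \<epsilon> * v $ \<gamma> * (1/2) *
    (pd \<alpha> (\<lambda>z. g z $ \<epsilon> $ \<gamma>) q + pd \<gamma> (\<lambda>z. g z $ \<epsilon> $ \<alpha>) q - pd \<epsilon> (\<lambda>z. g z $ \<alpha> $ \<gamma>) q))"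
    by (simp add: vector_matrix_mult_def g_conn_nth[OF q] sum_distrib_left sum_distrib_right mult_ac)
  also have "\<dots> = (\<Sum>\<epsilon>\<in>UNIV. \<Sum>\<gamma>\<in>UNIV. v $ \<epsilon> * v $ \<gamma> * (1/2) * pd \<alpha> (\<lambda>z. g z $ \<epsilon> $ \<gamma>) q)
     + ((\<Sum>\<epsilon>\<in>UNIV. \<Sum>\<gamma>\<in>UNIV. v $ \<epsilon> * v $ \<gamma> * (1/2) * pd \<gamma> (\<lambda>z. g z $ \<epsilon> $ \<alpha>) q)
     - (\<Sum>\<epsilon>\<in>UNIV. \<Sum>\<gamma>\<in>UNIV. v $ \<epsilon> * v $ \<gamma> * (1/2) * pd \<epsilon> (\<lambda>z. g z $ \<alpha> $ \<gamma>) q))"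
    by (simp add: sum.distrib sum_subtractf algebra_simps)
  also have "(\<Sum>\<epsilon>\<in>UNIV. \<Sum>\<gamma>\<in>UNIV. v $ \<epsilon> * v $ \<gamma> * (1/2) * pd \<epsilon> (\<lambda>z. g z $ \<alpha> $ \<gamma>) q)
    = (\<Sum>\<epsilon>\<in>UNIV. \<Sum>\<gamma>\<in>UNIV. v $ \<epsilon> * v $ \<gamma> * (1/2) * pd \<gamma> (\<lambda>z. g z $ \<epsilon> $ \<alpha>) q)"
    by (subst sum.swap) (simp add: pd_g_sym[OF q, of _ \<alpha>] mult_ac)
  also have "(\<Sum>\<epsilon>\<in>UNIV. \<Sum>\<gamma>\<in>UNIV. v $ \<epsilon> * v $ \<gamma> * (1/2) * pd \<alpha> (\<lambda>z. g z $ \<epsilon> $ \<gamma>) q) + (X - X)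
      = (1/2) * (v \<bullet> (dd g q (axis \<alpha> 1) *v v))" for X
    by (simp add: inner_vec_def matrix_vector_mult_def pd_def dd_mat_nth[OF open_U smooth_g q]
        sum_distrib_left mult_ac)
  finally show ?thesis .
qed

lemma dd_R:
  assumes q: "q \<in> U"
  shows "dd R q v = - (conn g q v ** R q) - R q ** transpose (conn g q v)"
proof -
  have "\<exists>T. open T \<and> (0::real) \<in> T \<and> (\<forall>r\<in>T. q + r *\<^sub>R v \<in> U)"
    by (intro exI[of _ "(\<lambda>r. q + r *\<^sub>R v) -` U"])
       (auto intro!: continuous_open_vimage continuous_intros open_U q)
  then obtain T where T: "open T" "0 \<in> T" "\<And>r. r \<in> T \<Longrightarrow> q + r *\<^sub>R v \<in> U" by blast
  have "((\<lambda>r. g (q + r *\<^sub>R v)) has_vector_derivative dd g q v) (at 0)"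
    "((\<lambda>r. R (q + r *\<^sub>R v)) has_vector_derivative dd R q v) (at 0)"
    using dd_curve[OF smooth_g, of "\<lambda>r. q + r *\<^sub>R v" 0 v] dd_curve[OF smooth_R, of "\<lambda>r. q + r *\<^sub>R v" 0 v]
      line_has_vector_derivative[of q v 0] q by auto
  from has_vector_derivative_matrix_inv[OF this T(1,2)] T(3) Rg
  have "dd R q v = - (R q ** dd g q v ** R q)" by simp
  also have "R q ** dd g q v ** R q = conn g q v ** R q + R q ** transpose (conn g q v)"
    by (simp add: dd_g q mm.add_left mm.add_right matrix_mul_assoc Rg)
       (simp add: matrix_mul_assoc[symmetric] gR q)
  finally show ?thesis by simp
qed

text \<open>The right-hand side of the scKt equation with its first index raised and its last index
  contracted with \<open>v\<close>.\<close>

definition killing_part :: "real^'k \<Rightarrow> real^'k \<Rightarrow> real^'k \<Rightarrow> real^'k^'k" where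
  "killing_part q \<alpha> v = (1/2) *\<^sub>R (outer (R q *v \<alpha>) (g q *v v) + outer v \<alpha>)"

text \<open>The scKt equation concerns the lowered tensor \<open>g z ** J z\<close>; metric
  compatibility cancels the derivative of \<open>g\<close>, and raising the index leaves a
  commutator with the connection besides \<open>killing_part\<close>.\<close>

lemma dd_scKt:
  assumes J: "scKt U g J" and q: "q \<in> U"
  shows "dd J q v = J q ** conn g q v - conn g q v ** J q + killing_part q (df (\<lambda>z. trace (J z)) q) v"
proof -
  let ?\<Gamma> = "conn g q v" and ?\<alpha> = "df (\<lambda>z. trace (J z)) q"
  let ?K = "(1/2) *\<^sub>R (outer ?\<alpha> (g q *v v) + outer (g q *v v) ?\<alpha>)"
  have sJ: "smooth_on U J" and cov: "cov_deriv g (\<lambda>z. g z ** J z) q \<alpha> \<beta> \<gamma> =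
           (1/2) * (?\<alpha> $ \<alpha> * g q $ \<beta> $ \<gamma> + ?\<alpha> $ \<beta> * g q $ \<alpha> $ \<gamma>)" for \<alpha> \<beta> \<gamma>
    using J q by (auto simp: scKt_def)
  have sB: "smooth_on U (\<lambda>z. g z ** J z)"
    by (rule smooth_on_matrix_mult[OF open_U smooth_g sJ])
  have B: "dd (\<lambda>z. g z ** J z) q v = transpose ?\<Gamma> ** (g q ** J q) + (g q ** J q) ** ?\<Gamma> + ?K"
  proof -
    have "dd (\<lambda>z. g z ** J z) q v $ \<alpha> $ \<beta> = (transpose ?\<Gamma> ** (g q ** J q) + (g q ** J q) ** ?\<Gamma> + ?K) $ \<alpha> $ \<beta>"
      for \<alpha> \<beta>
    proof -
      let ?b = "g q ** J q"
      have "dd (\<lambda>z. g z ** J z) q v $ \<alpha> $ \<beta> = (\<Sum>\<gamma>\<in>UNIV. v $ \<gamma> * pd \<gamma> (\<lambda>z. (g z ** J z) $ \<alpha> $ \<beta>) q)"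
        by (rule dd_mat_pd[OF open_U sB q])
      also have "\<dots> = (\<Sum>\<gamma>\<in>UNIV. v $ \<gamma> * (\<Sum>\<delta>\<in>UNIV. christoffel g q \<delta> \<alpha> \<gamma> * ?b $ \<delta> $ \<beta>)
          + v $ \<gamma> * (\<Sum>\<delta>\<in>UNIV. christoffel g q \<delta> \<beta> \<gamma> * ?b $ \<alpha> $ \<delta>)
          + v $ \<gamma> * ((1/2) * (?\<alpha> $ \<alpha> * g q $ \<beta> $ \<gamma> + ?\<alpha> $ \<beta> * g q $ \<alpha> $ \<gamma>)))"
      proof (rule sum.cong[OF refl])
        fix \<gamma>
        have "pd \<gamma> (\<lambda>z. (g z ** J z) $ \<alpha> $ \<beta>) q
          = (\<Sum>\<delta>\<in>UNIV. christoffel g q \<delta> \<alpha> \<gamma> * ?b $ \<delta> $ \<beta>)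
            + (\<Sum>\<delta>\<in>UNIV. christoffel g q \<delta> \<beta> \<gamma> * ?b $ \<alpha> $ \<delta>)
            + (1/2) * (?\<alpha> $ \<alpha> * g q $ \<beta> $ \<gamma> + ?\<alpha> $ \<beta> * g q $ \<alpha> $ \<gamma>)"
          using cov[of \<alpha> \<beta> \<gamma>] unfolding cov_deriv_def by linarith
        then show "v $ \<gamma> * pd \<gamma> (\<lambda>z. (g z ** J z) $ \<alpha> $ \<beta>) q
          = v $ \<gamma> * (\<Sum>\<delta>\<in>UNIV. christoffel g q \<delta> \<alpha> \<gamma> * ?b $ \<delta> $ \<beta>)
            + v $ \<gamma> * (\<Sum>\<delta>\<in>UNIV. christoffel g q \<delta> \<beta> \<gamma> * ?b $ \<alpha> $ \<delta>)
            + v $ \<gamma> * ((1/2) * (?\<alpha> $ \<alpha> * g q $ \<beta> $ \<gamma> + ?\<alpha> $ \<beta> * g q $ \<alpha> $ \<gamma>))"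
          by (simp only: distrib_left)
      qed
      also have "\<dots> = (\<Sum>\<delta>\<in>UNIV. (\<Sum>\<gamma>\<in>UNIV. christoffel g q \<delta> \<alpha> \<gamma> * v $ \<gamma>) * ?b $ \<delta> $ \<beta>)
          + (\<Sum>\<delta>\<in>UNIV. ?b $ \<alpha> $ \<delta> * (\<Sum>\<gamma>\<in>UNIV. christoffel g q \<delta> \<beta> \<gamma> * v $ \<gamma>))
          + (1/2) * (?\<alpha> $ \<alpha> * (\<Sum>\<gamma>\<in>UNIV. g q $ \<beta> $ \<gamma> * v $ \<gamma>) + ?\<alpha> $ \<beta> * (\<Sum>\<gamma>\<in>UNIV. g q $ \<alpha> $ \<gamma> * v $ \<gamma>))"
        unfolding sum.distrib
      proof (intro arg_cong2[where f = "(+)"])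
        show "(\<Sum>\<gamma>\<in>UNIV. v $ \<gamma> * (\<Sum>\<delta>\<in>UNIV. christoffel g q \<delta> \<alpha> \<gamma> * ?b $ \<delta> $ \<beta>))
          = (\<Sum>\<delta>\<in>UNIV. (\<Sum>\<gamma>\<in>UNIV. christoffel g q \<delta> \<alpha> \<gamma> * v $ \<gamma>) * ?b $ \<delta> $ \<beta>)"
          unfolding sum_distrib_left sum_distrib_right by (subst sum.swap) (simp only: mult_ac)
        show "(\<Sum>\<gamma>\<in>UNIV. v $ \<gamma> * (\<Sum>\<delta>\<in>UNIV. christoffel g q \<delta> \<beta> \<gamma> * ?b $ \<alpha> $ \<delta>))
          = (\<Sum>\<delta>\<in>UNIV. ?b $ \<alpha> $ \<delta> * (\<Sum>\<gamma>\<in>UNIV. christoffel g q \<delta> \<beta> \<gamma> * v $ \<gamma>))"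
          unfolding sum_distrib_left sum_distrib_right by (subst sum.swap) (simp only: mult_ac)
      qed (simp add: sum.distrib sum_distrib_left algebra_simps)
      also have "\<dots> = (transpose ?\<Gamma> ** ?b + ?b ** ?\<Gamma> + ?K) $ \<alpha> $ \<beta>"
        unfolding conn_def outer_def transpose_def
        by (simp add: matrix_matrix_mult_def matrix_vector_mult_def)
      finally show ?thesis .
    qed
    then show ?thesis by (simp add: vec_eq_iff)
  qed
  have "dd (\<lambda>z. g z ** J z) q v = g q ** dd J q v + dd g q v ** J q"
    by (rule dd_bilinear[OF mm.bounded_bilinear_axioms smooth_g sJ q])
  with B have "g q ** dd J q v = g q ** J q ** ?\<Gamma> - g q ** ?\<Gamma> ** J q + ?K"
    by (simp add: dd_g q mm.add_left matrix_mul_assoc algebra_simps)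
  then have "R q ** (g q ** dd J q v) = R q ** (g q ** (J q ** ?\<Gamma>)) - R q ** (g q ** (?\<Gamma> ** J q)) + R q ** ?K"
    by (simp add: mm.add_right mm.diff_right matrix_mul_assoc)
  then have "dd J q v = J q ** ?\<Gamma> - ?\<Gamma> ** J q + R q ** ?K"
    by (simp add: matrix_mul_assoc Rg q)
  moreover have "R q ** ?K = killing_part q ?\<alpha> v"
    by (simp add: killing_part_def mm.scaleR_right mm.add_right outer_mult Rg_vec q)
  ultimately show ?thesis by simp
qed

end

section \<open>The roots of the pencil\<close>

locale driven_system =
  fixes U :: "(real^('m::finite + 'n::finite)) set"
    and g J :: "real^('m + 'n) \<Rightarrow> real^('m + 'n)^('m + 'n)"
    and \<mu> :: "real^('m + 'n) \<Rightarrow> real^('m + 'n)"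
    and V :: "real^('m + 'n) \<Rightarrow> real"
    and g1 J1 :: "real^'m \<Rightarrow> real^'m^'m"
    and g2 :: "real^'n \<Rightarrow> real^'n^'n"
    and Q1 :: "real^'m \<Rightarrow> real^'m"
    and u :: "real^('m + 'n) \<Rightarrow> real^'n"
  assumes driven: "driven_cofactor_system U g \<mu> J g1 g2 Q1 V"
    and J1: "\<forall>q\<in>U. \<forall>i j. J q $ Inl i $ Inl j = J1 (ypart q) $ i $ j"
    and J1_nonsing: "\<forall>q\<in>U. det (J1 (ypart q)) \<noteq> 0"
    and u_smooth: "smooth_on U u"
    and u_roots: "\<forall>q\<in>U. \<forall>a. det (J q - u q $ a *\<^sub>R P2) = 0"
    and u_indep: "\<forall>q\<in>U. det ((\<chi> a b. pd (Inr b) (\<lambda>z. u z $ a) q) :: real^'n^'n) \<noteq> 0"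

sublocale driven_system \<subseteq> riemannian U g
  using driven by unfold_locales (auto simp: driven_cofactor_system_def coordinate_domain_def cofactor_system_def)

context driven_system
begin

abbreviation "\<alpha> q \<equiv> df (\<lambda>z. trace (J z)) q"
abbreviation "w b q \<equiv> df (\<lambda>z. u z $ b) q"
abbreviation "pencil l q \<equiv> J q - l *\<^sub>R P2"
abbreviation "C l q \<equiv> cof (pencil l q)"
text \<open>The restricted tensor is completed by the identity on K. Its determinant thus belongs to
  a full-size matrix and can be compared with \<open>det (pencil l q)\<close> by multiplying
  matrices.\<close>

definition "\<Delta> q = det (P1 ** J q ** P1 + P2)"
abbreviation "n b q \<equiv> ip q (P2 *v w b q) (w b q)"

lemma scKt_J: "scKt U g J" and smooth_J: "smooth_on U J" and smooth_\<mu>: "smooth_on U \<mu>"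
  and det_J: "q \<in> U \<Longrightarrow> det (J q) \<noteq> 0"
  using driven by (auto simp: driven_cofactor_system_def cofactor_system_def scKt_def)

lemma g_block:
  assumes "q \<in> U"
  shows "g q $ Inl i $ Inl j = g1 (ypart q) $ i $ j" "g q $ Inr a $ Inr b = g2 (xpart q) $ a $ b"
    "g q $ Inl i $ Inr a = 0" "g q $ Inr a $ Inl i = 0"
  using driven assms by (auto simp: driven_cofactor_system_def)

lemma smooth_u: "smooth_on U (\<lambda>z. u z $ b)"
  by (rule smooth_on_vec_nth[OF open_U u_smooth])

lemma smooth_w: "smooth_on U (w b)"
  by (rule smooth_on_df[OF open_U smooth_u])

lemma dd_u: "q \<in> U \<Longrightarrow> dd (\<lambda>z. u z $ b) q v = w b q \<bullet> v"
  by (rule dd_eq_df[OF smooth_u])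

section \<open>Symmetry of the pencil and of its cofactor matrix\<close>

lemma P2_sym: "x v* P2 = P2 *v x"
  by (metis transpose_P2 vector_transpose_matrix)

lemma P2_g: "q \<in> U \<Longrightarrow> P2 ** g q = g q ** P2"
  by (rule P2_commutesI) (simp_all add: g_block)

lemma gR_mult: "q \<in> U \<Longrightarrow> M ** g q ** R q = M" and Rg_mult: "q \<in> U \<Longrightarrow> M ** R q ** g q = M"
  by (simp_all add: matrix_mul_assoc[symmetric] gR Rg)

lemma P2_R: "q \<in> U \<Longrightarrow> P2 ** R q = R q ** P2"
proof -
  assume q: "q \<in> U"
  have "R q ** (P2 ** g q) ** R q = R q ** (g q ** P2) ** R q"
    by (simp only: P2_g[OF q])
  then show ?thesis by (simp add: matrix_mul_assoc gR_mult Rg q)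
qed

lemma P2_R_vec: "q \<in> U \<Longrightarrow> P2 *v (R q *v b) = R q *v (P2 *v b)"
  by (simp add: matrix_vector_mul_assoc P2_R)

lemma J_R: "q \<in> U \<Longrightarrow> J q *v (R q *v b) = R q *v (b v* J q)"
proof -
  assume q: "q \<in> U"
  have "transpose (g q ** J q) = g q ** J q" using scKt_J q by (auto simp: scKt_def)
  then have "transpose (J q) ** g q = g q ** J q" by (simp add: matrix_transpose_mul g_sym q)
  then have "R q ** (transpose (J q) ** g q) ** R q = R q ** (g q ** J q) ** R q"
    by simp
  then have "R q ** transpose (J q) = J q ** R q"
    by (simp add: matrix_mul_assoc gR_mult Rg q)
  then have "(J q ** R q) *v b = (R q ** transpose (J q)) *v b" by simp
  then show ?thesis
    by (simp only: matrix_vector_mul_assoc[symmetric] transpose_matrix_vector)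
qed

lemma pencil_R: "q \<in> U \<Longrightarrow> pencil l q *v (R q *v b) = R q *v (b v* pencil l q)"
  by (simp add: mv.diff_left vm.diff_right mv.scaleR_left vm.scaleR_right J_R P2_R_vec P2_sym
      mv.diff_right mv.scaleR_right)

text \<open>The pencil is symmetric for the metric, so its transpose is its conjugate by
  \<open>g q\<close>; \<open>cof_conj\<close> carries this over to the cofactor matrix, even where
  \<open>l\<close> is a root.\<close>

lemma C_R: "q \<in> U \<Longrightarrow> C l q *v (R q *v b) = R q *v (b v* C l q)"
proof -
  assume q: "q \<in> U"
  have "pencil l q ** R q = R q ** transpose (pencil l q)"
    using pencil_R[OF q, of l] unfolding matrix_eq by (simp add: matrix_vector_mul_assoc[symmetric])
  then have "g q ** (pencil l q ** R q) = g q ** (R q ** transpose (pencil l q))"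
    by simp
  then have "transpose (pencil l q) = g q ** pencil l q ** R q"
    by (simp only: matrix_mul_assoc) (simp add: gR q)
  then have "transpose (C l q) = g q ** C l q ** R q"
    using cof_conj[OF gR[OF q]] by (simp add: cof_transpose[symmetric])
  then have "R q ** transpose (C l q) = R q ** g q ** C l q ** R q"
    by (simp add: matrix_mul_assoc)
  then have "(C l q ** R q) *v b = (R q ** transpose (C l q)) *v b"
    by (simp add: Rg q)
  then show ?thesis
    by (simp only: matrix_vector_mul_assoc[symmetric] transpose_matrix_vector)
qed

lemma ip_J: "q \<in> U \<Longrightarrow> ip q (a v* J q) b = ip q a (b v* J q)"
  by (metis J_R dot_lmul_matrix)

lemma ip_P2: "q \<in> U \<Longrightarrow> ip q (P2 *v a) b = ip q a (P2 *v b)"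
  by (metis P2_R_vec P2_sym dot_lmul_matrix)

lemma ip_pencil: "q \<in> U \<Longrightarrow> ip q (a v* pencil l q) b = ip q a (b v* pencil l q)"
  by (metis pencil_R dot_lmul_matrix)

lemma C_pencil: "x v* C l q v* pencil l q = det (pencil l q) *\<^sub>R x"
  "x v* pencil l q v* C l q = det (pencil l q) *\<^sub>R x"
  by (simp_all only: vector_matrix_mul_assoc cof_mult_left cof_mult_right)
     (simp_all add: vec_eq_iff vector_matrix_mult_def mat_def if_distrib[of "(*) _"] cong: if_cong)

text \<open>\<open>P2\<close> is parallel: a first-kind Christoffel symbol with indices from both
  blocks involves only mixed entries of the metric, which are 0, or derivatives of a block in a
  foreign coordinate.\<close>

lemma conn_mixed:
  assumes q: "q \<in> U"
  shows "P2 ** conn g q v = conn g q v ** P2"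
proof -
  \<comment> \<open>\<open>g1\<close> and \<open>g2\<close> carry no smoothness of their own, so
    entries of \<open>g\<close> are compared along coordinate lines inside \<open>U\<close>.\<close>
  have d0: "dd (\<lambda>z. f (g z)) q e = 0"
    if f: "bounded_linear f" and c: "\<And>r. q + r *\<^sub>R e \<in> U \<Longrightarrow> f (g (q + r *\<^sub>R e)) = f (g q)" for f :: "_ \<Rightarrow> real" and e
  proof -
    have o: "open ((\<lambda>r. q + r *\<^sub>R e) -` U)"
      by (auto intro!: continuous_open_vimage continuous_intros open_U)
    have "((\<lambda>r. f (g (q + r *\<^sub>R e))) has_vector_derivative 0) (at 0)"
      by (rule has_vector_derivative_transform_within_open[OF has_vector_derivative_const o])
         (use q c in auto)
    then show ?thesis
      by (rule dd_eqI[OF smooth_on_bounded_linear[OF open_U f smooth_g] q])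
  qed
  have nth: "bounded_linear (\<lambda>M::real^('m+'n)^('m+'n). M $ k $ l)" for k l
    by (rule bounded_linear_compose[OF bounded_linear_vec_nth bounded_linear_vec_nth])
  have y: "ypart (q + r *\<^sub>R axis (Inr a) 1) = ypart q" for r a
    by (simp add: ypart_def vec_eq_iff axis_def)
  have x: "xpart (q + r *\<^sub>R axis (Inl i) 1) = xpart q" for r i
    by (simp add: xpart_def vec_eq_iff axis_def)
  have d1: "pd (Inr a) (\<lambda>z. g z $ Inl i $ Inl j) q = 0" for a i j
    unfolding pd_def by (rule d0[OF nth]) (simp add: g_block q y)
  have d2: "pd (Inl i) (\<lambda>z. g z $ Inr a $ Inr b) q = 0" for a b i
    unfolding pd_def by (rule d0[OF nth]) (simp add: g_block q x)
  have d3: "pd k (\<lambda>z. g z $ Inr a $ Inl i) q = 0" "pd k (\<lambda>z. g z $ Inl i $ Inr a) q = 0" for k a i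
    unfolding pd_def by (rule d0[OF nth], simp add: g_block q)+
  have "(g q ** conn g q v) $ Inl i $ Inr a = 0" "(g q ** conn g q v) $ Inr a $ Inl i = 0" for i a
    by (simp_all add: g_conn_nth[OF q] sum_sum_type d1 d2 d3)
  then have "P2 ** (g q ** conn g q v) = (g q ** conn g q v) ** P2"
    by (intro P2_commutesI)
  then have "R q ** (P2 ** (g q ** conn g q v)) = R q ** g q ** conn g q v ** P2"
    by (simp add: matrix_mul_assoc)
  moreover have "R q ** (P2 ** (g q ** conn g q v)) = P2 ** (R q ** g q ** conn g q v)"
    by (simp only: matrix_mul_assoc P2_R[OF q])
  ultimately show ?thesis by (simp add: Rg q)
qed

abbreviation "\<Gamma> q v \<equiv> conn g q v"

lemma dd_J: "q \<in> U \<Longrightarrow> dd J q v = J q ** \<Gamma> q v - \<Gamma> q v ** J q + killing_part q (\<alpha> q) v"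
  by (rule dd_scKt[OF scKt_J])

lemma vec_killing_part:
  "q \<in> U \<Longrightarrow> x v* killing_part q a v = (1/2) *\<^sub>R (ip q x a *\<^sub>R (g q *v v) + (x \<bullet> v) *\<^sub>R a)"
  by (simp add: killing_part_def vm.scaleR_right vm.add_right outer_mult)

text \<open>This is the gradient of \<open>det (pencil l z)\<close> at fixed \<open>l\<close>. As
  \<open>P2\<close> is parallel, the connection enters as a commutator with the pencil, whose trace
  against the cofactor matrix vanishes; the two halves of \<open>killing_part\<close> contribute
  equally because \<open>C\<close> is symmetric.\<close>

lemma trace_cof_dd_J:
  assumes q: "q \<in> U"
  shows "trace (C l q ** dd J q v) = (\<alpha> q v* C l q) \<bullet> v"
proof -
  let ?M = "pencil l q" and ?G = "\<Gamma> q v"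
  have e: "J q ** ?G - ?G ** J q = ?M ** ?G - ?G ** ?M"
    by (simp add: mm.diff_left mm.diff_right mm.scaleR_left mm.scaleR_right conn_mixed[OF q])
  have "trace (C l q ** (J q ** ?G - ?G ** J q)) = trace (C l q ** ?M ** ?G) - trace (C l q ** ?G ** ?M)"
    unfolding e by (simp only: mm.diff_right[of "C l q"] trace_sub matrix_mul_assoc)
  also have "trace (C l q ** ?G ** ?M) = trace (?M ** C l q ** ?G)"
    by (simp only: trace_mul_sym[of _ "?M"] matrix_mul_assoc)
  finally have "trace (C l q ** (J q ** ?G - ?G ** J q)) = 0"
    by (simp add: cof_mult_left cof_mult_right)
  moreover have "trace (C l q ** killing_part q (\<alpha> q) v) = (\<alpha> q v* C l q) \<bullet> v"
  proof -
    have "(C l q *v (R q *v \<alpha> q)) \<bullet> (g q *v v) = (\<alpha> q v* C l q) \<bullet> v"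
      unfolding C_R[OF q] dot_lmul_matrix[symmetric] by (simp add: dot_lmul_matrix[symmetric] inner_commute vec_g[OF q] gR_vec[OF q])
    moreover have "(C l q *v v) \<bullet> \<alpha> q = (\<alpha> q v* C l q) \<bullet> v"
      unfolding dot_lmul_matrix by (rule inner_commute)
    ultimately show ?thesis
      by (simp add: killing_part_def mm.scaleR_right mm.add_right outer_mult trace_scaleR trace_add trace_outer)
  qed
  ultimately show ?thesis
    by (simp add: dd_J[OF q] mm.add_right trace_add)
qed

lemma line_neighbourhood:
  assumes "q \<in> U"
  obtains T where "open T" "(0::real) \<in> T" "\<And>r. r \<in> T \<Longrightarrow> q + r *\<^sub>R v \<in> U"
proof
  show "open ((\<lambda>r. q + r *\<^sub>R v) -` U)"
    by (auto intro!: continuous_open_vimage continuous_intros open_U)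
qed (use assms in auto)

text \<open>Jacobi's formula along a line on which the root moves with the point and the determinant
  stays 0.\<close>

lemma root_gradient:
  assumes q: "q \<in> U"
  shows "\<alpha> q v* C (u q $ b) q = trace (C (u q $ b) q ** P2) *\<^sub>R w b q"
proof -
  let ?C = "C (u q $ b) q"
  have "(\<alpha> q v* ?C) \<bullet> v = (trace (?C ** P2) *\<^sub>R w b q) \<bullet> v" for v
  proof -
    obtain T where T: "open T" "0 \<in> T" "\<And>r. r \<in> T \<Longrightarrow> q + r *\<^sub>R v \<in> U"
      using line_neighbourhood[OF q] by blast
    have "((\<lambda>r. pencil (u (q + r *\<^sub>R v) $ b) (q + r *\<^sub>R v)) has_vector_derivative
        (dd J q v - (w b q \<bullet> v) *\<^sub>R P2)) (at 0)"
      using dd_curve[OF smooth_J, of "\<lambda>r. q + r *\<^sub>R v" 0 v] dd_curve[OF smooth_u[of b], of "\<lambda>r. q + r *\<^sub>R v" 0 v]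
        line_has_vector_derivative[of q v 0] q dd_u[OF q, of b v]
      by (intro has_vector_derivative_diff bounded_linear.has_vector_derivative[OF bounded_linear_scaleR_left]) auto
    from has_derivative_det[OF this]
    have "((\<lambda>r. det (pencil (u (q + r *\<^sub>R v) $ b) (q + r *\<^sub>R v))) has_real_derivative
        trace (?C ** (dd J q v - (w b q \<bullet> v) *\<^sub>R P2))) (at 0)" by simp
    moreover have "((\<lambda>r. det (pencil (u (q + r *\<^sub>R v) $ b) (q + r *\<^sub>R v))) has_real_derivative 0) (at 0)"
      by (rule has_field_derivative_transform_within_open[where f = "\<lambda>_. 0", OF DERIV_const T(1,2)])
         (use T(3) u_roots in auto)
    ultimately have "trace (?C ** (dd J q v - (w b q \<bullet> v) *\<^sub>R P2)) = 0"
      by (rule DERIV_unique)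
    then show ?thesis
      by (simp add: mm.diff_right mm.scaleR_right trace_sub trace_scaleR trace_cof_dd_J[OF q] mult.commute)
  qed
  then show ?thesis by (rule vector_eq_rdot[THEN iffD1, OF allI])
qed

end

lemma row_mult: "(A ** B) $ k = A $ k v* B" for A :: "real^'k^'j" and B :: "real^'l^'k"
  by (simp add: vec_eq_iff matrix_matrix_mult_def vector_matrix_mult_def mult.commute)

text \<open>Padded with zero rows so that \<open>P1 + stack z\<close> is the square matrix with rows
  dy^i and \<open>z c\<close>.\<close>

definition stack :: "('n \<Rightarrow> real^('m::finite + 'n::finite)) \<Rightarrow> real^('m + 'n)^('m + 'n)" where
  "stack z = (\<chi> k. case k of Inl i \<Rightarrow> 0 | Inr c \<Rightarrow> z c)"

lemma stack_nth: "stack z $ Inl i = 0" "stack z $ Inr c = z c"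
  by (simp_all add: stack_def)

lemma stack_mult: "(stack z ** M) $ Inl i = 0" "(stack z ** M) $ Inr c = z c v* M"
  by (simp_all add: row_mult stack_nth)

lemma P1_mult: "(P1 ** M) $ Inl i = M $ Inl i" "(P1 ** M) $ Inr a = 0"
  by (simp_all add: P1_def mm.diff_left P2_mult)

lemma mult_P1: "(M ** P1) $ k $ Inl i = M $ k $ Inl i" "(M ** P1) $ k $ Inr a = 0"
  by (simp_all add: P1_def mm.diff_right mult_P2)

lemma mult_P1_P2:
  fixes M :: "real^('m::finite + 'n::finite)^'k::finite"
  shows "M ** P1 ** P2 = 0" "M ** P2 ** P1 = 0" "M ** P2 ** P2 = M ** P2" "M ** P1 ** P1 = M ** P1"
  by (simp_all add: matrix_mul_assoc[symmetric] P1_P2 P2_P2)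

lemma vec_mult_stack: "x v* stack z = (\<Sum>c\<in>UNIV. x $ Inr c *\<^sub>R z c)"
  by (simp add: vec_eq_iff vector_matrix_mult_def sum_sum_type stack_nth mult.commute)

lemma nonzero_near:
  fixes f :: "real \<Rightarrow> real"
  assumes "(f has_real_derivative d) (at 0)" "d \<noteq> 0"
  shows "\<forall>\<^sub>F r in at 0. f r \<noteq> 0"
proof (cases "f 0 = 0")
  case True
  have "((\<lambda>r. (f r - f 0) / (r - 0)) \<longlongrightarrow> d) (at 0)"
    using assms(1) by (simp add: has_field_derivative_iff)
  from tendsto_imp_eventually_ne[OF this assms(2)]
  have "\<forall>\<^sub>F r in at 0. f r / r \<noteq> 0" by (simp add: True)
  then show ?thesis by eventually_elim auto
next
  case False
  have "(f \<longlongrightarrow> f 0) (at 0)"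
    using DERIV_isCont[OF assms(1)] by (simp add: isCont_def)
  then show ?thesis using False by (rule tendsto_imp_eventually_ne)
qed

section \<open>The determinant of the pencil as a product over the roots\<close>

context driven_system
begin

lemma \<Delta>_nz:
  assumes q: "q \<in> U"
  shows "\<Delta> q \<noteq> 0"
  unfolding \<Delta>_def
proof (rule det_nz_left_kernel)
  fix z :: "real^('m + 'n)" assume z: "z v* (P1 ** J q ** P1 + P2) = 0"
  have "(z v* (P1 ** J q ** P1 + P2)) v* P2 = P2 *v z"
    by (simp add: vector_matrix_mul_assoc mm.add_left mult_P1_P2 P2_P2) (simp add: P2_sym)
  then have r: "z $ Inr a = 0" for a
    using z P2_mult_vec(2)[of z a] by simp
  have "ypart z v* J1 (ypart q) = 0"
  proof (subst vec_eq_iff, intro allI)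
    fix j
    have "(P1 ** J q ** P1) $ k $ Inl j = (case k of Inl i \<Rightarrow> J q $ Inl i $ Inl j | Inr a \<Rightarrow> 0)" for k
      by (cases k) (simp_all add: mult_P1 P1_mult)
    then have "(z v* (P1 ** J q ** P1 + P2)) $ Inl j = (\<Sum>i\<in>UNIV. ypart z $ i * J1 (ypart q) $ i $ j)"
      using J1 q by (simp add: vector_matrix_mult_def sum_sum_type r P2_nth mult.commute) (simp add: ypart_def)
    then show "(ypart z v* J1 (ypart q)) $ j = 0 $ j"
      unfolding z by (simp add: vector_matrix_mult_def mult.commute)
  qed
  then have "ypart z = 0"
    using J1_nonsing q left_kernel_det_nz by blast
  then show "z = 0"
    by (intro sum_eqI) (simp_all add: r ypart_def vec_eq_iff)
qed

lemma \<Delta>_cong: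
  assumes "q \<in> U" "q' \<in> U" "ypart q = ypart q'"
  shows "\<Delta> q = \<Delta> q'"
proof -
  have "(P1 ** J q ** P1) $ k $ l = (P1 ** J q' ** P1) $ k $ l" for k l
    using assms J1
    by (cases k; cases l) (simp_all add: mult_P1 P1_mult)
  then have "P1 ** J q ** P1 = P1 ** J q' ** P1" by (simp add: vec_eq_iff)
  then show ?thesis by (simp add: \<Delta>_def)
qed

text \<open>The matrix is block triangular; a unipotent factor reduces it to the block diagonal
  matrix in \<open>\<Delta>\<close>.\<close>

lemma det_P1_J: "det (P1 ** J q + P2) = \<Delta> q"
proof -
  have "(mat 1 + P1 ** J q ** P2) ** (P1 ** J q ** P1 + P2) = P1 ** J q ** P1 + P2 + P1 ** J q ** P2"
    by (simp add: mm.add_left mm.add_right matrix_mul_assoc[symmetric] P1_P2 P2_P2)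
       (simp add: matrix_mul_assoc P1_P2)
  also have "\<dots> = P1 ** J q + P2"
    by (simp add: P1_def mm.diff_right)
  finally have "det (mat 1 + P1 ** J q ** P2) * \<Delta> q = det (P1 ** J q + P2)"
    by (simp add: \<Delta>_def det_mul[symmetric])
  then show ?thesis
    using det_unipotent(1)[of "P1 ** J q ** P2"]
    by (simp add: matrix_mul_assoc P1_P2) (simp add: matrix_mul_assoc[symmetric] P2_P2)
qed

text \<open>Multiplied from the left by the rows dy^i and \<open>z c\<close>, the pencil becomes a
  diagonal matrix with entries 1 and \<open>r c - l\<close> times a matrix free of \<open>l\<close>.
  The determinant of the latter is \<open>\<Delta> q\<close> times that of
  \<open>P1 + stack z\<close>, again up to a unipotent factor.\<close>

lemma det_pencil_eigenforms:
  fixes z :: "'n \<Rightarrow> real^('m + 'n)"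
  assumes eig: "\<And>c. z c v* J q = r c *\<^sub>R (P2 *v z c)" and nz: "det (P1 + stack z) \<noteq> 0"
  shows "det (pencil l q) = \<Delta> q * (\<Prod>c\<in>UNIV. r c - l)"
proof -
  define D where "D = (\<chi> k k'. if k = k' then (case k of Inl i \<Rightarrow> 1 | Inr c \<Rightarrow> r c - l) else 0 :: real^('m+'n)^('m+'n))"
  have D: "(D ** X) $ k = (case k of Inl i \<Rightarrow> 1 | Inr c \<Rightarrow> r c - l) *\<^sub>R X $ k" for X :: "real^('m+'n)^('m+'n)" and k
    by (simp add: vec_eq_iff matrix_matrix_mult_def D_def if_distrib[of "\<lambda>x. x * _"] cong: if_cong)
  have "P2 ** stack z = stack z"
    by (rule sum_eqI) (simp_all add: P2_mult stack_nth)
  then have P1s: "P1 ** stack z = 0"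
    by (simp add: P1_def mm.diff_left)
  have "(P1 + stack z) ** pencil l q = D ** ((P1 + stack z ** P2) ** (P1 ** J q + P2))"
  proof -
    have "(P1 + stack z ** P2) ** (P1 ** J q + P2) = P1 ** J q + stack z ** P2"
      by (simp add: mm.add_left mm.add_right matrix_mul_assoc P1_P2 mult_P1_P2)
    moreover have "(P1 + stack z) ** pencil l q = P1 ** J q + stack z ** J q - l *\<^sub>R (stack z ** P2)"
      by (simp add: mm.add_left mm.diff_right mm.scaleR_right P1_P2)
    moreover have "P1 ** J q + stack z ** J q - l *\<^sub>R (stack z ** P2) = D ** (P1 ** J q + stack z ** P2)"
      by (rule sum_eqI) (simp_all add: D P1_mult stack_mult eig P2_sym algebra_simps)
    ultimately show ?thesis by simp
  qed
  then have "det (P1 + stack z) * det (pencil l q) = det D * (det (P1 + stack z ** P2) * \<Delta> q)"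
    by (metis det_mul det_P1_J)
  moreover have "det (P1 + stack z ** P2) = det (P1 + stack z)"
  proof -
    have "(mat 1 + stack z ** P1) ** (P1 + stack z ** P2) = P1 + stack z"
    proof -
      have "(mat 1 + stack z ** P1) ** (P1 + stack z ** P2)
        = P1 + (stack z ** P2 + stack z ** P1) + stack z ** (P1 ** stack z) ** P2"
        by (simp add: mm.add_left mm.add_right) (simp add: matrix_mul_assoc[symmetric] P1_P2)
      then show ?thesis by (simp add: P1s mm.add_right[symmetric]) (simp add: P1_def)
    qed
    moreover have "det (mat 1 + stack z ** P1) = 1"
    proof -
      have "transpose (A - B) = transpose A - transpose B" for A B :: "real^('m+'n)^('m+'n)"
        by (simp add: transpose_def vec_eq_iff)
      then have tP1: "transpose P1 = (P1 :: real^('m+'n)^('m+'n))"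
        by (simp add: P1_def transpose_P2)
      have "P1 ** transpose (stack z ** P1) = transpose (stack z ** P1)"
        by (simp add: matrix_transpose_mul tP1 matrix_mul_assoc P1_P2)
      moreover have "transpose (stack z ** P1) ** P2 = transpose (stack z ** P1)"
      proof -
        have "transpose (stack z ** P1) ** P2 = transpose (P2 ** (stack z ** P1))"
          by (simp add: matrix_transpose_mul transpose_P2)
        then show ?thesis
          by (simp add: matrix_mul_assoc \<open>P2 ** stack z = stack z\<close>)
      qed
      ultimately show ?thesis
        using det_unipotent(2)[of "transpose (stack z ** P1)"] by simp
    qed
    ultimately show ?thesis by (metis det_mul mult_1)
  qed
  moreover have "det D = (\<Prod>c\<in>UNIV. r c - l)"
    by (subst det_diagonal) (simp_all add: D_def prod_sum_type)
  ultimately show ?thesis using nz by simp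
qed

text \<open>The value is the squared length of \<open>P2 *v z\<close>. If this projection vanished,
  \<open>z\<close> would be annihilated by the nonsingular \<open>J q\<close>.\<close>

lemma eigenform_pos:
  assumes q: "q \<in> U" and z: "z \<noteq> 0" "z v* J q = r *\<^sub>R (P2 *v z)"
  shows "ip q (P2 *v z) z > 0"
proof -
  have "P2 *v z \<noteq> 0"
    using z left_kernel_det_nz[OF det_J[OF q], of z] by auto
  then have "ip q (P2 *v z) (P2 *v z) > 0" by (rule ip_pos[OF q])
  then show ?thesis by (simp add: ip_P2[OF q])
qed

lemma eigenform_orthogonal:
  assumes q: "q \<in> U" and "z v* J q = r *\<^sub>R (P2 *v z)" "z' v* J q = r' *\<^sub>R (P2 *v z')" "r \<noteq> r'"
  shows "ip q (P2 *v z) z' = 0"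
proof -
  have "r * ip q (P2 *v z) z' = r' * ip q (P2 *v z) z'"
    using ip_J[OF q, of z z'] assms(2,3) by (simp add: mv.scaleR_right ip_P2[OF q])
  then show ?thesis using assms(4) by simp
qed

text \<open>Pairing a vanishing combination with \<open>R q *v (P2 *v z b)\<close> isolates the
  coefficient of \<open>z b\<close>: the rows of \<open>P1\<close> vanish on K, the other eigenforms
  are orthogonal, and \<open>eigenform_pos\<close> makes the remaining factor nonzero.\<close>

lemma eigenforms_independent:
  fixes z :: "'n \<Rightarrow> real^('m + 'n)"
  assumes q: "q \<in> U" and z: "\<And>c. z c \<noteq> 0" "\<And>c. z c v* J q = r c *\<^sub>R (P2 *v z c)" and r: "inj r"
  shows "det (P1 + stack z) \<noteq> 0"
proof (rule det_nz_left_kernel)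
  fix x assume x: "x v* (P1 + stack z) = 0"
  have e: "(x v* (P1 + stack z)) \<bullet> (R q *v (P2 *v z b)) = x $ Inr b * ip q (P2 *v z b) (z b)" for b
  proof -
    have "(x v* P1) \<bullet> (R q *v (P2 *v z b)) = x \<bullet> ((P1 ** P2) *v (R q *v z b))"
      by (simp only: P2_R_vec[OF q, symmetric] matrix_vector_mul_assoc[symmetric] dot_lmul_matrix)
    then have "(x v* (P1 + stack z)) \<bullet> (R q *v (P2 *v z b)) = (\<Sum>c\<in>UNIV. x $ Inr c * ip q (z c) (P2 *v z b))"
      by (simp add: vm.add_right inner_add_left P1_P2 vec_mult_stack inner_sum_left)
    also have "\<dots> = (\<Sum>c\<in>UNIV. if c = b then x $ Inr b * ip q (P2 *v z b) (z b) else 0)"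
    proof (rule sum.cong[OF refl])
      fix c
      show "x $ Inr c * ip q (z c) (P2 *v z b) = (if c = b then x $ Inr b * ip q (P2 *v z b) (z b) else 0)"
      proof (cases "c = b")
        case False
        then have "r c \<noteq> r b" using r by (auto dest: injD)
        then show ?thesis using eigenform_orthogonal[OF q z(2) z(2)] False by (simp add: ip_P2[OF q, symmetric])
      qed (simp add: ip_P2[OF q, symmetric])
    qed
    finally show ?thesis by simp
  qed
  then have "x $ Inr b = 0" for b
    using x e[of b] eigenform_pos[OF q z, of b] by simp
  moreover from this have "x v* P1 = 0" using x by (simp add: vm.add_right vec_mult_stack)
  then have "x $ Inl i = 0" for i
    by (simp add: P1_def vm.diff_right P2_sym) (metis P2_mult_vec(1))
  ultimately show "x = 0" by (intro sum_eqI) simp_all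
qed

lemma eigenforms_exist:
  assumes q: "q \<in> U"
  obtains z where "\<And>c. z c \<noteq> 0" "\<And>c. z c v* J q = u q $ c *\<^sub>R (P2 *v z c)"
proof -
  have "\<exists>x. x \<noteq> 0 \<and> x v* J q = u q $ c *\<^sub>R (P2 *v x)" for c
  proof -
    obtain x where "x \<noteq> 0" "x v* pencil (u q $ c) q = 0"
      using det_eq_0_left_kernel u_roots q by metis
    then show ?thesis by (auto simp: vm.diff_right vm.scaleR_right P2_sym)
  qed
  then show thesis using that by metis
qed

lemma det_pencil_distinct:
  assumes q: "q \<in> U" and inj: "inj (($) (u q))"
  shows "det (pencil l q) = \<Delta> q * (\<Prod>c\<in>UNIV. u q $ c - l)"
proof -
  obtain z where z: "\<And>c. z c \<noteq> 0" "\<And>c. z c v* J q = u q $ c *\<^sub>R (P2 *v z c)"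
    using eigenforms_exist[OF q] by blast
  show ?thesis
    by (rule det_pencil_eigenforms[OF z(2) eigenforms_independent[OF q z inj]])
qed

text \<open>Minus the \<open>l\<close>-derivative of the factored determinant of the pencil at its
  root \<open>u q $ b\<close>.\<close>

definition "\<tau> b q = \<Delta> q * (\<Prod>d\<in>UNIV - {b}. u q $ d - u q $ b)"

lemma \<tau>_nz: "q \<in> U \<Longrightarrow> inj (($) (u q)) \<Longrightarrow> \<tau> b q \<noteq> 0"
  by (auto simp: \<tau>_def \<Delta>_nz dest: injD)

text \<open>The derivative of the determinant in \<open>l\<close> is computed twice, by Jacobi's
  formula and from the factored form.\<close>

lemma trace_cof_root:
  assumes q: "q \<in> U" and inj: "inj (($) (u q))"
  shows "trace (C (u q $ b) q ** P2) = \<tau> b q"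
proof -
  have "((\<lambda>l. pencil l q) has_vector_derivative (0 - 1 *\<^sub>R P2)) (at (u q $ b))"
    by (intro has_vector_derivative_diff has_vector_derivative_const
        bounded_linear.has_vector_derivative[OF bounded_linear_scaleR_left] has_vector_derivative_id)
  from has_derivative_det[OF this]
  have "((\<lambda>l. det (pencil l q)) has_real_derivative - trace (C (u q $ b) q ** P2)) (at (u q $ b))"
    by (simp add: mm.minus_right trace_def sum_negf)
  moreover have "((\<lambda>l. det (pencil l q)) has_real_derivative - \<tau> b q) (at (u q $ b))"
  proof -
    have 1: "((\<lambda>l. u q $ b - l) has_real_derivative -1) (at (u q $ b))"
      by (auto intro!: derivative_eq_intros)
    \<comment> \<open>The derivative \<open>p\<close> of the remaining product need not be known,
      since it is multiplied by the factor that vanishes at the root.\<close>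
    have "(\<lambda>l. \<Prod>d\<in>UNIV - {b}. u q $ d - l) differentiable (at (u q $ b))"
      by (intro differentiableI has_derivative_prod) (auto intro!: derivative_eq_intros)
    then obtain p where 2: "((\<lambda>l. \<Prod>d\<in>UNIV - {b}. u q $ d - l) has_real_derivative p) (at (u q $ b))"
      by (auto simp: real_differentiable_def)
    have "det (pencil l q) = \<Delta> q * ((u q $ b - l) * (\<Prod>d\<in>UNIV - {b}. u q $ d - l))" for l
      unfolding det_pencil_distinct[OF assms] by (subst prod.remove[of UNIV b]) auto
    then show ?thesis
      using DERIV_cmult[OF DERIV_mult[OF 1 2], of "\<Delta> q"] by (simp add: \<tau>_def)
  qed
  ultimately show ?thesis by (metis DERIV_unique neg_equal_iff_equal)
qed

lemma dual_vector:
  assumes q: "q \<in> U"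
  obtains v where "P2 *v v = v" "\<And>b. w b q \<bullet> v = k $ b"
proof
  let ?M = "(\<chi> a b. pd (Inr b) (\<lambda>z. u z $ a) q) :: real^'n^'n"
  let ?v = "join 0 (matrix_inv ?M *v k)"
  have M: "det ?M \<noteq> 0" using u_indep q by blast
  show "P2 *v ?v = ?v"
    by (intro sum_eqI) (simp_all add: P2_mult_vec join_def)
  fix b
  have "w b q \<bullet> ?v = (?M *v (matrix_inv ?M *v k)) $ b"
    by (simp add: inner_vec_def df_def sum_sum_type join_def matrix_vector_mult_def)
  then show "w b q \<bullet> ?v = k $ b"
    by (simp add: matrix_vector_mul_assoc matrix_inv_mult(1)[OF M])
qed

lemma w_nz:
  assumes "q \<in> U"
  shows "w b q \<noteq> 0"
proof -
  obtain v where "\<And>c. w c q \<bullet> v = axis b 1 $ c" using dual_vector[OF assms] by metis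
  from this[of b] show ?thesis by auto
qed

lemma w_eigenform:
  assumes q: "q \<in> U"
  shows "w b q v* J q = u q $ b *\<^sub>R (P2 *v w b q)"
proof -
  define F where "F = (\<lambda>z. w b z v* J z - u z $ b *\<^sub>R (P2 *v w b z))"
  have F0: "F z = 0" if z: "z \<in> U" "inj (($) (u z))" for z
  proof -
    let ?l = "u z $ b"
    \<comment> \<open>\<open>root_gradient\<close> is multiplied by the pencil: the left side
      becomes the zero determinant times \<open>\<alpha>\<close>, the right side
      \<open>\<tau>\<close> times the desired equation.\<close>
    have "\<alpha> z v* C ?l z v* pencil ?l z = 0"
      using u_roots z by (simp add: C_pencil)
    then have "\<tau> b z *\<^sub>R (w b z v* pencil ?l z) = 0"
      by (simp add: root_gradient[OF z(1)] trace_cof_root[OF z] vm.scaleR_left)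
    then show ?thesis
      using \<tau>_nz[OF z, of b] by (simp add: F_def vm.diff_right vm.scaleR_right P2_sym)
  qed
  \<comment> \<open>The injection prescribes pairwise different speeds of the roots along the line
    in the direction \<open>v\<close>, so that roots coinciding at \<open>q\<close> separate at once
    and \<open>q\<close> is a limit of points with distinct roots.\<close>
  obtain e :: "'n \<Rightarrow> nat" where e: "inj e"
    using finite_imp_inj_to_nat_seg[of "UNIV :: 'n set"] by auto
  obtain v where v: "\<And>c. w c q \<bullet> v = (\<chi> c. real (e c)) $ c"
    using dual_vector[OF q] by metis
  let ?l = "\<lambda>r. q + r *\<^sub>R v"
  have "\<forall>\<^sub>F r in at 0. \<forall>c d. c \<noteq> d \<longrightarrow> u (?l r) $ c - u (?l r) $ d \<noteq> 0"
  proof (intro eventually_all_finite)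
    fix c d
    show "\<forall>\<^sub>F r in at 0. c \<noteq> d \<longrightarrow> u (?l r) $ c - u (?l r) $ d \<noteq> 0"
    proof (cases "c = d")
      case False
      have "((\<lambda>r. u (?l r) $ c - u (?l r) $ d) has_real_derivative
          dd (\<lambda>z. u z $ c) (?l 0) v - dd (\<lambda>z. u z $ d) (?l 0) v) (at 0)"
        by (intro DERIV_diff dd_line[OF smooth_u]) (use q in auto)
      moreover have "dd (\<lambda>z. u z $ c) (?l 0) v - dd (\<lambda>z. u z $ d) (?l 0) v \<noteq> 0"
        using False e by (simp add: dd_u[OF q] v) (auto dest: injD)
      ultimately have "\<forall>\<^sub>F r in at 0. u (?l r) $ c - u (?l r) $ d \<noteq> 0"
        by (rule nonzero_near)
      then show ?thesis by (simp add: False)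
    qed simp
  qed
  moreover have "\<forall>\<^sub>F r in at 0. ?l r \<in> U"
  proof -
    obtain T where "open T" "0 \<in> T" "\<And>r. r \<in> T \<Longrightarrow> ?l r \<in> U"
      using line_neighbourhood[OF q] by blast
    then show ?thesis by (auto simp: eventually_at_topological)
  qed
  ultimately have "\<forall>\<^sub>F r in at 0. F (?l r) = 0"
  proof eventually_elim
    case (elim r)
    then show ?case by (intro F0) (auto simp: inj_def)
  qed
  moreover have "((\<lambda>r. F (?l r)) \<longlongrightarrow> F q) (at 0)"
  proof -
    have "smooth_on U F"
      unfolding F_def
      by (intro smooth_on_add[of _ _ "\<lambda>x. - h x" for h, simplified] smooth_on_bounded_linear[OF open_U bounded_linear_minus[OF bounded_linear_ident]]
          smooth_on_vector_matrix_mult smooth_on_matrix_vector_mult smooth_on_const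
          smooth_on_bilinear[OF open_U bounded_bilinear_scaleR] open_U smooth_w smooth_J smooth_u)
    then have "isCont F q"
      using q open_U smooth_on_continuous_on continuous_on_eq_continuous_at by blast
    then have "isCont F (?l 0)" by simp
    moreover have "isCont ?l 0" by (intro continuous_intros)
    ultimately have "isCont (\<lambda>r. F (?l r)) 0"
      by - (rule isCont_o2)
    then show ?thesis by (simp add: isCont_def)
  qed
  moreover have "((\<lambda>r. F (?l r)) \<longlongrightarrow> 0) (at 0)" if "\<forall>\<^sub>F r in at 0. F (?l r) = 0"
    using that by (rule tendsto_eventually)
  ultimately have "F q = 0"
    using tendsto_unique[OF at_neq_bot] by blast
  then show ?thesis by (simp add: F_def)
qed

lemma w_pencil: "q \<in> U \<Longrightarrow> w b q v* pencil l q = (u q $ b - l) *\<^sub>R (P2 *v w b q)"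
  by (simp add: vm.diff_right vm.scaleR_right P2_sym w_eigenform algebra_simps)

lemma n_pos: "q \<in> U \<Longrightarrow> n b q > 0"
  by (rule eigenform_pos[OF _ w_nz w_eigenform])

end

lemma dd_cong:
  assumes "open U" "q \<in> U" "smooth_on U f" "\<And>z. z \<in> U \<Longrightarrow> f z = h z"
  shows "dd f q v = dd h q v"
  by (rule fun_cong[OF frechet_derivative_transform_within_open[OF
        smooth_on_differentiable[OF assms(3,2)] assms(1,2,4)]])

lemma dd_prod:
  fixes f :: "'i \<Rightarrow> 'a::euclidean_space \<Rightarrow> real"
  assumes "\<And>i. i \<in> I \<Longrightarrow> smooth_on U (f i)" "q \<in> U"
  shows "dd (\<lambda>z. \<Prod>i\<in>I. f i z) q v = (\<Sum>i\<in>I. dd (f i) q v * (\<Prod>j\<in>I - {i}. f j q))"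
  by (rule fun_cong[OF frechet_derivative_at[OF has_derivative_prod[OF
        smooth_on_has_derivative[OF assms]], symmetric]])

lemma dd_mult:
  fixes f h :: "'a::euclidean_space \<Rightarrow> real"
  shows "smooth_on U f \<Longrightarrow> smooth_on U h \<Longrightarrow> q \<in> U \<Longrightarrow>
    dd (\<lambda>z. f z * h z) q v = f q * dd h q v + dd f q v * h q"
  by (rule dd_bilinear[OF bounded_bilinear_mult])

lemma dd_diff:
  fixes f h :: "'a::euclidean_space \<Rightarrow> real"
  assumes "smooth_on U f" "smooth_on U h" "q \<in> U"
  shows "dd (\<lambda>z. f z - h z) q v = dd f q v - dd h q v"
  by (rule fun_cong[OF frechet_derivative_at[OF has_derivative_diff[OF
        smooth_on_has_derivative[OF assms(1,3)] smooth_on_has_derivative[OF assms(2,3)]], symmetric]])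

section \<open>The covariant Hessian of the roots\<close>

context driven_system
begin

text \<open>The covariant derivative of \<open>du\<^sup>b\<close> in the direction \<open>v\<close>.\<close>

definition nabla :: "'n \<Rightarrow> real^('m + 'n) \<Rightarrow> real^('m + 'n) \<Rightarrow> real^('m + 'n)" where
  "nabla b q v = dd (w b) q v - w b q v* \<Gamma> q v"

text \<open>Ordinary second derivatives commute and the connection is torsion-free.\<close>

lemma nabla_commute:
  assumes q: "q \<in> U"
  shows "nabla b q v \<bullet> z = nabla b q z \<bullet> v"
proof -
  have "dd (w b) q v \<bullet> z = dd (\<lambda>q. dd (\<lambda>z. u z $ b) q z) q v" for v z
  proof -
    have "dd (w b) q v \<bullet> z = dd (\<lambda>q. w b q \<bullet> z) q v"
      by (rule dd_bounded_linear[OF smooth_w q bounded_linear_inner_left, symmetric])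
    also have "\<dots> = dd (\<lambda>q. dd (\<lambda>z. u z $ b) q z) q v"
      by (rule dd_cong[OF open_U q]) (simp_all add: dd_u smooth_on_inner open_U smooth_w smooth_on_const)
    finally show ?thesis .
  qed
  moreover have "(w b q v* \<Gamma> q v) \<bullet> z = (w b q v* \<Gamma> q z) \<bullet> v"
    unfolding dot_lmul_matrix conn_commute[OF q, of v z] ..
  ultimately show ?thesis
    by (simp add: nabla_def inner_diff_left dd_commute[OF open_U smooth_u q])
qed

text \<open>The covariant derivative of \<open>w_eigenform\<close>: with \<open>P2\<close> parallel,
  only the derivative of the root and \<open>killing_part\<close> remain besides the
  Hessian.\<close>

lemma nabla_pencil:
  assumes q: "q \<in> U"
  shows "nabla b q v v* pencil (u q $ b) q
    = (w b q \<bullet> v) *\<^sub>R (P2 *v w b q) - w b q v* killing_part q (\<alpha> q) v"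
proof -
  let ?w = "w b q" and ?w' = "dd (w b) q v" and ?G = "\<Gamma> q v" and ?l = "u q $ b"
    and ?K = "killing_part q (\<alpha> q) v"
  have "dd (\<lambda>z. w b z v* J z) q v = dd (\<lambda>z. u z $ b *\<^sub>R (P2 *v w b z)) q v"
    by (rule dd_cong[OF open_U q smooth_on_vector_matrix_mult[OF open_U smooth_w smooth_J] w_eigenform])
  moreover have "dd (\<lambda>z. w b z v* J z) q v = ?w v* dd J q v + ?w' v* J q"
    by (rule dd_bilinear[OF vm.bounded_bilinear_axioms smooth_w smooth_J q])
  moreover have "dd (\<lambda>z. u z $ b *\<^sub>R (P2 *v w b z)) q v
    = ?l *\<^sub>R dd (\<lambda>z. P2 *v w b z) q v + dd (\<lambda>z. u z $ b) q v *\<^sub>R (P2 *v ?w)"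
    by (rule dd_bilinear[OF bounded_bilinear_scaleR smooth_u smooth_on_bounded_linear[OF open_U _ smooth_w] q])
       (rule matrix_vector_mul_bounded_linear)
  moreover have "dd (\<lambda>z. P2 *v w b z) q v = P2 *v ?w'"
    by (rule dd_bounded_linear[OF smooth_w q matrix_vector_mul_bounded_linear])
  ultimately have e: "?w v* dd J q v + ?w' v* J q = ?l *\<^sub>R (P2 *v ?w') + (?w \<bullet> v) *\<^sub>R (P2 *v ?w)"
    by (simp add: dd_u[OF q])
  have "?w v* (J q ** ?G) = ?l *\<^sub>R ((?w v* P2) v* ?G)"
    by (simp add: vector_matrix_mul_assoc[symmetric] w_eigenform[OF q] vm.scaleR_left P2_sym)
  also have "\<dots> = ?l *\<^sub>R (P2 *v (?w v* ?G))"
    by (simp only: vector_matrix_mul_assoc conn_mixed[OF q]) (simp only: vector_matrix_mul_assoc[symmetric] P2_sym)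
  finally have "?w v* dd J q v = ?l *\<^sub>R (P2 *v (?w v* ?G)) - (?w v* ?G) v* J q + ?w v* ?K"
    by (simp add: dd_J[OF q] vm.add_right vm.diff_right vector_matrix_mul_assoc)
  with e show ?thesis
    by (simp add: nabla_def vm.diff_left vm.diff_right vm.scaleR_right P2_sym mv.diff_right algebra_simps)
qed

lemma nabla_pencil_inner:
  assumes q: "q \<in> U"
  shows "(nabla b q v v* pencil (u q $ b) q) \<bullet> (R q *v \<xi>)
    = (w b q \<bullet> v) * ip q (P2 *v w b q) \<xi>
      - (1/2) * (ip q (w b q) (\<alpha> q) * (v \<bullet> \<xi>) + (w b q \<bullet> v) * ip q (\<alpha> q) \<xi>)"
proof -
  have "(g q *v v) \<bullet> (R q *v \<xi>) = v \<bullet> \<xi>"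
    by (metis dot_lmul_matrix gR_vec q vec_g)
  then show ?thesis
    unfolding nabla_pencil[OF q] vec_killing_part[OF q]
    by (simp add: inner_diff_left inner_add_left algebra_simps)
qed

lemma w_pencil_root: "q \<in> U \<Longrightarrow> w b q v* pencil (u q $ b) q = 0"
  by (simp add: w_pencil)

text \<open>The pencil is symmetric, so pairing \<open>nabla_pencil_inner\<close> with a form in its
  kernel removes the unknown Hessian. Applied to \<open>w b\<close> it determines the product with
  \<open>\<alpha>\<close>; applied to a second eigenform with the same root it gives a
  contradiction.\<close>

lemma kernel_pairing:
  assumes q: "q \<in> U" and \<xi>: "\<xi> v* pencil (u q $ b) q = 0"
  shows "(w b q \<bullet> v) * ip q (P2 *v w b q) \<xi>
      = (1/2) * (ip q (w b q) (\<alpha> q) * (v \<bullet> \<xi>) + (w b q \<bullet> v) * ip q (\<alpha> q) \<xi>)"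
proof -
  have "(nabla b q v v* pencil (u q $ b) q) \<bullet> (R q *v \<xi>) = 0"
    unfolding ip_pencil[OF q] \<xi> by simp
  then show ?thesis unfolding nabla_pencil_inner[OF q] by simp
qed

lemma ip_w_\<alpha>:
  assumes q: "q \<in> U"
  shows "ip q (w b q) (\<alpha> q) = n b q"
proof -
  \<comment> \<open>The coefficient vector of \<open>w b q\<close> serves as the direction
    \<open>v\<close>; all that matters is that the form does not vanish on it.\<close>
  have "w b q \<bullet> w b q \<noteq> 0" using w_nz[OF q] by simp
  moreover have "(w b q \<bullet> w b q) * n b q = (w b q \<bullet> w b q) * ip q (w b q) (\<alpha> q)"
    using kernel_pairing[OF q w_pencil_root[OF q], of b "w b q"] ip_commute[OF q, of "\<alpha> q"]
    by (simp add: field_simps)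
  ultimately show ?thesis by simp
qed

lemma distinct_roots:
  assumes q: "q \<in> U"
  shows "inj (($) (u q))"
proof (rule injI, rule ccontr)
  fix b c assume eq: "u q $ b = u q $ c" and ne: "b \<noteq> c"
  \<comment> \<open>With coinciding roots \<open>w c q\<close> lies in the kernel of the pencil at
    root \<open>b\<close>. Since \<open>w b q\<close> vanishes on \<open>v\<close> and
    \<open>w c q\<close> takes the value 1, \<open>kernel_pairing\<close> reduces to half of
    \<open>n b q\<close> being 0.\<close>
  obtain v where v: "\<And>d. w d q \<bullet> v = axis c 1 $ d" using dual_vector[OF q] by metis
  have "w c q v* pencil (u q $ b) q = 0"
    unfolding eq by (rule w_pencil_root[OF q])
  from kernel_pairing[OF q this, of v] have "n b q = 0"
    using ne v[of b] v[of c] by (simp add: ip_w_\<alpha>[OF q] axis_def inner_commute)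
  then show False using n_pos[OF q, of b] by simp
qed

lemma u_ne: "q \<in> U \<Longrightarrow> b \<noteq> c \<Longrightarrow> u q $ b \<noteq> u q $ c"
  using distinct_roots by (auto dest: injD)

lemma det_pencil: "q \<in> U \<Longrightarrow> det (pencil l q) = \<Delta> q * (\<Prod>c\<in>UNIV. u q $ c - l)"
  by (rule det_pencil_distinct[OF _ distinct_roots])

lemma w_orthogonal: "q \<in> U \<Longrightarrow> b \<noteq> c \<Longrightarrow> ip q (P2 *v w b q) (w c q) = 0"
  by (rule eigenform_orthogonal[OF _ w_eigenform w_eigenform u_ne])

text \<open>Away from the root, apply the cofactor matrix to \<open>w_pencil\<close> and cancel
  \<open>u q $ b - l\<close>. Both sides are continuous in \<open>l\<close>, which supplies the root
  itself.\<close>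

lemma P2_w_C:
  assumes q: "q \<in> U"
  shows "(P2 *v w b q) v* C l q = (\<Delta> q * (\<Prod>d\<in>UNIV - {b}. u q $ d - l)) *\<^sub>R w b q"
proof -
  let ?f = "\<lambda>l. (P2 *v w b q) v* C l q"
    and ?h = "\<lambda>l. (\<Delta> q * (\<Prod>d\<in>UNIV - {b}. u q $ d - l)) *\<^sub>R w b q"
  have ne: "?f l = ?h l" if "l \<noteq> u q $ b" for l
  proof -
    have "(u q $ b - l) *\<^sub>R ?f l = det (pencil l q) *\<^sub>R w b q"
      using C_pencil(2)[of "w b q" q l] by (simp add: w_pencil[OF q] vm.scaleR_left)
    also have "det (pencil l q) = (u q $ b - l) * (\<Delta> q * (\<Prod>d\<in>UNIV - {b}. u q $ d - l))"
      unfolding det_pencil[OF q] by (subst prod.remove[of UNIV b]) auto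
    finally have "(u q $ b - l) *\<^sub>R ?f l = (u q $ b - l) *\<^sub>R ?h l" by simp
    then show ?thesis by (rule real_vector.scale_left_imp_eq[rotated]) (use that in simp)
  qed
  have "smooth_on UNIV (\<lambda>l::real. pencil l q)"
    by (intro smooth_on_add[of _ _ "\<lambda>x. - h x" for h, simplified] smooth_on_const
        smooth_on_bounded_linear[OF open_UNIV bounded_linear_minus[OF bounded_linear_ident]]
        smooth_on_linear bounded_linear_scaleR_left) simp_all
  then have "smooth_on UNIV ?f"
    by (intro smooth_on_vector_matrix_mult smooth_on_const smooth_on_cof) simp_all
  then have "isCont ?f (u q $ b)"
    using smooth_on_continuous_on continuous_on_eq_continuous_at by blast
  then have "(?f \<longlongrightarrow> ?f (u q $ b)) (at (u q $ b))" by (simp add: isCont_def)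
  moreover have "(?h \<longlongrightarrow> ?h (u q $ b)) (at (u q $ b))"
    by (intro tendsto_intros)
  then have "(?f \<longlongrightarrow> ?h (u q $ b)) (at (u q $ b))"
    by (rule Lim_transform_eventually) (simp add: eventually_at_filter ne)
  ultimately have "?f (u q $ b) = ?h (u q $ b)"
    by (rule tendsto_unique[OF at_neq_bot])
  then show ?thesis using ne by (cases "l = u q $ b") simp_all
qed

text \<open>Forms \<open>\<nu> v* J q\<close> with \<open>P2 *v \<nu> = 0\<close> are orthogonal to
  every \<open>w b q\<close>, and so is \<open>P2 *v w c q\<close> for \<open>c \<noteq> b\<close>.
  Thus pairing with \<open>w b q\<close> reads off the coefficient \<open>m b\<close>, and
  nonsingularity of \<open>J q\<close> settles the rest.\<close>

lemma covector_decomposition: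
  assumes q: "q \<in> U"
  obtains \<nu> m where "P2 *v \<nu> = 0" "\<kappa> = \<nu> v* J q + (\<Sum>c\<in>UNIV. m c *\<^sub>R (P2 *v w c q))"
proof -
  let ?X = "P1 ** J q + stack (\<lambda>c. P2 *v w c q)"
  have X: "x v* ?X = (x v* P1) v* J q + (\<Sum>c\<in>UNIV. x $ Inr c *\<^sub>R (P2 *v w c q))" for x
    by (simp add: vm.add_right vec_mult_stack vector_matrix_mul_assoc)
  have P1: "P2 *v (x v* P1) = 0" for x
    by (simp add: P2_sym[symmetric] vector_matrix_mul_assoc P1_P2)
  have "det ?X \<noteq> 0"
  proof (rule det_nz_left_kernel)
    fix x assume x: "x v* ?X = 0"
    have "x $ Inr b = 0" for b
    proof -
      have "ip q ((x v* P1) v* J q) (w b q) = 0"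
        by (simp add: ip_J[OF q] w_eigenform[OF q] mv.scaleR_right ip_P2[OF q, symmetric] P1)
      then have "ip q (x v* ?X) (w b q) = (\<Sum>c\<in>UNIV. x $ Inr c * ip q (P2 *v w c q) (w b q))"
        by (simp add: X inner_add_left inner_sum_left)
      also have "\<dots> = (\<Sum>c\<in>UNIV. if c = b then x $ Inr b * n b q else 0)"
        by (rule sum.cong) (auto simp: w_orthogonal[OF q])
      finally show ?thesis using x n_pos[OF q, of b] by simp
    qed
    moreover from this have "(x v* P1) v* J q = 0" using x by (simp add: X)
    then have "x v* P1 = 0" by (rule left_kernel_det_nz[OF det_J[OF q]])
    then have "x $ Inl i = 0" for i
      by (simp add: P1_def vm.diff_right P2_sym) (metis P2_mult_vec(1))
    ultimately show "x = 0" by (intro sum_eqI) simp_all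
  qed
  then have e: "\<kappa> = (\<kappa> v* matrix_inv ?X) v* ?X"
    by (simp add: vector_matrix_mul_assoc matrix_inv_mult(2))
  show thesis by (rule that[OF P1 trans[OF e X]])
qed

text \<open>The image of the symmetric pencil is the annihilator of its kernel, and that kernel is
  spanned by \<open>w b q\<close> because the roots are distinct. Explicitly, \<open>m b\<close>
  vanishes and the other coefficients are divided by differences of roots.\<close>

lemma kernel_w:
  assumes q: "q \<in> U" and v: "w b q \<bullet> v = 0"
  obtains \<xi> where "v = R q *v (\<xi> v* pencil (u q $ b) q)"
proof -
  obtain \<nu> m where \<nu>: "P2 *v \<nu> = 0"
    and \<kappa>: "g q *v v = \<nu> v* J q + (\<Sum>c\<in>UNIV. m c *\<^sub>R (P2 *v w c q))"
    using covector_decomposition[OF q] by blast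
  have "ip q (\<nu> v* J q) (w b q) = 0"
    by (simp add: ip_J[OF q] w_eigenform[OF q] mv.scaleR_right ip_P2[OF q, symmetric] \<nu>)
  then have "ip q (g q *v v) (w b q) = (\<Sum>c\<in>UNIV. m c * ip q (P2 *v w c q) (w b q))"
    by (simp add: \<kappa> inner_add_left inner_sum_left)
  also have "\<dots> = (\<Sum>c\<in>UNIV. if c = b then m b * n b q else 0)"
    by (rule sum.cong) (auto simp: w_orthogonal[OF q])
  finally have "m b * n b q = 0"
    using v by (simp add: ip_commute[OF q, of "g q *v v"] Rg_vec[OF q])
  then have m: "m b = 0" using n_pos[OF q, of b] by simp
  \<comment> \<open>For \<open>c = b\<close> the quotient is 0 by the convention for division by 0,
    in accordance with \<open>m b = 0\<close>.\<close>
  define \<xi> where "\<xi> = \<nu> + (\<Sum>c\<in>UNIV. (m c / (u q $ c - u q $ b)) *\<^sub>R w c q)"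
  have "\<nu> v* pencil (u q $ b) q = \<nu> v* J q"
    by (simp add: vm.diff_right vm.scaleR_right P2_sym \<nu>)
  moreover have "(\<Sum>c\<in>UNIV. (m c / (u q $ c - u q $ b)) *\<^sub>R w c q) v* pencil (u q $ b) q
      = (\<Sum>c\<in>UNIV. m c *\<^sub>R (P2 *v w c q))"
    unfolding vm.sum_left
  proof (rule sum.cong[OF refl])
    fix c
    show "(m c / (u q $ c - u q $ b)) *\<^sub>R w c q v* pencil (u q $ b) q = m c *\<^sub>R (P2 *v w c q)"
      using m u_ne[OF q, of c b] by (cases "c = b") (simp_all add: vm.scaleR_left w_pencil[OF q])
  qed
  ultimately have "\<xi> v* pencil (u q $ b) q = g q *v v"
    by (simp add: \<xi>_def vm.add_left \<kappa>)
  then have "v = R q *v (\<xi> v* pencil (u q $ b) q)" by (simp add: Rg_vec[OF q])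
  then show thesis by (rule that)
qed

lemma smooth_\<Delta>: "smooth_on U \<Delta>"
  unfolding \<Delta>_def
  by (intro smooth_on_det smooth_on_add smooth_on_matrix_mult smooth_on_const smooth_J open_U)

lemma P2_d\<Delta>:
  assumes q: "q \<in> U"
  shows "P2 *v df \<Delta> q = 0"
proof (rule sum_eqI)
  fix a
  obtain T where T: "open T" "0 \<in> T" "\<And>r. r \<in> T \<Longrightarrow> q + r *\<^sub>R axis (Inr a) 1 \<in> U"
    using line_neighbourhood[OF q] by blast
  have "((\<lambda>r. \<Delta> (q + r *\<^sub>R axis (Inr a) 1)) has_vector_derivative 0) (at 0)"
    by (rule has_vector_derivative_transform_within_open[where f = "\<lambda>_. \<Delta> q", OF has_vector_derivative_const T(1,2)])
       (rule \<Delta>_cong[OF q T(3)], simp_all add: ypart_def vec_eq_iff axis_def)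
  then have "dd \<Delta> q (axis (Inr a) 1) = 0"
    by (rule dd_eqI[OF smooth_\<Delta> q])
  then show "(P2 *v df \<Delta> q) $ Inr a = 0 $ Inr a"
    by (simp add: P2_mult_vec df_def pd_def)
qed (simp add: P2_mult_vec)

text \<open>The gradient of \<open>det (J z)\<close> is \<open>\<alpha> q v* cof (J q)\<close>, and
  \<open>det (J z)\<close> is \<open>\<Delta> z\<close> times the product of the roots. After
  multiplication by \<open>J q\<close> that product is a common factor, nonzero because
  \<open>J q\<close> is nonsingular.\<close>

lemma d\<Delta>_J:
  assumes q: "q \<in> U"
  shows "df \<Delta> q v* J q = \<Delta> q *\<^sub>R (\<alpha> q - (\<Sum>d\<in>UNIV. P2 *v w d q))"
proof -
  let ?p = "\<Prod>c\<in>UNIV. u q $ c"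
  have dJ: "det (J z) = \<Delta> z * (\<Prod>c\<in>UNIV. u z $ c)" if "z \<in> U" for z
    using det_pencil[OF that, of 0] by simp
  have p: "?p \<noteq> 0" using det_J[OF q] dJ[OF q] by auto
  have "\<alpha> q v* cof (J q) = ?p *\<^sub>R df \<Delta> q + \<Delta> q *\<^sub>R (\<Sum>d\<in>UNIV. (\<Prod>e\<in>UNIV - {d}. u q $ e) *\<^sub>R w d q)" (is "?a = ?b")
  proof (rule vector_eq_rdot[THEN iffD1, OF allI])
    fix v
    have "((\<lambda>r. det (J (q + r *\<^sub>R v))) has_real_derivative trace (cof (J q) ** dd J q v)) (at 0)"
      using has_derivative_det[OF dd_curve[OF smooth_J _ line_has_vector_derivative], of q 0 v] q by simp
    then have "dd (\<lambda>z. det (J z)) q v = trace (cof (J q) ** dd J q v)"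
      by (intro dd_eqI[OF smooth_on_det[OF open_U smooth_J] q])
         (simp add: has_real_derivative_iff_has_vector_derivative)
    also have "\<dots> = ?a \<bullet> v"
      using trace_cof_dd_J[OF q, of 0 v] by simp
    finally have "?a \<bullet> v = dd (\<lambda>z. \<Delta> z * (\<Prod>c\<in>UNIV. u z $ c)) q v"
      using dd_cong[OF open_U q smooth_on_det[OF open_U smooth_J] dJ, of v] by simp
    also have "\<dots> = ?b \<bullet> v"
      by (simp add: dd_mult[OF smooth_\<Delta> smooth_on_prod[OF open_U smooth_u] q] dd_prod[OF smooth_u q] dd_u[OF q]
          dd_eq_df[OF smooth_\<Delta> q] inner_add_left inner_sum_left algebra_simps)
    finally show "?a \<bullet> v = ?b \<bullet> v" .
  qed
  then have "?a v* J q = ?p *\<^sub>R (df \<Delta> q v* J q)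
      + \<Delta> q *\<^sub>R (\<Sum>d\<in>UNIV. (\<Prod>e\<in>UNIV - {d}. u q $ e) *\<^sub>R (w d q v* J q))"
    by (simp add: vm.add_left vm.scaleR_left vm.sum_left)
  also have "(\<Sum>d\<in>UNIV. (\<Prod>e\<in>UNIV - {d}. u q $ e) *\<^sub>R (w d q v* J q)) = (\<Sum>d\<in>UNIV. ?p *\<^sub>R (P2 *v w d q))"
  proof (rule sum.cong[OF refl])
    fix d
    have "?p = u q $ d * (\<Prod>e\<in>UNIV - {d}. u q $ e)" by (rule prod.remove) auto
    then show "(\<Prod>e\<in>UNIV - {d}. u q $ e) *\<^sub>R (w d q v* J q) = ?p *\<^sub>R (P2 *v w d q)"
      by (simp add: w_eigenform[OF q] mult.commute)
  qed
  also have "?a v* J q = (?p * \<Delta> q) *\<^sub>R \<alpha> q"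
    using C_pencil(1)[of "\<alpha> q" q 0] dJ[OF q] by (simp add: mult.commute)
  finally have "?p *\<^sub>R (\<Delta> q *\<^sub>R \<alpha> q) = ?p *\<^sub>R (df \<Delta> q v* J q + \<Delta> q *\<^sub>R (\<Sum>d\<in>UNIV. P2 *v w d q))"
    by (simp add: scaleR_sum_right scaleR_add_right mult_ac)
  then have "\<Delta> q *\<^sub>R \<alpha> q = df \<Delta> q v* J q + \<Delta> q *\<^sub>R (\<Sum>d\<in>UNIV. P2 *v w d q)"
    by (rule real_vector.scale_left_imp_eq[OF p])
  then show ?thesis by (simp add: algebra_simps)
qed

section \<open>The coefficient of the squared momentum as a function of one root\<close>

lemma smooth_\<tau>: "smooth_on U (\<tau> b)"
  unfolding \<tau>_def by (intro smooth_on_mult smooth_\<Delta> smooth_on_prod smooth_on_diff smooth_u open_U)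

lemma smooth_P2_w: "smooth_on U (\<lambda>z. P2 *v w b z)"
  by (rule smooth_on_bounded_linear[OF open_U matrix_vector_mul_bounded_linear smooth_w])

lemma smooth_R_w: "smooth_on U (\<lambda>z. R z *v w b z)"
  by (rule smooth_on_matrix_vector_mult[OF open_U smooth_R smooth_w])

lemma smooth_n: "smooth_on U (n b)"
  by (rule smooth_on_inner[OF open_U smooth_P2_w smooth_R_w])

text \<open>Each \<open>w d q\<close> takes a multiple of \<open>u q $ d - u q $ b\<close> on this
  direction, which restores the factor lost by differentiation. The resulting sum over
  \<open>d \<noteq> b\<close> cancels against the sum in \<open>d\<Delta>_J\<close>, leaving the
  term with \<open>d = b\<close>.\<close>

lemma dd_\<tau>:
  assumes q: "q \<in> U"
  shows "dd (\<tau> b) q (R q *v (\<xi> v* pencil (u q $ b) q)) = \<tau> b q * (ip q (\<alpha> q) \<xi> - ip q (P2 *v w b q) \<xi>)"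
proof -
  let ?v = "R q *v (\<xi> v* pencil (u q $ b) q)" and ?p = "\<Prod>d\<in>UNIV - {b}. u q $ d - u q $ b"
  have w: "w d q \<bullet> ?v = (u q $ d - u q $ b) * ip q (P2 *v w d q) \<xi>" for d
    unfolding ip_pencil[OF q, symmetric] by (simp add: w_pencil[OF q])
  have "df \<Delta> q \<bullet> ?v = ip q (df \<Delta> q v* J q) \<xi>"
    unfolding ip_pencil[OF q, symmetric]
    by (simp add: vm.diff_right vm.scaleR_right P2_sym P2_d\<Delta>[OF q])
  also have "\<dots> = \<Delta> q * (ip q (\<alpha> q) \<xi> - (\<Sum>d\<in>UNIV. ip q (P2 *v w d q) \<xi>))"
    by (simp add: d\<Delta>_J[OF q] inner_diff_left inner_sum_left)
  finally have d\<Delta>: "df \<Delta> q \<bullet> ?v = \<Delta> q * (ip q (\<alpha> q) \<xi> - (\<Sum>d\<in>UNIV. ip q (P2 *v w d q) \<xi>))" .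
  have "dd (\<lambda>z. \<Prod>d\<in>UNIV - {b}. u z $ d - u z $ b) q ?v
    = (\<Sum>d\<in>UNIV - {b}. (w d q \<bullet> ?v - w b q \<bullet> ?v) * (\<Prod>e\<in>UNIV - {b} - {d}. u q $ e - u q $ b))"
    by (simp only: dd_prod[OF smooth_on_diff[OF open_U smooth_u smooth_u] q]
        dd_diff[OF smooth_u smooth_u q] dd_u[OF q])
  also have "\<dots> = (\<Sum>d\<in>UNIV - {b}. ip q (P2 *v w d q) \<xi> * ?p)"
  proof (rule sum.cong[OF refl])
    fix d assume d: "d \<in> UNIV - {b}"
    have "?p = (u q $ d - u q $ b) * (\<Prod>e\<in>UNIV - {b} - {d}. u q $ e - u q $ b)"
      by (rule prod.remove) (use d in auto)
    then show "(w d q \<bullet> ?v - w b q \<bullet> ?v) * (\<Prod>e\<in>UNIV - {b} - {d}. u q $ e - u q $ b)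
      = ip q (P2 *v w d q) \<xi> * ?p"
      by (simp add: w)
  qed
  finally have dp: "dd (\<lambda>z. \<Prod>d\<in>UNIV - {b}. u z $ d - u z $ b) q ?v
    = ?p * (\<Sum>d\<in>UNIV - {b}. ip q (P2 *v w d q) \<xi>)"
    by (simp add: sum_distrib_left mult.commute)
  have "(\<Sum>d\<in>UNIV. ip q (P2 *v w d q) \<xi>) = ip q (P2 *v w b q) \<xi> + (\<Sum>d\<in>UNIV - {b}. ip q (P2 *v w d q) \<xi>)"
    by (rule sum.remove) auto
  then show ?thesis
    unfolding \<tau>_def dd_mult[OF smooth_\<Delta> smooth_on_prod[OF open_U smooth_on_diff[OF open_U smooth_u smooth_u]] q]
      dd_eq_df[OF smooth_\<Delta> q] dp d\<Delta>
    by (simp add: algebra_simps)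
qed

text \<open>The metric and \<open>P2\<close> are parallel, so the connection terms cancel and only
  the Hessian of the root is left.\<close>

lemma dd_n:
  assumes q: "q \<in> U"
  shows "dd (n b) q v = 2 * (nabla b q v \<bullet> (R q *v (P2 *v w b q)))"
proof -
  let ?w = "w b q" and ?w' = "dd (w b) q v" and ?G = "\<Gamma> q v"
  have "dd (\<lambda>z. R z *v w b z) q v = R q *v ?w' + dd R q v *v ?w"
    by (rule dd_bilinear[OF mv.bounded_bilinear_axioms smooth_R smooth_w q])
  moreover have "dd (\<lambda>z. P2 *v w b z) q v = P2 *v ?w'"
    by (rule dd_bounded_linear[OF smooth_w q matrix_vector_mul_bounded_linear])
  ultimately have "dd (n b) q v = (P2 *v ?w) \<bullet> (R q *v ?w' + dd R q v *v ?w) + (P2 *v ?w') \<bullet> (R q *v ?w)"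
    using dd_bilinear[OF bounded_bilinear_inner smooth_P2_w smooth_R_w q, of b b v] by simp
  also have "dd R q v *v ?w = - (?G *v (R q *v ?w)) - R q *v (?w v* ?G)"
    by (simp add: dd_R[OF q] mv.diff_left mv.minus_left matrix_vector_mul_assoc[symmetric])
  also have "(P2 *v ?w) \<bullet> (R q *v ?w' + (- (?G *v (R q *v ?w)) - R q *v (?w v* ?G))) + (P2 *v ?w') \<bullet> (R q *v ?w)
    = ip q (P2 *v ?w) (nabla b q v) + (ip q (P2 *v ?w') ?w - ((P2 *v ?w) v* ?G) \<bullet> (R q *v ?w))"
    by (simp add: nabla_def mv.diff_right inner_diff_right inner_add_right dot_lmul_matrix)
  also have "(P2 *v ?w) v* ?G = P2 *v (?w v* ?G)"
    by (simp only: P2_sym[symmetric] vector_matrix_mul_assoc conn_mixed[OF q])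
  also have "ip q (P2 *v ?w') ?w - (P2 *v (?w v* ?G)) \<bullet> (R q *v ?w) = ip q (P2 *v nabla b q v) ?w"
    by (simp add: nabla_def mv.diff_right inner_diff_left)
  also have "\<dots> = ip q (nabla b q v) (P2 *v ?w)" by (rule ip_P2[OF q])
  also have "ip q (P2 *v ?w) (nabla b q v) = ip q (nabla b q v) (P2 *v ?w)" by (rule ip_commute[OF q])
  finally show ?thesis by simp
qed

text \<open>The symmetry of the covariant Hessian moves the derivative to the direction \<open>R (P2 w)\<close>, where
  \<open>nabla_pencil\<close> determines it; directly it is known only up to multiples of \<open>w\<close>.\<close>

lemma dd_n_kernel:
  assumes q: "q \<in> U"
  shows "dd (n b) q (R q *v (\<xi> v* pencil (u q $ b) q)) = n b q * (ip q (P2 *v w b q) \<xi> - ip q (\<alpha> q) \<xi>)"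
proof -
  let ?z = "R q *v (P2 *v w b q)"
  have wz: "w b q \<bullet> ?z = n b q" by (rule ip_P2[OF q, symmetric])
  have z\<xi>: "?z \<bullet> \<xi> = ip q (P2 *v w b q) \<xi>"
    using ip_commute[OF q, of \<xi> "P2 *v w b q"] by (simp add: inner_commute)
  have "nabla b q (R q *v (\<xi> v* pencil (u q $ b) q)) \<bullet> ?z = nabla b q ?z \<bullet> (R q *v (\<xi> v* pencil (u q $ b) q))"
    by (rule nabla_commute[OF q])
  also have "\<dots> = (nabla b q ?z v* pencil (u q $ b) q) \<bullet> (R q *v \<xi>)"
    by (rule ip_pencil[OF q, symmetric])
  also have "\<dots> = (1/2) * (n b q * (ip q (P2 *v w b q) \<xi> - ip q (\<alpha> q) \<xi>))"
    unfolding nabla_pencil_inner[OF q] wz z\<xi> ip_w_\<alpha>[OF q] by (simp add: algebra_simps)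
  finally show ?thesis by (simp add: dd_n[OF q])
qed

definition "\<Phi> b q = \<tau> b q * n b q"

lemma smooth_\<Phi>: "smooth_on U (\<Phi> b)"
  unfolding \<Phi>_def by (rule smooth_on_mult[OF open_U smooth_\<tau> smooth_n])

lemma \<Phi>_nz: "q \<in> U \<Longrightarrow> \<Phi> b q \<noteq> 0"
  using \<tau>_nz[OF _ distinct_roots, of q b] n_pos[of q b] by (simp add: \<Phi>_def)

lemma dd_\<Phi>_kernel:
  assumes q: "q \<in> U" and v: "w b q \<bullet> v = 0"
  shows "dd (\<Phi> b) q v = 0"
proof -
  obtain \<xi> where \<xi>: "v = R q *v (\<xi> v* pencil (u q $ b) q)" using kernel_w[OF assms] by blast
  show ?thesis
    unfolding \<Phi>_def dd_mult[OF smooth_\<tau> smooth_n q] \<xi> dd_\<tau>[OF q] dd_n_kernel[OF q]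
    by (simp add: algebra_simps)
qed

end

section \<open>The quadratic integrals\<close>

text \<open>An identity for all real \<open>c\<close> is an identity of polynomials. The exponent
  \<open>i - 1\<close> makes index \<open>m + 1\<close> the coefficient at degree
  \<open>m\<close>.\<close>

lemma top_coefficient:
  fixes a :: "nat \<Rightarrow> real"
  assumes "\<And>c. (\<Sum>i=1..m + 1. c ^ (i - 1) * a i) = poly r c"
  shows "a (m + 1) = coeff r m"
proof -
  have "poly (\<Sum>i=1..m + 1. monom (a i) (i - 1)) = poly r"
    using assms by (simp add: fun_eq_iff poly_sum poly_monom mult.commute)
  then have "(\<Sum>i=1..m + 1. monom (a i) (i - 1)) = r" by (simp add: poly_eq_poly_eq_iff)
  moreover have "coeff (\<Sum>i=1..m + 1. monom (a i) (i - 1)) m = (\<Sum>i=1..m + 1. if i = m + 1 then a i else 0)"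
    unfolding coeff_sum by (rule sum.cong) auto
  ultimately show ?thesis by auto
qed

lemma degree_prod_linear: "finite D \<Longrightarrow> degree (\<Prod>d\<in>D. [:r d, 1:]) = card D" for r :: "'i \<Rightarrow> real"
  by (subst degree_prod_eq_sum_degree) auto

lemma coeff_prod_linear:
  fixes r :: "'i \<Rightarrow> real"
  assumes "finite D"
  shows "coeff (\<Prod>d\<in>D. [:r d, 1:]) (card D) = 1"
proof -
  have "lead_coeff (\<Prod>d\<in>D. [:r d, 1:]) = 1" by (simp add: lead_coeff_prod)
  then show ?thesis by (simp add: degree_prod_linear assms)
qed

lemma dd_power_0:
  fixes f :: "'a::euclidean_space \<Rightarrow> real"
  assumes "open U" "smooth_on U f" "q \<in> U" "dd f q v = 0"
  shows "dd (\<lambda>z. f z ^ j) q v = 0"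
  by (induction j) (simp_all add: dd_mult[OF assms(2) smooth_on_power[OF assms(1,2)] assms(3)] assms(4))

locale driven_integrals = driven_system U g J \<mu> V g1 J1 g2 Q1 u
  for U :: "(real^('m::finite + 'n::finite)) set" and g J \<mu> V g1 J1 g2 Q1 u +
  fixes A :: "nat \<Rightarrow> real^('m + 'n) \<Rightarrow> real^('m + 'n)^('m + 'n)"
    and W :: "nat \<Rightarrow> real^('m + 'n) \<Rightarrow> real"
  assumes A: "\<forall>q\<in>U. \<forall>c. cof (J q + c *\<^sub>R P2) = (\<Sum>i=1..CARD('n) + 1. c ^ (i - 1) *\<^sub>R A i q)"
    and W: "\<forall>i\<in>{1..CARD('n) + 1}. smooth_on U (W i) \<and> (\<forall>q\<in>U. \<mu> q v* A i q = - df (W i) q)"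
begin

definition "\<phi> b q = (\<Sum>i=1..CARD('n) + 1. (- u q $ b) ^ (i - 1) * W i q)"

abbreviation "A_top q \<equiv> A (CARD('n) + 1) q"
abbreviation "W_top q \<equiv> W (CARD('n) + 1) q"

lemma smooth_W: "i \<in> {1..CARD('n) + 1} \<Longrightarrow> smooth_on U (W i)"
  using W by blast

lemma dd_W: "i \<in> {1..CARD('n) + 1} \<Longrightarrow> q \<in> U \<Longrightarrow> dd (W i) q v = - ((\<mu> q v* A i q) \<bullet> v)"
  using W by (simp add: dd_eq_df[OF smooth_W] del: One_nat_def)

lemma C_eq: "q \<in> U \<Longrightarrow> C l q = (\<Sum>i=1..CARD('n) + 1. (- l) ^ (i - 1) *\<^sub>R A i q)"
  using A[rule_format, of q "- l"] by simp

lemma smooth_\<phi>: "smooth_on U (\<phi> b)"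
  unfolding \<phi>_def
  by (intro smooth_on_sum smooth_on_mult smooth_on_power smooth_on_uminus smooth_u smooth_W open_U) simp_all

text \<open>On the kernel of \<open>w b\<close> the powers of the root are stationary, so only the
  \<open>W i\<close> contribute, and their differentials add up to minus
  \<open>\<mu> q v* C (u q $ b) q\<close>. The pencil supplied by \<open>kernel_w\<close> turns this
  into a multiple of its determinant 0.\<close>

lemma dd_\<phi>_kernel:
  assumes q: "q \<in> U" and v: "w b q \<bullet> v = 0"
  shows "dd (\<phi> b) q v = 0"
proof -
  let ?l = "u q $ b"
  obtain \<xi> where \<xi>: "v = R q *v (\<xi> v* pencil ?l q)" using kernel_w[OF assms] by blast
  have su: "smooth_on U (\<lambda>z. - u z $ b)" by (rule smooth_on_uminus[OF open_U smooth_u])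
  have "dd (\<lambda>z. - u z $ b) q v = 0"
    using dd_bounded_linear[OF smooth_u q bounded_linear_minus[OF bounded_linear_ident], of b v] v
    by (simp add: dd_u[OF q])
  note p0 = dd_power_0[OF open_U su q this]
  have "(\<phi> b has_derivative (\<lambda>h. \<Sum>i=1..CARD('n) + 1. dd (\<lambda>z. (- u z $ b) ^ (i - 1) * W i z) q h)) (at q)"
    unfolding \<phi>_def
    by (intro has_derivative_sum smooth_on_has_derivative[OF smooth_on_mult[OF open_U smooth_on_power[OF open_U su] smooth_W] q])
  from fun_cong[OF frechet_derivative_at[OF this, symmetric], of v]
  have "dd (\<phi> b) q v = (\<Sum>i=1..CARD('n) + 1. dd (\<lambda>z. (- u z $ b) ^ (i - 1) * W i z) q v)" .
  also have "\<dots> = (\<Sum>i=1..CARD('n) + 1. - ((- ?l) ^ (i - 1) * ((\<mu> q v* A i q) \<bullet> v)))"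
  proof (rule sum.cong[OF refl])
    fix i assume i: "i \<in> {1..CARD('n) + 1}"
    show "dd (\<lambda>z. (- u z $ b) ^ (i - 1) * W i z) q v = - ((- ?l) ^ (i - 1) * ((\<mu> q v* A i q) \<bullet> v))"
      unfolding dd_mult[OF smooth_on_power[OF open_U su] smooth_W[OF i] q] p0 dd_W[OF i q] by simp
  qed
  also have "\<dots> = - ((\<mu> q v* C ?l q) \<bullet> v)"
    by (simp only: C_eq[OF q] vm.sum_right vm.scaleR_right inner_sum_left inner_scaleR_left sum_negf)
  also have "\<dots> = - ((\<mu> q v* C ?l q v* pencil ?l q) \<bullet> (R q *v \<xi>))"
    unfolding \<xi> ip_pencil[OF q] ..
  also have "\<dots> = 0"
    using u_roots q by (simp add: C_pencil)
  finally show ?thesis .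
qed

text \<open>Coefficients at degree n are compared component by component. The product is monic, so
  fewer than n factors contribute nothing.\<close>

lemma top_vec_eqI:
  fixes x :: "nat \<Rightarrow> real^'k"
  assumes "finite D" "card D \<le> CARD('n)"
    and "\<And>c. (\<Sum>i=1..CARD('n) + 1. c ^ (i - 1) *\<^sub>R x i) = (k * (\<Prod>d\<in>D. r d + c)) *\<^sub>R e"
  shows "x (CARD('n) + 1) = (if card D = CARD('n) then k else 0) *\<^sub>R e"
proof (subst vec_eq_iff, intro allI)
  fix j
  have "(\<Sum>i=1..CARD('n) + 1. c ^ (i - 1) * x i $ j) = poly (smult (k * e $ j) (\<Prod>d\<in>D. [:r d, 1:])) c" for c
    using arg_cong[OF assms(3)[of c], of "\<lambda>x. x $ j"] by (simp add: poly_prod mult_ac)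
  then have "x (CARD('n) + 1) $ j = coeff (smult (k * e $ j) (\<Prod>d\<in>D. [:r d, 1:])) CARD('n)"
    by (rule top_coefficient)
  also have "\<dots> = ((if card D = CARD('n) then k else 0) *\<^sub>R e) $ j"
  proof (cases "card D = CARD('n)")
    case True
    then show ?thesis using coeff_prod_linear[OF assms(1), of r] by simp
  next
    case False
    then have "degree (\<Prod>d\<in>D. [:r d, 1:]) < CARD('n)"
      using assms(1,2) by (simp add: degree_prod_linear)
    then show ?thesis using False by (simp add: coeff_eq_0)
  qed
  finally show "x (CARD('n) + 1) $ j = ((if card D = CARD('n) then k else 0) *\<^sub>R e) $ j" .
qed

lemma A_sum_vec: "q \<in> U \<Longrightarrow> (\<Sum>i=1..CARD('n) + 1. c ^ (i - 1) *\<^sub>R (A i q *v x)) = C (- c) q *v x"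
  by (simp only: C_eq mv.sum_left mv.scaleR_left minus_minus)

lemma A_top_R_P2_w:
  assumes q: "q \<in> U"
  shows "A_top q *v (R q *v (P2 *v w b q)) = 0"
proof -
  have e: "(\<Sum>i=1..CARD('n) + 1. c ^ (i - 1) *\<^sub>R (A i q *v (R q *v (P2 *v w b q))))
    = (\<Delta> q * (\<Prod>d\<in>UNIV - {b}. u q $ d + c)) *\<^sub>R (R q *v w b q)" for c
    unfolding A_sum_vec[OF q] C_R[OF q] P2_w_C[OF q] by (simp add: mv.scaleR_right)
  have c: "card (UNIV - {b}) < CARD('n)" by (rule psubset_card_mono) auto
  have "A_top q *v (R q *v (P2 *v w b q))
    = (if card (UNIV - {b}) = CARD('n) then \<Delta> q else 0) *\<^sub>R (R q *v w b q)"
    by (rule top_vec_eqI[OF _ less_imp_le[OF c] e]) simp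
  then show ?thesis by (simp only: less_imp_neq[OF c] if_False scaleR_zero_left)
qed

lemma w_separates:
  assumes q: "q \<in> U" and v: "P2 *v v = v" "\<And>b. w b q \<bullet> v = 0"
  shows "v = 0"
proof -
  let ?M = "(\<chi> a b. pd (Inr b) (\<lambda>z. u z $ a) q) :: real^'n^'n"
  have l: "v $ Inl i = 0" for i using P2_mult_vec(1)[of v i] v(1) by simp
  have "(?M *v xpart v) $ b = w b q \<bullet> v" for b
    by (simp add: inner_vec_def df_def sum_sum_type l matrix_vector_mult_def xpart_def)
  then have "?M *v xpart v = 0" by (simp add: vec_eq_iff v(2))
  then have "matrix_inv ?M *v (?M *v xpart v) = 0" by simp
  then have "xpart v = 0"
    using u_indep q by (simp add: matrix_vector_mul_assoc matrix_inv_mult)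
  then show ?thesis by (intro sum_eqI) (simp_all add: l xpart_def vec_eq_iff)
qed

text \<open>The vectors \<open>R q *v (P2 *v w c q)\<close> form a basis of K on which the forms
  \<open>w b q\<close> act diagonally, and each of them is annihilated. This is why neither the
  driven momenta nor the driven positions enter the top integral.\<close>

lemma A_top_P2:
  assumes q: "q \<in> U"
  shows "A_top q *v (P2 *v v) = 0"
proof -
  let ?e = "\<lambda>c. R q *v (P2 *v w c q)"
  define v' where "v' = (\<Sum>c\<in>UNIV. (w c q \<bullet> (P2 *v v) / n c q) *\<^sub>R ?e c)"
  have "P2 *v ?e c = ?e c" for c by (simp add: P2_R_vec[OF q])
  then have v': "P2 *v v' = v'" by (simp add: v'_def mv.sum_right mv.scaleR_right)
  have "w b q \<bullet> v' = w b q \<bullet> (P2 *v v)" for b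
  proof -
    have "w b q \<bullet> ?e c = (if c = b then n b q else 0)" for c
      using w_orthogonal[OF q, of b c] by (simp add: ip_P2[OF q, symmetric])
    then have "w b q \<bullet> v' = (\<Sum>c\<in>UNIV. if c = b then w b q \<bullet> (P2 *v v) / n b q * n b q else 0)"
      unfolding v'_def inner_sum_right by (intro sum.cong) auto
    then show ?thesis using n_pos[OF q, of b] by simp
  qed
  then have "P2 *v v - v' = 0"
    by (intro w_separates[OF q]) (simp_all add: mv.diff_right v' inner_diff_right)
  then have "P2 *v v = v'" by simp
  moreover have "A_top q *v v' = 0"
    by (simp add: v'_def mv.sum_right mv.scaleR_right A_top_R_P2_w[OF q] del: One_nat_def)
  ultimately show ?thesis by (simp only:)
qed

text \<open>As \<open>P2 *v \<eta> = 0\<close>, the form \<open>\<eta> v* J q\<close> equals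
  \<open>\<eta> v* pencil l q\<close> for every \<open>l\<close>, so the cofactor matrix returns
  \<open>\<eta>\<close> times the determinant, whose coefficient at degree n is
  \<open>\<Delta> q\<close>.\<close>

lemma A_top_R_J:
  assumes q: "q \<in> U" and \<eta>: "P2 *v \<eta> = 0"
  shows "A_top q *v (R q *v (\<eta> v* J q)) = \<Delta> q *\<^sub>R (R q *v \<eta>)"
proof -
  have "(\<Sum>i=1..CARD('n) + 1. c ^ (i - 1) *\<^sub>R (A i q *v (R q *v (\<eta> v* J q))))
    = (\<Delta> q * (\<Prod>d\<in>UNIV. u q $ d + c)) *\<^sub>R (R q *v \<eta>)" for c
  proof -
    have "\<eta> v* J q = \<eta> v* pencil (- c) q"
      unfolding vm.diff_right vm.scaleR_right P2_sym \<eta> by simp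
    then have "(\<eta> v* J q) v* C (- c) q = (\<Delta> q * (\<Prod>d\<in>UNIV. u q $ d + c)) *\<^sub>R \<eta>"
      using C_pencil(2)[of \<eta> q "- c"] det_pencil[OF q, of "- c"] by simp
    then show ?thesis
      unfolding A_sum_vec[OF q] C_R[OF q] by (simp only: mv.scaleR_right)
  qed
  from top_vec_eqI[OF _ _ this] show ?thesis by (simp del: One_nat_def)
qed

text \<open>The canonical substitution on the whole space: \<open>\<eta>\<close> carries the momenta
  with tilde of the driving system, and \<open>J\<close> distributes them over both blocks.\<close>

definition "momentum q \<eta> s = \<eta> v* J q + (\<Sum>b\<in>UNIV. s $ b *\<^sub>R (P2 *v w b q))"

lemma momentum_eq:
  assumes q: "q \<in> U"
  shows "join (\<eta> v* J1 (ypart q)) (driven_momentum J u \<eta> q s) = momentum q (join \<eta> 0) s"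
proof (rule sum_eqI)
  fix i
  show "join (\<eta> v* J1 (ypart q)) (driven_momentum J u \<eta> q s) $ Inl i = momentum q (join \<eta> 0) s $ Inl i"
    using J1 q by (simp add: join_def momentum_def vector_matrix_mult_def sum_sum_type P2_mult_vec)
next
  fix a
  show "join (\<eta> v* J1 (ypart q)) (driven_momentum J u \<eta> q s) $ Inr a = momentum q (join \<eta> 0) s $ Inr a"
    by (simp add: join_def momentum_def driven_momentum_def vector_matrix_mult_def sum_sum_type P2_mult_vec df_def mult.commute)
qed

lemma P2_join: "P2 *v join \<eta> 0 = 0"
  by (intro sum_eqI) (simp_all add: P2_mult_vec join_def)

text \<open>At a root the cofactor matrix annihilates \<open>\<eta> v* J q\<close>, which lies in
  the image of the pencil, and every \<open>P2 *v w c q\<close> with \<open>c \<noteq> b\<close>.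
  Hence \<open>s $ b\<close> is the only momentum that survives.\<close>

lemma sum_integrals_root:
  assumes q: "q \<in> U" and \<eta>: "P2 *v \<eta> = 0"
  shows "(\<Sum>i=1..CARD('n) + 1. (- u q $ b) ^ (i - 1) * quadratic_integral g (A i) (W i) q (momentum q \<eta> s))
    = (1/2) * (s $ b)\<^sup>2 * \<Phi> b q + \<phi> b q"
proof -
  let ?p = "momentum q \<eta> s" and ?l = "u q $ b"
  have "\<eta> v* J q = \<eta> v* pencil ?l q"
    unfolding vm.diff_right vm.scaleR_right P2_sym \<eta> by simp
  then have \<eta>C: "\<eta> v* J q v* C ?l q = 0"
    using C_pencil(2)[of \<eta> q ?l] u_roots q by simp
  have wC: "(P2 *v w c q) v* C ?l q = (if c = b then \<tau> b q else 0) *\<^sub>R w c q" for c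
  proof (cases "c = b")
    case False
    then have "(\<Prod>d\<in>UNIV - {c}. u q $ d - ?l) = 0" by (intro prod_zero) auto
    then show ?thesis using False by (simp add: P2_w_C[OF q])
  qed (simp add: P2_w_C[OF q] \<tau>_def)
  have pC: "?p v* C ?l q = (s $ b * \<tau> b q) *\<^sub>R w b q"
    unfolding momentum_def vm.add_left \<eta>C vm.sum_left vm.scaleR_left wC
    by (subst sum.remove[of _ b]) (auto intro!: sum.neutral)
  have "ip q (w b q) (\<eta> v* J q) = 0"
    by (simp add: ip_J[OF q, symmetric] w_eigenform[OF q] ip_P2[OF q] \<eta>)
  then have wp: "ip q (w b q) ?p = (\<Sum>c\<in>UNIV. s $ c * ip q (P2 *v w b q) (w c q))"
    by (simp add: momentum_def mv.add_right mv.sum_right mv.scaleR_right inner_add_right inner_sum_right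
        ip_P2[OF q])
  also have "\<dots> = (\<Sum>c\<in>UNIV. if c = b then s $ b * n b q else 0)"
    by (rule sum.cong) (auto simp: w_orthogonal[OF q])
  finally have wp: "ip q (w b q) ?p = s $ b * n b q" by simp
  have "(\<Sum>i=1..CARD('n) + 1. (- ?l) ^ (i - 1) * quadratic_integral g (A i) (W i) q ?p)
     = (1/2) * (\<Sum>i=1..CARD('n) + 1. (- ?l) ^ (i - 1) * (?p \<bullet> (A i q *v (R q *v ?p)))) + \<phi> b q"
    by (simp only: quadratic_integral_def \<phi>_def matrix_vector_mul_assoc sum_distrib_left sum.distrib[symmetric] distrib_left mult_ac)
  also have "(\<Sum>i=1..CARD('n) + 1. (- ?l) ^ (i - 1) * (?p \<bullet> (A i q *v (R q *v ?p)))) = ?p \<bullet> (C ?l q *v (R q *v ?p))"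
    by (simp only: C_eq[OF q] mv.sum_left mv.scaleR_left inner_sum_right inner_scaleR_right)
  also have "\<dots> = ip q (?p v* C ?l q) ?p" by (simp only: dot_lmul_matrix)
  also have "\<dots> = (s $ b)\<^sup>2 * \<Phi> b q"
    by (simp add: pC wp \<Phi>_def power2_eq_square)
  finally show ?thesis by simp
qed

lemma integral_top:
  assumes q: "q \<in> U" and \<eta>: "P2 *v \<eta> = 0"
  shows "quadratic_integral g A_top W_top q (momentum q \<eta> s)
    = (1/2) * \<Delta> q * ip q \<eta> (\<eta> v* J q) + W_top q"
proof -
  let ?p = "momentum q \<eta> s"
  have "A_top q *v (R q *v ?p) = \<Delta> q *\<^sub>R (R q *v \<eta>)"
    by (simp add: momentum_def mv.add_right mv.sum_right mv.scaleR_right A_top_R_P2_w[OF q] A_top_R_J[OF q \<eta>] del: One_nat_def)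
  moreover have "ip q ?p \<eta> = ip q \<eta> (\<eta> v* J q)"
    by (simp add: momentum_def inner_add_left inner_sum_left ip_P2[OF q] \<eta>) (rule ip_commute[OF q])
  ultimately show ?thesis
    by (simp add: quadratic_integral_def matrix_vector_mul_assoc[symmetric] del: One_nat_def)
qed

end

section \<open>Conservation of the energy of the driving system\<close>

lemma join_nth: "join y x $ Inl i = y $ i" "join y x $ Inr a = x $ a"
  by (simp_all add: join_def)

lemma join_add: "join y x = join y 0 + join 0 x"
  by (intro sum_eqI) (simp_all add: join_def)

lemma join_split: "join 0 x = P2 *v join y x" "join 0 x = P2 *v join 0 x"
  by (intro sum_eqI; simp add: P2_mult_vec join_def)+

lemma ypart_join [simp]: "ypart (join y x) = y" and xpart_join [simp]: "xpart (join y x) = x"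
  by (simp_all add: ypart_def xpart_def join_def vec_eq_iff)

lemma join_parts [simp]: "join (ypart q) (xpart q) = q"
  by (intro sum_eqI) (simp_all add: ypart_def xpart_def join_def)

lemma bounded_linear_join:
  "bounded_linear (\<lambda>y. join y 0)" "bounded_linear (join 0)"
  by (auto simp: linear_conv_bounded_linear[symmetric] join_def intro!: linearI sum_eqI)

lemma continuous_on_join:
  assumes "continuous_on X f" "continuous_on X h"
  shows "continuous_on X (\<lambda>z. join (f z) (h z))"
proof -
  have "continuous_on X (\<lambda>z. join (f z) 0 + join 0 (h z))"
    by (intro continuous_on_add bounded_linear.continuous_on[OF bounded_linear_join(1)]
        bounded_linear.continuous_on[OF bounded_linear_join(2)] assms)
  then show ?thesis by (simp add: join_add[symmetric])
qed

lemma has_vector_derivative_vecI: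
  fixes f :: "real \<Rightarrow> real^'k"
  assumes "\<And>i. ((\<lambda>\<tau>. f \<tau> $ i) has_vector_derivative d $ i) (at t)"
  shows "(f has_vector_derivative d) (at t)"
proof -
  have rep: "(\<Sum>i\<in>UNIV. z $ i *\<^sub>R axis i 1) = z" for z :: "real^'k"
    by (simp add: vec_eq_iff axis_def if_distrib[of "(*) _"] cong: if_cong)
  have "((\<lambda>\<tau>. \<Sum>i\<in>UNIV. f \<tau> $ i *\<^sub>R (axis i 1 :: real^'k)) has_vector_derivative (\<Sum>i\<in>UNIV. d $ i *\<^sub>R axis i 1)) (at t)"
    by (intro has_vector_derivative_sum bounded_linear.has_vector_derivative[OF bounded_linear_scaleR_left] assms)
  then show ?thesis by (simp only: rep)
qed

lemma pd_kinetic_velocity: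
  assumes "transpose (G z) = G z"
  shows "pd i (\<lambda>v. kinetic G z v) v = (G z *v v) $ i"
proof -
  have "((\<lambda>v. kinetic G z v) has_derivative (\<lambda>e. (1/2) * (v \<bullet> (G z *v e) + e \<bullet> (G z *v v)))) (at v)"
    unfolding kinetic_def
    by (intro has_derivative_mult_right bounded_bilinear.FDERIV[OF bounded_bilinear_inner]
        has_derivative_ident bounded_linear_imp_has_derivative matrix_vector_mul_bounded_linear)
  from fun_cong[OF frechet_derivative_at[OF this, symmetric], of "axis i 1"]
  have "pd i (\<lambda>v. kinetic G z v) v = (1/2) * (v \<bullet> (G z *v axis i 1) + axis i 1 \<bullet> (G z *v v))"
    by (simp add: pd_def)
  also have "v \<bullet> (G z *v axis i 1) = (G z *v v) \<bullet> axis i 1"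
    by (metis assms dot_lmul_matrix transpose_matrix_vector)
  finally show ?thesis by (simp add: inner_axis inner_commute[of "axis i 1"])
qed

locale driven_motion = driven_integrals U g J \<mu> V g1 J1 g2 Q1 u A W
  for U :: "(real^('m::finite + 'n::finite)) set" and g J \<mu> V g1 J1 g2 Q1 u A W +
  fixes T :: "real set"
    and y p pt :: "real \<Rightarrow> real^'m"
  assumes open_T: "open T"
    and driving: "lagrange_solution T (ypart ` U) g1 Q1 y p"
    and pt: "\<forall>t\<in>T. p t = pt t v* J1 (y t)"
begin

definition "\<eta> t = (join (pt t) 0 :: real^('m + 'n))"

text \<open>By \<open>integral_top\<close> the value of the top integral along the driving motion,
  free of \<open>s\<close>. That \<open>x\<close> does not matter locally is shown only by
  \<open>energy_space_derivative\<close>.\<close>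

definition "energy t x = (1/2) * \<Delta> (join (y t) x) * ip (join (y t) x) (\<eta> t) (\<eta> t v* J (join (y t) x))
  + W_top (join (y t) x)"

lemma P2_\<eta>: "P2 *v \<eta> t = 0"
  by (simp add: \<eta>_def P2_join)

lemma y_continuous: "continuous_on T y"
  using driving unfolding lagrange_solution_def
  by (meson continuous_at_imp_continuous_on has_vector_derivative_continuous)

lemma continuous_join: "continuous_on (T \<times> UNIV) (\<lambda>z. join (y (fst z)) (snd z))"
  by (intro continuous_on_join continuous_on_compose2[OF y_continuous] continuous_intros) auto

lemma open_join:
  fixes S :: "(real^('m + 'n)) set"
  assumes "open S"
  shows "open {(t, x). t \<in> T \<and> join (y t) x \<in> S}"
proof -
  have "open ((\<lambda>z. join (y (fst z)) (snd z)) -` S \<inter> (T \<times> UNIV))"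
    using continuous_on_open_vimage[OF open_Times[OF open_T open_UNIV]] continuous_join assms by blast
  also have "(\<lambda>z. join (y (fst z)) (snd z)) -` S \<inter> (T \<times> UNIV) = {(t, x). t \<in> T \<and> join (y t) x \<in> S}"
    by auto
  finally show ?thesis .
qed

lemma \<eta>_J:
  assumes "t \<in> T" "join (y t) x \<in> U"
  shows "\<eta> t v* J (join (y t) x) = join (p t) 0 + P2 *v (\<eta> t v* J (join (y t) x))"
proof (rule sum_eqI)
  fix i
  show "(\<eta> t v* J (join (y t) x)) $ Inl i = (join (p t) 0 + P2 *v (\<eta> t v* J (join (y t) x))) $ Inl i"
    using J1[rule_format, OF assms(2)] pt assms(1)
    by (simp add: P2_mult_vec join_def[of "p t"] vector_matrix_mult_def sum_sum_type)
       (simp add: \<eta>_def join_def vector_matrix_mult_def)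
qed (simp add: P2_mult_vec join_def)

lemma ip_\<eta>_J:
  assumes "t \<in> T" "join (y t) x \<in> U"
  shows "ip (join (y t) x) a (\<eta> t v* J (join (y t) x)) = ip (join (y t) x) a (join (p t) 0)
    + ip (join (y t) x) (P2 *v a) (\<eta> t v* J (join (y t) x))"
  by (subst \<eta>_J[OF assms]) (simp only: mv.add_right inner_add_right ip_P2[OF assms(2)])

lemma energy_alt:
  assumes "t \<in> T" "join (y t) x \<in> U"
  shows "energy t x = (1/2) * \<Delta> (join (y t) x) * ip (join (y t) x) (\<eta> t) (join (p t) 0) + W_top (join (y t) x)"
  unfolding energy_def by (subst ip_\<eta>_J[OF assms]) (simp add: P2_\<eta> del: One_nat_def)

lemma g1_sym: "q \<in> U \<Longrightarrow> transpose (g1 (ypart q)) = g1 (ypart q)"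
  using g_sym[of q] g_block(1)[of q] by (simp add: vec_eq_iff transpose_def) metis

text \<open>Lagrange's equations of the driving system are lifted to the whole space at an arbitrary
  \<open>x\<close>, so that the connection and the tensors of the full system apply. The second
  block of the force side is zero because the metric of the driving system does not depend on
  \<open>x\<close>.\<close>

lemma driving_momentum:
  obtains v where
    "\<And>t. t \<in> T \<Longrightarrow> (y has_vector_derivative v t) (at t)"
    "\<And>t x. t \<in> T \<Longrightarrow> join (y t) x \<in> U \<Longrightarrow> g (join (y t) x) *v join (v t) 0 = join (p t) 0"
    "\<And>t x. t \<in> T \<Longrightarrow> join (y t) x \<in> U \<Longrightarrow> ((\<lambda>\<tau>. join (p \<tau>) 0) has_vector_derivative
      (join (p t) 0 v* \<Gamma> (join (y t) x) (join (v t) 0) + P1 *v \<mu> (join (y t) x))) (at t)"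
proof -
  obtain v where yU: "\<And>t. t \<in> T \<Longrightarrow> y t \<in> ypart ` U"
    and y': "\<And>t. t \<in> T \<Longrightarrow> (y has_vector_derivative v t) (at t)"
    and pv: "\<And>t. t \<in> T \<Longrightarrow> p t = g1 (y t) *v v t"
    and L: "\<And>t i. t \<in> T \<Longrightarrow> ((\<lambda>\<tau>. pd i (\<lambda>w. kinetic g1 (y \<tau>) w) (v \<tau>)) has_real_derivative
            pd i (\<lambda>z. kinetic g1 z (v t)) (y t) + Q1 (y t) $ i) (at t)"
    using driving unfolding lagrange_solution_def by blast
  have gv: "g (join (y t) x) *v join (v t) 0 = join (p t) 0" if "t \<in> T" "join (y t) x \<in> U" for t x
    using g_block[OF that(2)] pv[OF that(1)]
    by (intro sum_eqI) (simp_all add: matrix_vector_mult_def sum_sum_type, simp_all add: join_def)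
  have "((\<lambda>\<tau>. join (p \<tau>) 0) has_vector_derivative
      (join (p t) 0 v* \<Gamma> (join (y t) x) (join (v t) 0) + P1 *v \<mu> (join (y t) x))) (at t)"
    if t: "t \<in> T" and q: "join (y t) x \<in> U" for t x
  proof -
    let ?q = "join (y t) x" and ?V = "join (v t) 0 :: real^('m + 'n)"
    let ?d = "join (p t) 0 v* \<Gamma> ?q ?V + P1 *v \<mu> ?q"
    have d: "(join (p t) 0 v* \<Gamma> ?q ?V) $ k = (1/2) * (?V \<bullet> (dd g ?q (axis k 1) *v ?V))" for k
      unfolding gv[OF t q, symmetric] by (rule geodesic_term[OF q])
    have kin: "?V \<bullet> (g (join z x) *v ?V) = v t \<bullet> (g1 z *v v t)" if "join z x \<in> U" for z x
      using g_block[OF that] by (simp add: inner_vec_def matrix_vector_mult_def sum_sum_type)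
        (simp add: join_def)
    have j: "(\<lambda>z. join z x) = (\<lambda>z. join z 0 + join 0 x)"
      by (rule ext) (rule join_add)
    have der_join: "((\<lambda>z. join z x) has_derivative (\<lambda>e. join e 0)) (at z)" for z :: "real^'m"
      using has_derivative_add[OF bounded_linear_imp_has_derivative[OF bounded_linear_join(1)] has_derivative_const[of "join 0 x"], of "at z"]
      by (subst j) simp
    have open_x: "open {z. join z x \<in> U}"
      using open_vimage[OF open_U, of "\<lambda>z. join z x"]
      by (simp add: vimage_def continuous_on_join continuous_on_id continuous_on_const)
    have p': "((\<lambda>\<tau>. p \<tau> $ i) has_vector_derivative ?d $ Inl i) (at t)" for i
    proof -
      have "((\<lambda>z. g (join z x)) has_derivative (\<lambda>e. dd g ?q (join e 0))) (at (y t))"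
        by (rule has_derivative_compose[OF der_join smooth_on_has_derivative[OF smooth_g q]])
      then have "((\<lambda>z. (1/2) * (?V \<bullet> (g (join z x) *v ?V))) has_derivative
          (\<lambda>e. (1/2) * (?V \<bullet> (dd g ?q (join e 0) *v ?V)))) (at (y t))"
        by (intro has_derivative_mult_right bounded_linear.has_derivative[OF bounded_linear_inner_right]
            bounded_linear.has_derivative[OF mv.bounded_linear_left])
      then have "((\<lambda>z. kinetic g1 z (v t)) has_derivative
          (\<lambda>e. (1/2) * (?V \<bullet> (dd g ?q (join e 0) *v ?V)))) (at (y t))"
        by (rule has_derivative_transform_within_open[OF _ open_x]) (use q kin in \<open>auto simp: kinetic_def\<close>)
      from fun_cong[OF frechet_derivative_at[OF this, symmetric], of "axis i 1"]
      have "pd i (\<lambda>z. kinetic g1 z (v t)) (y t) = (1/2) * (?V \<bullet> (dd g ?q (join (axis i 1) 0) *v ?V))"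
        by (simp add: pd_def)
      moreover have "join (axis i 1) 0 = (axis (Inl i) 1 :: real^('m + 'n))"
        by (intro sum_eqI) (simp_all add: join_def axis_def)
      moreover have "(P1 *v \<mu> ?q) $ Inl i = Q1 (y t) $ i"
        using driven q by (simp add: P1_def mv.diff_left P2_mult_vec driven_cofactor_system_def)
      ultimately have "pd i (\<lambda>z. kinetic g1 z (v t)) (y t) + Q1 (y t) $ i = ?d $ Inl i"
        by (simp add: d)
      then have "((\<lambda>\<tau>. pd i (\<lambda>w. kinetic g1 (y \<tau>) w) (v \<tau>)) has_real_derivative ?d $ Inl i) (at t)"
        using L[OF t, of i] by (simp only:)
      then show ?thesis
        unfolding has_real_derivative_iff_has_vector_derivative
      proof (rule has_vector_derivative_transform_within_open[OF _ open_T t])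
        \<comment> \<open>The velocity gradient of the kinetic energy is the momentum only if
          \<open>g1\<close> is symmetric at \<open>y \<tau>\<close>, which is known since
          \<open>y \<tau>\<close> is in the projection of \<open>U\<close>.\<close>
        fix \<tau> assume \<tau>: "\<tau> \<in> T"
        then obtain q' where "q' \<in> U" "y \<tau> = ypart q'" using yU by blast
        then have "transpose (g1 (y \<tau>)) = g1 (y \<tau>)" by (simp add: g1_sym)
        then show "pd i (\<lambda>w. kinetic g1 (y \<tau>) w) (v \<tau>) = p \<tau> $ i"
          by (simp add: pd_kinetic_velocity pv[OF \<tau>])
      qed
    qed
    have d0: "?d $ Inr a = 0" for a
    proof -
      obtain T' where T': "open T'" "0 \<in> T'" "\<And>r. r \<in> T' \<Longrightarrow> ?q + r *\<^sub>R axis (Inr a) 1 \<in> U"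
        using line_neighbourhood[OF q] by blast
      have j: "?q + r *\<^sub>R axis (Inr a) 1 = join (y t) (x + r *\<^sub>R axis a 1)" for r
        by (intro sum_eqI) (simp_all add: join_def axis_def)
      have bl: "bounded_linear (\<lambda>M. ?V \<bullet> (M *v ?V))"
        by (rule bounded_linear_compose[OF bounded_linear_inner_right mv.bounded_linear_left])
      have "((\<lambda>r. ?V \<bullet> (g (?q + r *\<^sub>R axis (Inr a) 1) *v ?V)) has_vector_derivative 0) (at 0)"
        by (rule has_vector_derivative_transform_within_open[where f = "\<lambda>_. v t \<bullet> (g1 (y t) *v v t)",
              OF has_vector_derivative_const T'(1,2)])
           (use T'(3) kin in \<open>auto simp: j\<close>)
      then have "dd (\<lambda>z. ?V \<bullet> (g z *v ?V)) ?q (axis (Inr a) 1) = 0"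
        by (rule dd_eqI[OF smooth_on_bounded_linear[OF open_U bl smooth_g] q])
      then have "?V \<bullet> (dd g ?q (axis (Inr a) 1) *v ?V) = 0"
        by (simp add: dd_bounded_linear[OF smooth_g q bl])
      then show ?thesis
        by (simp add: d P1_def mv.diff_left P2_mult_vec)
    qed
    have "(p has_vector_derivative (\<chi> i. ?d $ Inl i)) (at t)"
      by (rule has_vector_derivative_vecI) (simp only: vec_lambda_beta p')
    from bounded_linear.has_vector_derivative[OF bounded_linear_join(1) this]
    have "((\<lambda>\<tau>. join (p \<tau>) 0) has_vector_derivative (join (\<chi> i. ?d $ Inl i) 0 :: real^('m + 'n))) (at t)" .
    moreover have "join (\<chi> i. ?d $ Inl i) 0 = ?d"
      by (intro sum_eqI) (simp_all only: join_nth vec_lambda_beta d0 zero_index)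
    ultimately show ?thesis by simp
  qed
  with y' gv that show thesis by blast
qed

text \<open>The terms in \<open>\<alpha>\<close> coming from \<open>\<Delta>\<close> and from
  \<open>killing_part\<close> cancel, so the kinetic part changes at the rate
  \<open>\<Delta>\<close> times the product of \<open>\<eta> t\<close> with the force form. The
  derivative of the top potential is the opposite, by \<open>A_top_R_J\<close>.\<close>

lemma energy_time_derivative:
  assumes t: "t \<in> T" and q: "join (y t) x \<in> U"
  shows "((\<lambda>\<tau>. energy \<tau> x) has_real_derivative 0) (at t)"
proof -
  obtain v where y': "(y has_vector_derivative v t) (at t)"
    and gv: "g (join (y t) x) *v join (v t) 0 = join (p t) 0"
    and \<kappa>': "((\<lambda>\<tau>. join (p \<tau>) 0) has_vector_derivative
      (join (p t) 0 v* \<Gamma> (join (y t) x) (join (v t) 0) + P1 *v \<mu> (join (y t) x))) (at t)"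
    using driving_momentum t q by metis
  define q\<^sub>0 where "q\<^sub>0 = join (y t) x"
  define \<kappa> where "\<kappa> = (join (p t) 0 :: real^('m + 'n))"
  define Y where "Y = (join (v t) 0 :: real^('m + 'n))"
  define G where "G = \<Gamma> q\<^sub>0 Y"
  define K where "K = (\<lambda>z. P1 ** J z ** P1 + P2)"
  define e where "e = \<eta> t"
  have qU: "q\<^sub>0 \<in> U" using q by (simp add: q\<^sub>0_def)
  have gY: "g q\<^sub>0 *v Y = \<kappa>" using gv by (simp add: q\<^sub>0_def Y_def \<kappa>_def)
  then have R\<kappa>: "R q\<^sub>0 *v \<kappa> = Y" using Rg_vec[OF qU] by metis
  have PY: "P2 *v Y = 0" "P2 *v \<kappa> = 0" "P2 *v e = 0"
    by (simp_all add: Y_def \<kappa>_def e_def P2_join P2_\<eta>)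
  have curve: "((\<lambda>\<tau>. join (y \<tau>) x) has_vector_derivative Y) (at t)"
  proof -
    have j: "(\<lambda>\<tau>. join (y \<tau>) x) = (\<lambda>\<tau>. join (y \<tau>) 0 + join 0 x)"
      by (rule ext) (rule join_add)
    show ?thesis
      using has_vector_derivative_add[OF bounded_linear.has_vector_derivative[OF bounded_linear_join(1) y']
          has_vector_derivative_const[of "join 0 x"]] by (subst j) (simp add: Y_def)
  qed
  define T' where "T' = {\<tau>. \<tau> \<in> T \<and> join (y \<tau>) x \<in> U}"
  have T': "open T'" "t \<in> T'"
    using open_vimage[OF open_join[OF open_U], of "\<lambda>\<tau>. (\<tau>, x)"] t q
    by (simp_all add: T'_def vimage_def continuous_on_Pair continuous_on_id continuous_on_const)
  note curve_dd = dd_curve[where \<gamma> = "\<lambda>\<tau>. join (y \<tau>) x" and t = t, OF _ q curve, folded q\<^sub>0_def]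
  have bl: "bounded_linear (\<lambda>M. P1 ** M ** P1 :: real^('m+'n)^('m+'n))"
    by (rule bounded_linear_compose[OF mm.bounded_linear_left mm.bounded_linear_right])
  have smooth_K: "smooth_on U K"
    unfolding K_def by (intro smooth_on_add smooth_on_matrix_mult smooth_on_const smooth_J open_U)
  have K': "((\<lambda>\<tau>. K (join (y \<tau>) x)) has_vector_derivative (P1 ** dd J q\<^sub>0 Y ** P1)) (at t)"
    unfolding K_def
    using has_vector_derivative_add[OF bounded_linear.has_vector_derivative[OF bl curve_dd[OF smooth_J]]
        has_vector_derivative_const[of P2]] by simp
  have detK: "det (K z) \<noteq> 0" if "z \<in> U" for z using \<Delta>_nz[OF that] by (simp add: K_def \<Delta>_def)
  have \<eta>K: "\<eta> \<tau> v* K (join (y \<tau>) x) = join (p \<tau>) 0" if "\<tau> \<in> T'" for \<tau>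
  proof -
    have \<tau>: "\<tau> \<in> T" "join (y \<tau>) x \<in> U" using that by (auto simp: T'_def)
    have "\<eta> \<tau> v* K (join (y \<tau>) x) = ((\<eta> \<tau> v* P1) v* J (join (y \<tau>) x)) v* P1 + P2 *v \<eta> \<tau>"
      by (simp add: K_def vm.add_right vector_matrix_mul_assoc P2_sym)
    also have "\<eta> \<tau> v* P1 = \<eta> \<tau>" by (simp add: P1_def vm.diff_right P2_sym P2_\<eta>)
    also have "(\<eta> \<tau> v* J (join (y \<tau>) x)) v* P1 = join (p \<tau>) 0"
      by (subst \<eta>_J[OF \<tau>]) (simp add: P1_def vm.diff_right P2_sym mv.add_right P2_join)
    finally show ?thesis by (simp add: P2_\<eta>)
  qed
  \<comment> \<open>Differentiability of \<open>pt\<close> is not given; it is recovered from that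
    of \<open>p\<close> by inverting the smooth matrix \<open>K\<close>.\<close>
  have "\<exists>e'. (\<eta> has_vector_derivative e') (at t)"
  proof
    show "(\<eta> has_vector_derivative (join (p t) 0 v* dd (\<lambda>z. matrix_inv (K z)) q\<^sub>0 Y
      + (join (p t) 0 v* \<Gamma> (join (y t) x) (join (v t) 0) + P1 *v \<mu> (join (y t) x)) v* matrix_inv (K q\<^sub>0))) (at t)"
    proof (rule has_vector_derivative_transform_within_open[OF _ T'])
      show "((\<lambda>\<tau>. join (p \<tau>) 0 v* matrix_inv (K (join (y \<tau>) x))) has_vector_derivative
         (join (p t) 0 v* dd (\<lambda>z. matrix_inv (K z)) q\<^sub>0 Y
      + (join (p t) 0 v* \<Gamma> (join (y t) x) (join (v t) 0) + P1 *v \<mu> (join (y t) x)) v* matrix_inv (K q\<^sub>0))) (at t)"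
        using vm.has_vector_derivative[OF \<kappa>' curve_dd[OF smooth_on_matrix_inv[OF open_U smooth_K detK]]]
        by (simp add: q\<^sub>0_def)
      fix \<tau> assume \<tau>: "\<tau> \<in> T'"
      then have "det (K (join (y \<tau>) x)) \<noteq> 0" by (intro detK) (auto simp: T'_def)
      then show "join (p \<tau>) 0 v* matrix_inv (K (join (y \<tau>) x)) = \<eta> \<tau>"
        unfolding \<eta>K[OF \<tau>, symmetric] vector_matrix_mul_assoc by (simp add: matrix_inv_mult)
    qed
  qed
  then obtain e' where e': "(\<eta> has_vector_derivative e') (at t)" by blast
  define \<kappa>d where "\<kappa>d = \<kappa> v* G + P1 *v \<mu> q\<^sub>0"
  have \<kappa>d: "((\<lambda>\<tau>. join (p \<tau>) 0) has_vector_derivative \<kappa>d) (at t)"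
    using \<kappa>' by (simp add: \<kappa>d_def \<kappa>_def q\<^sub>0_def Y_def G_def)
  have d1: "((\<lambda>\<tau>. \<eta> \<tau> v* K (join (y \<tau>) x)) has_vector_derivative \<kappa>d) (at t)"
    by (rule has_vector_derivative_transform_within_open[OF \<kappa>d T']) (simp add: \<eta>K)
  \<comment> \<open>Differentiating the product with \<open>K\<close> determines \<open>e'\<close>
    implicitly, so the derivative of the inverse of \<open>K\<close> need not be computed.\<close>
  have e'K: "e' v* K q\<^sub>0 = \<kappa>d - e v* (P1 ** dd J q\<^sub>0 Y ** P1)"
    using vector_derivative_unique_at[OF d1 vm.has_vector_derivative[OF e' K']]
    by (simp add: q\<^sub>0_def e_def)
  have eJ: "e v* J q\<^sub>0 = \<kappa> + P2 *v (e v* J q\<^sub>0)"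
    unfolding q\<^sub>0_def e_def \<kappa>_def by (rule \<eta>_J[OF t q])
  have eK: "e v* K q\<^sub>0 = \<kappa>" using \<eta>K[OF T'(2)] by (simp add: e_def q\<^sub>0_def \<kappa>_def)
  let ?ip = "ip q\<^sub>0" and ?S = "killing_part q\<^sub>0 (\<alpha> q\<^sub>0) Y"
  have P2G: "P2 *v (z v* G) = (P2 *v z) v* G" for z
    unfolding G_def P2_sym[symmetric] vector_matrix_mul_assoc conn_mixed[OF qU] ..
  have R'\<kappa>: "e \<bullet> (dd R q\<^sub>0 Y *v \<kappa>) = - ?ip (e v* G) \<kappa> - ?ip e (\<kappa> v* G)"
    by (simp add: dd_R[OF qU] G_def mv.diff_left mv.minus_left matrix_vector_mul_assoc[symmetric]
        inner_diff_right dot_lmul_matrix)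
  have e'R\<kappa>: "?ip e' \<kappa> = ?ip \<kappa>d e - (e v* (P1 ** dd J q\<^sub>0 Y ** P1)) \<bullet> (R q\<^sub>0 *v e)"
  proof -
    have KR: "?ip a (b v* K q\<^sub>0) = ?ip (a v* K q\<^sub>0) b" for a b
    proof -
      have P1ip: "?ip a (P1 *v b) = ?ip (P1 *v a) b" for a b
        by (simp add: P1_def mv.diff_left mv.diff_right inner_diff_left inner_diff_right ip_P2[OF qU])
      have P1s: "x v* P1 = P1 *v x" for x by (simp add: P1_def vm.diff_right mv.diff_left P2_sym)
      show ?thesis
        by (simp add: K_def vm.add_right mv.add_right inner_add_left inner_add_right P2_sym ip_P2[OF qU]
            vector_matrix_mul_assoc[symmetric] P1s P1ip[symmetric] ip_J[OF qU])
    qed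
    show ?thesis
      unfolding eK[symmetric] KR e'K by (simp add: inner_diff_left)
  qed
  have dJ: "(e v* (P1 ** dd J q\<^sub>0 Y ** P1)) \<bullet> (R q\<^sub>0 *v e)
    = ?ip (\<kappa> v* G) e - ?ip (e v* G) \<kappa> + (e v* ?S) \<bullet> (R q\<^sub>0 *v e)"
  proof -
    have eP1: "e v* P1 = e" by (simp add: P1_def vm.diff_right P2_sym PY)
    have P1R: "P1 *v (R q\<^sub>0 *v e) = R q\<^sub>0 *v e"
      by (simp add: P1_def mv.diff_left P2_R_vec[OF qU] PY)
    have "(e v* (P1 ** dd J q\<^sub>0 Y ** P1)) \<bullet> (R q\<^sub>0 *v e) = ((e v* dd J q\<^sub>0 Y) v* P1) \<bullet> (R q\<^sub>0 *v e)"
      by (simp only: vector_matrix_mul_assoc[symmetric] eP1)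
    also have "\<dots> = (e v* dd J q\<^sub>0 Y) \<bullet> (R q\<^sub>0 *v e)"
      by (simp only: dot_lmul_matrix[of _ P1] P1R)
    also have "e v* dd J q\<^sub>0 Y = (e v* J q\<^sub>0) v* G - (e v* G) v* J q\<^sub>0 + e v* ?S"
      by (simp add: dd_J[OF qU] vm.add_right vm.diff_right vector_matrix_mul_assoc G_def)
    also have "((e v* J q\<^sub>0) v* G - (e v* G) v* J q\<^sub>0 + e v* ?S) \<bullet> (R q\<^sub>0 *v e)
      = ?ip ((e v* J q\<^sub>0) v* G) e - ?ip (e v* G) (e v* J q\<^sub>0) + (e v* ?S) \<bullet> (R q\<^sub>0 *v e)"
      by (simp only: inner_add_left inner_diff_left ip_J[OF qU])
    also have "?ip ((e v* J q\<^sub>0) v* G) e = ?ip (\<kappa> v* G) e"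
      by (subst eJ) (simp add: vm.add_left inner_add_left P2G[symmetric] ip_P2[OF qU] PY)
    also have "?ip (e v* G) (e v* J q\<^sub>0) = ?ip (e v* G) \<kappa>"
      by (subst eJ) (simp add: mv.add_right inner_add_right ip_P2[OF qU, symmetric] P2G PY vm.zero_left)
    finally show ?thesis .
  qed
  have S: "(e v* ?S) \<bullet> (R q\<^sub>0 *v e) = ?ip e (\<alpha> q\<^sub>0) * ?ip e \<kappa>"
    unfolding vec_killing_part[OF qU] gY
    using ip_commute[OF qU, of \<kappa> e] ip_commute[OF qU, of "\<alpha> q\<^sub>0" e]
    by (simp add: inner_add_left R\<kappa>)
  have \<mu>1: "?ip e (P1 *v \<mu> q\<^sub>0) = ?ip e (\<mu> q\<^sub>0)"
    by (simp add: P1_def mv.diff_left mv.diff_right inner_diff_right ip_P2[OF qU, symmetric] PY)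
  have F': "((\<lambda>\<tau>. \<eta> \<tau> \<bullet> (R (join (y \<tau>) x) *v join (p \<tau>) 0)) has_vector_derivative
      (2 * ?ip e (\<mu> q\<^sub>0) - ?ip e (\<alpha> q\<^sub>0) * ?ip e \<kappa>)) (at t)"
  proof -
    have "((\<lambda>\<tau>. \<eta> \<tau> \<bullet> (R (join (y \<tau>) x) *v join (p \<tau>) 0)) has_vector_derivative
      (e \<bullet> (R q\<^sub>0 *v \<kappa>d + dd R q\<^sub>0 Y *v \<kappa>) + ?ip e' \<kappa>)) (at t)"
      using bounded_bilinear.has_vector_derivative[OF bounded_bilinear_inner e'
          mv.has_vector_derivative[OF curve_dd[OF smooth_R] \<kappa>d]]
      by (simp add: e_def q\<^sub>0_def \<kappa>_def)
    moreover have "e \<bullet> (R q\<^sub>0 *v \<kappa>d + dd R q\<^sub>0 Y *v \<kappa>) + ?ip e' \<kappa>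
      = 2 * ?ip e (\<mu> q\<^sub>0) - ?ip e (\<alpha> q\<^sub>0) * ?ip e \<kappa>"
      unfolding e'R\<kappa> dJ S inner_add_right R'\<kappa> ip_commute[OF qU, of \<kappa>d e] ip_commute[OF qU, of "\<kappa> v* G" e]
      by (simp add: \<kappa>d_def mv.add_right inner_add_right \<mu>1)
    ultimately show ?thesis by simp
  qed
  have \<Delta>': "dd \<Delta> q\<^sub>0 Y = \<Delta> q\<^sub>0 * ?ip e (\<alpha> q\<^sub>0)"
  proof -
    have "dd \<Delta> q\<^sub>0 Y = ?ip (df \<Delta> q\<^sub>0) \<kappa>"
      by (simp add: dd_eq_df[OF smooth_\<Delta> qU] R\<kappa>)
    also have "\<dots> = ?ip (df \<Delta> q\<^sub>0) (e v* J q\<^sub>0)"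
      by (subst eJ) (simp add: mv.add_right inner_add_right ip_P2[OF qU, symmetric] P2_d\<Delta>[OF qU])
    also have "\<dots> = \<Delta> q\<^sub>0 * ?ip (\<alpha> q\<^sub>0) e"
      unfolding ip_J[OF qU, symmetric] d\<Delta>_J[OF qU]
      by (simp add: inner_diff_left inner_sum_left ip_P2[OF qU] PY)
    finally show ?thesis by (simp add: ip_commute[OF qU, of e])
  qed
  have W': "dd (\<lambda>z. W_top z) q\<^sub>0 Y = - (\<Delta> q\<^sub>0 * ?ip e (\<mu> q\<^sub>0))"
  proof -
    \<comment> \<open>The velocity differs from \<open>R q\<^sub>0 *v (e v* J q\<^sub>0)\<close> by
      an element of K, which the top tensor annihilates.\<close>
    have "Y = R q\<^sub>0 *v (e v* J q\<^sub>0) - P2 *v (R q\<^sub>0 *v (e v* J q\<^sub>0))"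
      unfolding R\<kappa>[symmetric] P2_R_vec[OF qU] by (subst (2) eJ) (subst (1) eJ, simp add: mv.add_right PY)
    then have "A_top q\<^sub>0 *v Y = \<Delta> q\<^sub>0 *\<^sub>R (R q\<^sub>0 *v e)"
      by (simp add: mv.diff_right A_top_P2[OF qU] A_top_R_J[OF qU PY(3)] del: One_nat_def)
    then have "dd (\<lambda>z. W_top z) q\<^sub>0 Y = - (\<mu> q\<^sub>0 \<bullet> (\<Delta> q\<^sub>0 *\<^sub>R (R q\<^sub>0 *v e)))"
      using dd_W[OF _ qU, of "CARD('n) + 1" Y] by (simp add: dot_lmul_matrix del: One_nat_def)
    then show ?thesis by (simp add: ip_commute[OF qU, of e])
  qed
  have sW: "smooth_on U (\<lambda>z. W_top z)" by (rule smooth_W) simp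
  have "((\<lambda>\<tau>. (1/2) * (\<Delta> (join (y \<tau>) x) * (\<eta> \<tau> \<bullet> (R (join (y \<tau>) x) *v join (p \<tau>) 0))) + W_top (join (y \<tau>) x))
    has_real_derivative ((1/2) * (dd \<Delta> q\<^sub>0 Y * ?ip e \<kappa> + (2 * ?ip e (\<mu> q\<^sub>0) - ?ip e (\<alpha> q\<^sub>0) * ?ip e \<kappa>) * \<Delta> q\<^sub>0)
      + dd (\<lambda>z. W_top z) q\<^sub>0 Y)) (at t)"
    using DERIV_add[OF DERIV_cmult[OF DERIV_mult[OF
          curve_dd[OF smooth_\<Delta>, folded has_real_derivative_iff_has_vector_derivative]
          F'[folded has_real_derivative_iff_has_vector_derivative]], of "1/2"]
        curve_dd[OF sW, folded has_real_derivative_iff_has_vector_derivative]]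
    by (simp add: e_def \<kappa>_def q\<^sub>0_def)
  moreover have "(1/2) * (dd \<Delta> q\<^sub>0 Y * ?ip e \<kappa> + (2 * ?ip e (\<mu> q\<^sub>0) - ?ip e (\<alpha> q\<^sub>0) * ?ip e \<kappa>) * \<Delta> q\<^sub>0)
      + dd (\<lambda>z. W_top z) q\<^sub>0 Y = 0"
    unfolding \<Delta>' W' by (simp add: algebra_simps)
  ultimately have "((\<lambda>\<tau>. (1/2) * (\<Delta> (join (y \<tau>) x) * (\<eta> \<tau> \<bullet> (R (join (y \<tau>) x) *v join (p \<tau>) 0)))
      + W_top (join (y \<tau>) x)) has_real_derivative 0) (at t)" by simp
  then show ?thesis
    by (rule has_field_derivative_transform_within_open[OF _ T'])
       (use energy_alt in \<open>auto simp: T'_def\<close>)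
qed

text \<open>At a fixed time \<open>\<Delta>\<close> and the velocity obtained from
  \<open>p t\<close> are independent of \<open>x\<close>, and the differential of the top potential
  vanishes on K by \<open>A_top_P2\<close>.\<close>

lemma energy_space_derivative:
  assumes t: "t \<in> T" and q: "join (y t) x \<in> U"
  shows "((\<lambda>x. energy t x) has_derivative (\<lambda>_. 0)) (at x)"
proof -
  obtain v where gv: "\<And>x. join (y t) x \<in> U \<Longrightarrow> g (join (y t) x) *v join (v t) 0 = join (p t) 0"
    using driving_momentum t by metis
  have open_X: "open {x. join (y t) x \<in> U}"
    using open_vimage[OF open_U, of "\<lambda>x. join (y t) x"]
    by (simp add: vimage_def continuous_on_join continuous_on_id continuous_on_const)
  have j: "(\<lambda>x. join (y t) x) = (\<lambda>x. join (y t) 0 + join 0 x)"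
    by (rule ext) (rule join_add)
  have "((\<lambda>x. join (y t) x) has_derivative (\<lambda>e. join 0 e)) (at x)"
    using has_derivative_add[OF has_derivative_const[of "join (y t) 0"] bounded_linear_imp_has_derivative[OF bounded_linear_join(2)], of "at x"]
    by (subst j) simp
  from has_derivative_compose[OF this smooth_on_has_derivative[OF smooth_W[of "CARD('n) + 1"] q]]
  have "((\<lambda>x. W_top (join (y t) x)) has_derivative (\<lambda>e. dd (\<lambda>z. W_top z) (join (y t) x) (join 0 e))) (at x)"
    by (simp del: One_nat_def)
  moreover have "dd (\<lambda>z. W_top z) (join (y t) x) (join 0 e) = 0" for e
  proof -
    have "A_top (join (y t) x) *v join 0 e = 0"
      by (subst join_split(2)) (rule A_top_P2[OF q])
    then show ?thesis
      using dd_W[OF _ q, of "CARD('n) + 1" "join 0 e"] by (simp add: dot_lmul_matrix del: One_nat_def)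
  qed
  ultimately have "((\<lambda>x'. (1/2) * \<Delta> (join (y t) x) * (\<eta> t \<bullet> join (v t) 0) + W_top (join (y t) x')) has_derivative (\<lambda>_. 0)) (at x)"
    using has_derivative_add[OF has_derivative_const] by fastforce
  then show ?thesis
  proof (rule has_derivative_transform_within_open[OF _ open_X])
    fix x' assume x': "x' \<in> {x. join (y t) x \<in> U}"
    then have "R (join (y t) x') *v join (p t) 0 = join (v t) 0"
      by (simp add: gv[symmetric] Rg_vec)
    moreover have "\<Delta> (join (y t) x) = \<Delta> (join (y t) x')"
      using x' q by (intro \<Delta>_cong) auto
    ultimately show "(1/2) * \<Delta> (join (y t) x) * (\<eta> t \<bullet> join (v t) 0) + W_top (join (y t) x') = energy t x'"
      using x' by (simp add: energy_alt[OF t] del: One_nat_def)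
  qed (use q in simp)
qed

text \<open>On a product of balls, move \<open>x\<close> at a fixed time and then the time at a
  fixed \<open>x\<close>. The statement is local because the slices of \<open>U\<close> need not be
  connected.\<close>

lemma energy_locally_constant:
  assumes t: "t \<in> T" and q: "join (y t) x \<in> U"
  obtains X where "open X" "(t, x) \<in> X"
    "\<And>t' x'. (t', x') \<in> X \<Longrightarrow> t' \<in> T \<and> join (y t') x' \<in> U \<and> energy t' x' = energy t x"
proof -
  have "(t, x) \<in> {(t, x). t \<in> T \<and> join (y t) x \<in> U}" using t q by simp
  with open_join[OF open_U] obtain A B where AB: "open A" "open B" "(t, x) \<in> A \<times> B"
    "A \<times> B \<subseteq> {(t, x). t \<in> T \<and> join (y t) x \<in> U}"
    by (rule open_prod_elim)
  obtain r s where r: "r > 0" "ball t r \<subseteq> A" and s: "s > 0" "ball x s \<subseteq> B"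
    using AB openE by (metis mem_Times_iff fst_conv snd_conv)
  have in_U: "t' \<in> T \<and> join (y t') x' \<in> U" if "t' \<in> ball t r" "x' \<in> ball x s" for t' x'
    using that r s AB(4) by blast
  have "energy t' x' = energy t x" if t': "t' \<in> ball t r" and x': "x' \<in> ball x s" for t' x'
  proof -
    have "energy t' x' = energy t' x"
    proof (rule has_derivative_zero_unique[where f = "energy t'", OF convex_ball])
      show "(energy t' has_derivative (\<lambda>_. 0)) (at z within ball x s)" if "z \<in> ball x s" for z
        using energy_space_derivative in_U[OF t' that] by (blast intro: has_derivative_at_withinI)
    qed (use x' s in auto)
    also have "\<dots> = energy t x"
    proof -
      have "((\<lambda>\<tau>. energy \<tau> x) has_field_derivative 0) (at \<tau> within ball t r)" if "\<tau> \<in> ball t r" for \<tau>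
        using energy_time_derivative in_U[OF that, of x] s(1)
        by (auto intro: has_field_derivative_at_within)
      from has_field_derivative_zero_constant[OF convex_ball this] show ?thesis
        using t' r(1) by force
    qed
    finally show ?thesis .
  qed
  note const = this
  show thesis
  proof (rule that)
    show "open (ball t r \<times> ball x s)" by (rule open_Times) simp_all
    show "(t, x) \<in> ball t r \<times> ball x s" using r s by simp
    fix t' x' assume "(t', x') \<in> ball t r \<times> ball x s"
    then have "t' \<in> ball t r" "x' \<in> ball x s" by (simp_all only: mem_Times_iff fst_conv snd_conv)
    then show "t' \<in> T \<and> join (y t') x' \<in> U \<and> energy t' x' = energy t x"
      using in_U const by blast
  qed
qed

end

section \<open>Functions of a single root\<close>

lemma bounded_linear_ypart: "bounded_linear ypart" and bounded_linear_xpart: "bounded_linear xpart"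
  by (auto simp: linear_conv_bounded_linear[symmetric] ypart_def xpart_def vec_eq_iff intro!: linearI)

lemma smooth_on_join:
  fixes f :: "'a::euclidean_space \<Rightarrow> real^'m::finite" and h :: "'a \<Rightarrow> real^'n::finite"
  assumes "open X" "smooth_on X f" "smooth_on X h"
  shows "smooth_on X (\<lambda>z. join (f z) (h z))"
proof -
  have "smooth_on X (\<lambda>z. join (f z) 0 + join 0 (h z))"
    by (intro smooth_on_add smooth_on_bounded_linear[OF _ bounded_linear_join(1)]
        smooth_on_bounded_linear[OF _ bounded_linear_join(2)] assms)
  then show ?thesis by (simp add: join_add[symmetric])
qed

section \<open>The coordinates (y, u) and their local inverses\<close>

context driven_motion
begin

definition "\<Theta> q = join (ypart q) (u q)"

lemma smooth_\<Theta>: "smooth_on U \<Theta>"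
  unfolding \<Theta>_def
  by (intro smooth_on_join smooth_on_linear bounded_linear_ypart u_smooth open_U)

lemma dd_\<Theta>_nth:
  assumes q: "q \<in> U"
  shows "dd \<Theta> q v $ Inl i = v $ Inl i" "dd \<Theta> q v $ Inr b = w b q \<bullet> v"
proof -
  have "dd (\<lambda>z. \<Theta> z $ Inl i) q v = v $ Inl i"
    using fun_cong[OF frechet_derivative_at[OF bounded_linear_imp_has_derivative[OF bounded_linear_vec_nth], symmetric], of "Inl i" q v]
    by (simp add: \<Theta>_def join_nth ypart_def)
  then show "dd \<Theta> q v $ Inl i = v $ Inl i" by (simp add: dd_vec_nth[OF smooth_\<Theta> q])
  have "dd (\<lambda>z. \<Theta> z $ Inr b) q v = w b q \<bullet> v"
    by (simp add: \<Theta>_def join_nth dd_u[OF q])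
  then show "dd \<Theta> q v $ Inr b = w b q \<bullet> v" by (simp add: dd_vec_nth[OF smooth_\<Theta> q])
qed

lemma jac_\<Theta>:
  assumes q: "q \<in> U"
  shows "det (jac \<Theta> q) \<noteq> 0"
proof -
  have "jac \<Theta> q *v v = dd \<Theta> q v" for v
    using has_derivative_bounded_linear[OF smooth_on_has_derivative[OF smooth_\<Theta> q]]
    by (metis matrix_vector_mul(3))
  moreover have "v = 0" if v: "dd \<Theta> q v = 0" for v
  proof (rule w_separates[OF q])
    have "v $ Inl i = 0" for i using dd_\<Theta>_nth(1)[OF q, of v i] v by simp
    then show "P2 *v v = v" by (intro sum_eqI) (simp_all add: P2_mult_vec)
    show "w b q \<bullet> v = 0" for b using dd_\<Theta>_nth(2)[OF q, of v b] v by simp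
  qed
  ultimately have "\<forall>v. jac \<Theta> q *v v = 0 \<longrightarrow> v = 0" by simp
  then show ?thesis
    using matrix_left_invertible_ker invertible_left_inverse invertible_det_nz by blast
qed

text \<open>The inverse function theorem for \<open>\<Theta>\<close>, with the image cut down to a
  ball because \<open>chart_factor\<close> uses its convexity.\<close>

lemma local_chart:
  assumes q0: "q0 \<in> U"
  obtains r \<Xi> where "r > 0" "smooth_on (ball (\<Theta> q0) r) \<Xi>" "open (\<Xi> ` ball (\<Theta> q0) r)" "\<Xi> (\<Theta> q0) = q0"
    "\<And>z. z \<in> ball (\<Theta> q0) r \<Longrightarrow> \<Xi> z \<in> U \<and> \<Theta> (\<Xi> z) = z"
proof -
  obtain Q B \<Xi> where Q: "open Q" "Q \<subseteq> U" "q0 \<in> Q" "open B" "\<Theta> q0 \<in> B" "homeomorphism Q B \<Theta> \<Xi>" "smooth_on B \<Xi>"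
    using smooth_local_inverse[OF open_U smooth_\<Theta> jac_\<Theta> q0] by blast
  obtain r where r: "r > 0" "ball (\<Theta> q0) r \<subseteq> B" using Q(4,5) openE by blast
  have \<Xi>: "\<Xi> z \<in> Q" "\<Theta> (\<Xi> z) = z" if "z \<in> B" for z
    using Q(6) that unfolding homeomorphism_def by auto
  have \<Xi>': "\<Theta> q \<in> B" "\<Xi> (\<Theta> q) = q" if "q \<in> Q" for q
    using Q(6) that unfolding homeomorphism_def by auto
  have "\<Xi> ` ball (\<Theta> q0) r = \<Theta> -` ball (\<Theta> q0) r \<inter> Q"
  proof
    show "\<Xi> ` ball (\<Theta> q0) r \<subseteq> \<Theta> -` ball (\<Theta> q0) r \<inter> Q" using r \<Xi> by auto
    show "\<Theta> -` ball (\<Theta> q0) r \<inter> Q \<subseteq> \<Xi> ` ball (\<Theta> q0) r"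
    proof
      fix q assume "q \<in> \<Theta> -` ball (\<Theta> q0) r \<inter> Q"
      then have "\<Theta> q \<in> ball (\<Theta> q0) r" "\<Xi> (\<Theta> q) = q" using \<Xi>' by auto
      then show "q \<in> \<Xi> ` ball (\<Theta> q0) r" by (metis image_eqI)
    qed
  qed
  moreover have "continuous_on Q \<Theta>"
    using smooth_on_continuous_on[OF smooth_\<Theta>] Q(2) by (rule continuous_on_subset)
  then have "open (\<Theta> -` ball (\<Theta> q0) r \<inter> Q)"
    using continuous_on_open_vimage[OF Q(1)] open_ball by blast
  ultimately have "open (\<Xi> ` ball (\<Theta> q0) r)" by simp
  moreover have "smooth_on (ball (\<Theta> q0) r) \<Xi>" using Q(7) r(2) by (rule smooth_on_subset)
  moreover have "\<Xi> z \<in> U \<and> \<Theta> (\<Xi> z) = z" if "z \<in> ball (\<Theta> q0) r" for z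
    using \<Xi> r(2) Q(2) that by blast
  ultimately show thesis using that r(1) \<Xi>'(2)[OF Q(3)] by blast
qed

text \<open>Along the segment from \<open>z\<close> to \<open>z'\<close> the coordinate
  \<open>Inr b\<close> is constant, so the image curve has its velocity in the kernel of
  \<open>w b\<close>, where \<open>f\<close> is stationary.\<close>

lemma chart_factor:
  fixes f :: "real^('m + 'n) \<Rightarrow> real"
  assumes \<Xi>: "smooth_on (ball z0 r) \<Xi>" "\<And>z. z \<in> ball z0 r \<Longrightarrow> \<Xi> z \<in> U \<and> \<Theta> (\<Xi> z) = z"
    and f: "smooth_on U f" "\<And>q v. q \<in> U \<Longrightarrow> w b q \<bullet> v = 0 \<Longrightarrow> dd f q v = 0"
    and z: "z \<in> ball z0 r" "z' \<in> ball z0 r" "z $ Inr b = z' $ Inr b"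
  shows "f (\<Xi> z) = f (\<Xi> z')"
proof -
  let ?l = "\<lambda>t. z + t *\<^sub>R (z' - z)"
  have l: "?l t \<in> ball z0 r" if "t \<in> {0..1}" for t
    using convexD_alt[OF convex_ball z(1,2), of t] that by (simp add: algebra_simps)
  have "((\<lambda>t. f (\<Xi> (?l t))) has_real_derivative 0) (at t)" if t: "t \<in> {0..1}" for t
  proof -
    note lt = l[OF t]
    have curve: "((\<lambda>t. \<Xi> (?l t)) has_vector_derivative dd \<Xi> (?l t) (z' - z)) (at t)"
      by (rule dd_curve[OF \<Xi>(1) lt line_has_vector_derivative])
    have U: "\<Xi> (?l t) \<in> U" using \<Xi>(2)[OF lt] by simp
    have "((\<lambda>t. u (\<Xi> (?l t)) $ b) has_vector_derivative w b (\<Xi> (?l t)) \<bullet> dd \<Xi> (?l t) (z' - z)) (at t)"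
      using dd_curve[OF smooth_u[of b], of "\<lambda>t. \<Xi> (?l t)" t, OF U curve] by (simp add: dd_u[OF U])
    moreover have "((\<lambda>t. u (\<Xi> (?l t)) $ b) has_vector_derivative 0) (at t)"
    proof -
      have o: "open (?l -` ball z0 r)"
        by (rule open_vimage[OF open_ball]) (intro continuous_intros)
      show ?thesis
      proof (rule has_vector_derivative_transform_within_open[where f = "\<lambda>_. z $ Inr b", OF has_vector_derivative_const o])
        fix s assume "s \<in> ?l -` ball z0 r"
        then have "\<Theta> (\<Xi> (?l s)) = ?l s" using \<Xi>(2) by simp
        then have "u (\<Xi> (?l s)) $ b = ?l s $ Inr b" by (metis \<Theta>_def join_nth(2))
        then show "z $ Inr b = u (\<Xi> (?l s)) $ b" using z(3) by simp
      qed (use lt in simp)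
    qed
    ultimately have "w b (\<Xi> (?l t)) \<bullet> dd \<Xi> (?l t) (z' - z) = 0"
      by (rule vector_derivative_unique_at)
    then have "dd f (\<Xi> (?l t)) (dd \<Xi> (?l t) (z' - z)) = 0"
      by (rule f(2)[OF U])
    then show ?thesis
      using dd_curve[OF f(1), of "\<lambda>t. \<Xi> (?l t)" t, OF U curve]
      by (simp add: has_real_derivative_iff_has_vector_derivative)
  qed
  then have "f (\<Xi> (?l 0)) = f (\<Xi> (?l 1))"
    using has_field_derivative_zero_constant[of "{0..1::real}" "\<lambda>t. f (\<Xi> (?l t))"]
    by (metis (no_types, lifting) atLeastAtMost_iff convex_real_interval(5) has_field_derivative_at_within order_refl zero_le_one)
  then show ?thesis by simp
qed

section \<open>Moving charts and their fibres\<close>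

abbreviation "\<theta> t x \<equiv> u (join (y t) x)"

text \<open>\<open>\<sigma> t v\<close> is the position \<open>x\<close> with root values \<open>v\<close> at time \<open>t\<close>.\<close>

lemma local_section:
  assumes t0: "t0 \<in> T" and q0: "join (y t0) x0 \<in> U"
  obtains r \<Xi> D \<sigma> where "r > 0" "smooth_on (ball (\<Theta> (join (y t0) x0)) r) \<Xi>" "open (\<Xi> ` ball (\<Theta> (join (y t0) x0)) r)"
    "\<And>z. z \<in> ball (\<Theta> (join (y t0) x0)) r \<Longrightarrow> \<Xi> z \<in> U \<and> \<Theta> (\<Xi> z) = z"
    "D = {(t, v). t \<in> T \<and> join (y t) v \<in> ball (\<Theta> (join (y t0) x0)) r}"
    "open D" "continuous_on D (\<lambda>(t, v). \<sigma> t v)" "\<sigma> t0 (\<theta> t0 x0) = x0" "(t0, \<theta> t0 x0) \<in> D"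
    "\<And>t v. (t, v) \<in> D \<Longrightarrow> join (y t) (\<sigma> t v) = \<Xi> (join (y t) v) \<and> \<theta> t (\<sigma> t v) = v"
proof -
  let ?z0 = "\<Theta> (join (y t0) x0)"
  obtain r \<Xi> where r: "r > 0" "smooth_on (ball ?z0 r) \<Xi>" "open (\<Xi> ` ball ?z0 r)" "\<Xi> ?z0 = join (y t0) x0"
    and \<Xi>: "\<And>z. z \<in> ball ?z0 r \<Longrightarrow> \<Xi> z \<in> U \<and> \<Theta> (\<Xi> z) = z"
    using local_chart[OF q0] by blast
  define D where "D = {(t, v). t \<in> T \<and> join (y t) v \<in> ball ?z0 r}"
  define \<sigma> where "\<sigma> = (\<lambda>t v. xpart (\<Xi> (join (y t) v)))"
  have "open D" unfolding D_def by (rule open_join) simp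
  moreover have "continuous_on D (\<lambda>z. \<Xi> (join (y (fst z)) (snd z)))"
    by (rule continuous_on_compose2[OF smooth_on_continuous_on[OF r(2)] continuous_on_subset[OF continuous_join]])
       (auto simp: D_def)
  then have "continuous_on D (\<lambda>(t, v). \<sigma> t v)"
    unfolding \<sigma>_def case_prod_beta by (rule bounded_linear.continuous_on[OF bounded_linear_xpart])
  moreover have z0: "join (y t0) (\<theta> t0 x0) = ?z0" by (simp add: \<Theta>_def)
  then have "\<sigma> t0 (\<theta> t0 x0) = x0" by (simp add: \<sigma>_def r(4))
  moreover have "(t0, \<theta> t0 x0) \<in> D" using t0 r(1) z0 by (simp add: D_def)
  moreover have "join (y t) (\<sigma> t v) = \<Xi> (join (y t) v) \<and> \<theta> t (\<sigma> t v) = v" if "(t, v) \<in> D" for t v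
  proof -
    have "\<Theta> (\<Xi> (join (y t) v)) = join (y t) v" using \<Xi> that by (auto simp: D_def)
    then have "ypart (\<Xi> (join (y t) v)) = y t" "u (\<Xi> (join (y t) v)) = v"
      unfolding \<Theta>_def by (metis ypart_join, metis xpart_join)
    moreover from this(1) have "join (y t) (\<sigma> t v) = \<Xi> (join (y t) v)"
      unfolding \<sigma>_def by (metis join_parts)
    ultimately show ?thesis by simp
  qed
  ultimately show thesis using that[OF r(1-3) \<Xi> D_def] by blast
qed

lemma moving_chart_exists:
  assumes t0: "t0 \<in> T" and q0: "join (y t0) x0 \<in> U"
  shows "\<exists>N. moving_chart T U u y N \<and> (t0, x0) \<in> N"
proof -
  let ?z0 = "\<Theta> (join (y t0) x0)"
  obtain r \<Xi> D \<sigma> where r: "r > 0" "smooth_on (ball ?z0 r) \<Xi>" "open (\<Xi> ` ball ?z0 r)"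
    and \<Xi>: "\<And>z. z \<in> ball ?z0 r \<Longrightarrow> \<Xi> z \<in> U \<and> \<Theta> (\<Xi> z) = z"
    and D_eq: "D = {(t, v). t \<in> T \<and> join (y t) v \<in> ball ?z0 r}"
    and D: "open D" "continuous_on D (\<lambda>(t, v). \<sigma> t v)" "\<sigma> t0 (\<theta> t0 x0) = x0" "(t0, \<theta> t0 x0) \<in> D"
    and \<sigma>: "\<And>t v. (t, v) \<in> D \<Longrightarrow> join (y t) (\<sigma> t v) = \<Xi> (join (y t) v) \<and> \<theta> t (\<sigma> t v) = v"
    using local_section[OF assms] by blast
  obtain A B where AB: "open A" "open B" "(t0, \<theta> t0 x0) \<in> A \<times> B" "A \<times> B \<subseteq> D"
    using D(1,4) by (rule open_prod_elim)
  obtain d where d: "d > 0" "ball t0 d \<subseteq> A" using AB openE by (metis mem_Times_iff fst_conv)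
  \<comment> \<open>With times in a ball and root values in \<open>B\<close>, the product lies in
    the domain of the section. The time set of a value \<open>v\<close> is then the whole ball or
    empty, hence connected.\<close>
  define N where "N = {(t, x). (t \<in> ball t0 d \<and> t \<in> T \<and> join (y t) x \<in> \<Xi> ` ball ?z0 r) \<and> \<theta> t x \<in> B}"
  have DT: "t \<in> T" if "t \<in> ball t0 d" for t
    using that d(2) AB(3,4) unfolding D_eq by blast
  have ImU: "\<Xi> ` ball ?z0 r \<subseteq> U" using \<Xi> by blast
  have "open N"
  proof -
    have oB: "open (u -` B \<inter> \<Xi> ` ball ?z0 r)"
      using continuous_on_open_vimage[OF r(3)] AB(2)
        continuous_on_subset[OF smooth_on_continuous_on[OF u_smooth] ImU] by blast
    have "open ((ball t0 d \<times> UNIV) \<inter> {(t, x). t \<in> T \<and> join (y t) x \<in> u -` B \<inter> \<Xi> ` ball ?z0 r})"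
      by (rule open_Int[OF open_Times[OF open_ball open_UNIV] open_join[OF oB]])
    also have "(ball t0 d \<times> UNIV) \<inter> {(t, x). t \<in> T \<and> join (y t) x \<in> u -` B \<inter> \<Xi> ` ball ?z0 r} = N"
      unfolding N_def by auto
    finally show ?thesis .
  qed
  moreover have "\<forall>(t, x)\<in>N. t \<in> T \<and> join (y t) x \<in> U" using ImU by (auto simp: N_def)
  moreover have "inj_on (\<lambda>(t, x). (t, \<theta> t x)) N"
  proof (rule inj_onI, clarsimp)
    fix t x x' assume N: "(t, x) \<in> N" "(t, x') \<in> N" and eq: "\<theta> t x = \<theta> t x'"
    obtain z z' where z: "z \<in> ball ?z0 r" "z' \<in> ball ?z0 r" "join (y t) x = \<Xi> z" "join (y t) x' = \<Xi> z'"
      using N unfolding N_def by blast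
    have "\<Theta> (join (y t) x) = \<Theta> (join (y t) x')" using eq by (simp add: \<Theta>_def)
    then have "join (y t) x = join (y t) x'" using z \<Xi> by metis
    then show "x = x'" by (metis xpart_join)
  qed
  moreover have "connected {t. \<exists>x. (t, x) \<in> N \<and> \<theta> t x = v}" for v
  proof (cases "v \<in> B")
    case True
    have "{t. \<exists>x. (t, x) \<in> N \<and> \<theta> t x = v} = ball t0 d"
    proof
      show "{t. \<exists>x. (t, x) \<in> N \<and> \<theta> t x = v} \<subseteq> ball t0 d" unfolding N_def by blast
      show "ball t0 d \<subseteq> {t. \<exists>x. (t, x) \<in> N \<and> \<theta> t x = v}"
      proof
        fix t assume t: "t \<in> ball t0 d"
        then have tv: "(t, v) \<in> D" using d(2) AB(4) True by blast
        then have "join (y t) v \<in> ball ?z0 r" by (simp add: D_eq)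
        then have "join (y t) (\<sigma> t v) \<in> \<Xi> ` ball ?z0 r" using \<sigma>[OF tv] by (metis imageI)
        moreover have "\<theta> t (\<sigma> t v) \<in> B" using \<sigma>[OF tv] True by metis
        ultimately have "(t, \<sigma> t v) \<in> N" using t DT[OF t] unfolding N_def by blast
        then show "t \<in> {t. \<exists>x. (t, x) \<in> N \<and> \<theta> t x = v}" using \<sigma>[OF tv] by blast
      qed
    qed
    then show ?thesis by simp
  next
    case False
    then have "{t. \<exists>x. (t, x) \<in> N \<and> \<theta> t x = v} = {}" by (auto simp: N_def)
    then show ?thesis by (simp only: connected_empty)
  qed
  moreover have "(t0, x0) \<in> N"
  proof -
    have "join (y t0) x0 = \<Xi> ?z0" using \<sigma>[OF D(4)] D(3) by (simp add: \<Theta>_def)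
    then have "join (y t0) x0 \<in> \<Xi> ` ball ?z0 r" using r(1) by simp
    then show ?thesis using d(1) t0 AB(3) by (simp add: N_def)
  qed
  ultimately show ?thesis unfolding moving_chart_def by blast
qed

text \<open>Injectivity of the chart makes the point \<open>\<xi> t\<close> with root values
  \<open>?v\<close> unique, and \<open>local_section\<close> makes it continuous in time. Local
  constancy along it spreads over the connected time set.\<close>

lemma fibre_constant:
  fixes F :: "real \<Rightarrow> real^'n \<Rightarrow> 'c"
  assumes N: "moving_chart T U u y N"
    and loc: "\<And>t0 x0. (t0, x0) \<in> N \<Longrightarrow> \<exists>X. open X \<and> (t0, x0) \<in> X \<and>
      (\<forall>(t, x)\<in>X. t \<in> T \<longrightarrow> join (y t) x \<in> U \<longrightarrow> \<theta> t x = \<theta> t0 x0 \<longrightarrow> F t x = F t0 x0)"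
    and tx: "(t1, x1) \<in> N" "(t2, x2) \<in> N" "\<theta> t1 x1 = \<theta> t2 x2"
  shows "F t1 x1 = F t2 x2"
proof -
  let ?v = "\<theta> t1 x1"
  let ?S = "{t. \<exists>x. (t, x) \<in> N \<and> \<theta> t x = ?v}"
  define \<xi> where "\<xi> = (\<lambda>t. THE x. (t, x) \<in> N \<and> \<theta> t x = ?v)"
  have uniq: "x = x'" if "(t, x) \<in> N" "(t, x') \<in> N" "\<theta> t x = \<theta> t x'" for t x x'
    using N that unfolding moving_chart_def by (auto dest!: inj_onD[where x = "(t, x)" and y = "(t, x')"])
  have \<xi>: "\<xi> t = x" if "(t, x) \<in> N" "\<theta> t x = ?v" for t x
    unfolding \<xi>_def using uniq that by (intro the_equality) auto
  have "F t1 (\<xi> t1) = F t2 (\<xi> t2)"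
  proof (rule connected_local_const[where f = "\<lambda>t. F t (\<xi> t)" and A = ?S])
    show "connected ?S" using N by (simp add: moving_chart_def)
    show "t1 \<in> ?S" "t2 \<in> ?S" using tx by force+
    show "\<forall>t0\<in>?S. \<forall>\<^sub>F t in at t0 within ?S. F t0 (\<xi> t0) = F t (\<xi> t)"
    proof
      fix t0 assume "t0 \<in> ?S"
      then obtain x0 where x0: "(t0, x0) \<in> N" "\<theta> t0 x0 = ?v" by blast
      have q0: "t0 \<in> T" "join (y t0) x0 \<in> U" using N x0(1) by (auto simp: moving_chart_def)
      obtain X where X: "open X" "(t0, x0) \<in> X" "\<And>t x. (t, x) \<in> X \<Longrightarrow> t \<in> T \<Longrightarrow> join (y t) x \<in> U \<Longrightarrow>
          \<theta> t x = \<theta> t0 x0 \<Longrightarrow> F t x = F t0 x0"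
        using loc[OF x0(1)] by blast
      obtain r \<Xi> D \<sigma> where
        D: "open D" "continuous_on D (\<lambda>(t, v). \<sigma> t v)" "\<sigma> t0 (\<theta> t0 x0) = x0" "(t0, \<theta> t0 x0) \<in> D"
        and \<sigma>: "\<And>t v. (t, v) \<in> D \<Longrightarrow> join (y t) (\<sigma> t v) = \<Xi> (join (y t) v) \<and> \<theta> t (\<sigma> t v) = v"
        by (rule local_section[OF q0]) (rule that)
      have c1: "isCont (\<lambda>(t, v). \<sigma> t v) (t0, ?v)"
        using D x0(2) continuous_on_eq_continuous_at by metis
      have c2: "isCont (\<lambda>t. (t, ?v)) t0" by (intro continuous_intros)
      have "isCont (\<lambda>t. \<sigma> t ?v) t0"
        using isCont_o2[OF c2 c1] by simp
      then have "isCont (\<lambda>t. (t, \<sigma> t ?v)) t0"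
        by (rule isCont_Pair[OF continuous_ident])
      then have "\<forall>\<^sub>F t in at t0. (t, \<sigma> t ?v) \<in> X \<inter> N"
        using X(1,2) x0 D(3) N unfolding isCont_def moving_chart_def
        by (intro topological_tendstoD[where f = "\<lambda>t. (t, \<sigma> t ?v)" and l = "(t0, \<sigma> t0 ?v)"]) auto
      moreover have "\<forall>\<^sub>F t in at t0. (t, ?v) \<in> D"
        using c2 D(1,4) x0(2) unfolding isCont_def
        by (intro topological_tendstoD) auto
      ultimately have "\<forall>\<^sub>F t in at t0. F t0 (\<xi> t0) = F t (\<xi> t)"
      proof eventually_elim
        case (elim t)
        then have "(t, \<sigma> t ?v) \<in> N" "(t, \<sigma> t ?v) \<in> X" by simp_all
        moreover have "\<theta> t (\<sigma> t ?v) = ?v" using \<sigma>[OF elim(2)] by (rule conjunct2)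
        moreover have "t \<in> T" "join (y t) (\<sigma> t ?v) \<in> U"
          using elim(1) N unfolding moving_chart_def by blast+
        ultimately have "F t (\<sigma> t ?v) = F t0 x0" "\<xi> t = \<sigma> t ?v" using X(3) \<xi> x0(2) by metis+
        then show ?case using \<xi>[OF x0] by simp
      qed
      then show "\<forall>\<^sub>F t in at t0 within ?S. F t0 (\<xi> t0) = F t (\<xi> t)"
        by (rule filter_leD[OF at_le[OF subset_UNIV]])
    qed
  qed
  then show ?thesis using \<xi> tx by simp
qed

end

lemma dist_join: "dist (join y x) (join y x') = dist x x'"
proof -
  have "join y x - join y x' = join 0 (x - x')"
    by (intro sum_eqI) (simp_all add: join_nth)
  then have "dist (join y x) (join y x') = norm (join 0 (x - x') :: real^('a + 'b))"
    by (simp add: dist_norm)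
  also have "\<dots> = norm (x - x')"
    by (simp add: norm_eq_sqrt_inner inner_vec_def sum_sum_type join_nth)
  finally show ?thesis by (simp add: dist_norm)
qed

context driven_motion
begin

text \<open>Near each point \<open>chart_factor\<close> makes \<open>f\<close> depend on
  \<open>u $ b\<close> alone; this is the local hypothesis of \<open>fibre_constant\<close>.\<close>

lemma root_function_fibre_constant:
  fixes f :: "real^('m + 'n) \<Rightarrow> real"
  assumes N: "moving_chart T U u y N"
    and f: "smooth_on U f" "\<And>q v. q \<in> U \<Longrightarrow> w b q \<bullet> v = 0 \<Longrightarrow> dd f q v = 0"
    and tx: "(t1, x1) \<in> N" "(t2, x2) \<in> N" "\<theta> t1 x1 = \<theta> t2 x2"
  shows "f (join (y t1) x1) = f (join (y t2) x2)"
proof (rule fibre_constant[OF N _ tx, where F = "\<lambda>t x. f (join (y t) x)"])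
  fix t0 x0 assume "(t0, x0) \<in> N"
  then have q0: "t0 \<in> T" "join (y t0) x0 \<in> U" using N by (auto simp: moving_chart_def)
  obtain r \<Xi> where r: "r > 0" "smooth_on (ball (\<Theta> (join (y t0) x0)) r) \<Xi>"
    "open (\<Xi> ` ball (\<Theta> (join (y t0) x0)) r)" "\<Xi> (\<Theta> (join (y t0) x0)) = join (y t0) x0"
    and \<Xi>: "\<And>z. z \<in> ball (\<Theta> (join (y t0) x0)) r \<Longrightarrow> \<Xi> z \<in> U \<and> \<Theta> (\<Xi> z) = z"
    by (rule local_chart[OF q0(2)]) (rule that)
  let ?B = "ball (\<Theta> (join (y t0) x0)) r"
  let ?X = "{(t, x). t \<in> T \<and> join (y t) x \<in> \<Xi> ` ?B}"
  show "\<exists>X. open X \<and> (t0, x0) \<in> X \<and> (\<forall>(t, x)\<in>X. t \<in> T \<longrightarrow> join (y t) x \<in> U \<longrightarrow>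
      \<theta> t x = \<theta> t0 x0 \<longrightarrow> f (join (y t) x) = f (join (y t0) x0))"
  proof (intro exI[of _ ?X] conjI)
    show "open ?X" by (rule open_join[OF r(3)])
    have c: "\<Theta> (join (y t0) x0) \<in> ?B" using r(1) by simp
    then have "\<Xi> (\<Theta> (join (y t0) x0)) \<in> \<Xi> ` ?B" by (rule imageI)
    then show "(t0, x0) \<in> ?X" using r(4) q0(1) by simp
    have "f (join (y t) x) = f (join (y t0) x0)" if tx: "(t, x) \<in> ?X" and eq: "\<theta> t x = \<theta> t0 x0" for t x
    proof -
      obtain z where z: "z \<in> ?B" "join (y t) x = \<Xi> z" using tx by auto
      then have "z = \<Theta> (join (y t) x)" using \<Xi> by simp
      then have zb: "z $ Inr b = \<Theta> (join (y t0) x0) $ Inr b"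
        using eq by (simp add: \<Theta>_def join_nth)
      have "f (\<Xi> z) = f (\<Xi> (\<Theta> (join (y t0) x0)))"
        by (rule chart_factor[where b = b, OF r(2) _ f(1) _ z(1) c zb]) (use \<Xi> f(2) in blast)+
      then show ?thesis using z(2) r(4) by metis
    qed
    then show "\<forall>(t, x)\<in>?X. t \<in> T \<longrightarrow> join (y t) x \<in> U \<longrightarrow> \<theta> t x = \<theta> t0 x0 \<longrightarrow>
        f (join (y t) x) = f (join (y t0) x0)" by blast
  qed
qed

lemma energy_fibre_constant:
  assumes N: "moving_chart T U u y N"
    and tx: "(t1, x1) \<in> N" "(t2, x2) \<in> N" "\<theta> t1 x1 = \<theta> t2 x2"
  shows "energy t1 x1 = energy t2 x2"
proof (rule fibre_constant[OF N _ tx])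
  fix t0 x0 assume "(t0, x0) \<in> N"
  then have q0: "t0 \<in> T" "join (y t0) x0 \<in> U" using N by (auto simp: moving_chart_def)
  obtain X where X: "open X" "(t0, x0) \<in> X"
    "\<And>t' x'. (t', x') \<in> X \<Longrightarrow> t' \<in> T \<and> join (y t') x' \<in> U \<and> energy t' x' = energy t0 x0"
    by (rule energy_locally_constant[OF q0]) (rule that)
  show "\<exists>X. open X \<and> (t0, x0) \<in> X \<and> (\<forall>(t, x)\<in>X. t \<in> T \<longrightarrow> join (y t) x \<in> U \<longrightarrow>
      \<theta> t x = \<theta> t0 x0 \<longrightarrow> energy t x = energy t0 x0)"
    by (intro exI[of _ X] conjI X(1,2)) (use X(3) in blast)
qed

text \<open>A single time slice suffices, because the integrals are constant on the fibres. The
  one-variable functions are the restrictions of \<open>\<Phi> b\<close> and \<open>\<phi> b\<close>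
  to the chart line \<open>e b\<close> through the centre on which only entry \<open>b\<close>
  varies.\<close>

lemma local_normal_form:
  assumes N: "moving_chart T U u y N" and tx: "(t0, x0) \<in> N"
  obtains \<rho> f \<psi> where "\<rho> > 0"
    "\<And>b. smooth_on {\<theta> t0 x0 $ b - \<rho><..<\<theta> t0 x0 $ b + \<rho>} (f b)"
    "\<And>b. smooth_on {\<theta> t0 x0 $ b - \<rho><..<\<theta> t0 x0 $ b + \<rho>} (\<psi> b)"
    "\<And>b c. c \<in> {\<theta> t0 x0 $ b - \<rho><..<\<theta> t0 x0 $ b + \<rho>} \<Longrightarrow> f b c \<noteq> 0"
    "\<And>v. v \<in> ball (\<theta> t0 x0) \<rho> \<Longrightarrow> \<exists>x. (t0, x) \<in> N \<and> \<theta> t0 x = v \<and> energy t0 x = energy t0 x0 \<and>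
       (\<forall>b. \<Phi> b (join (y t0) x) = f b (v $ b) \<and> \<phi> b (join (y t0) x) = \<psi> b (v $ b))"
proof -
  have q0: "t0 \<in> T" "join (y t0) x0 \<in> U" using N tx by (auto simp: moving_chart_def)
  let ?v0 = "\<theta> t0 x0" and ?q0 = "join (y t0) x0"
  obtain r \<Xi> D \<sigma> where r: "r > 0" "smooth_on (ball (\<Theta> ?q0) r) \<Xi>"
    and \<Xi>: "\<And>z. z \<in> ball (\<Theta> ?q0) r \<Longrightarrow> \<Xi> z \<in> U \<and> \<Theta> (\<Xi> z) = z"
    and D_eq: "D = {(t, v). t \<in> T \<and> join (y t) v \<in> ball (\<Theta> ?q0) r}"
    and D: "open D" "continuous_on D (\<lambda>(t, v). \<sigma> t v)" "\<sigma> t0 ?v0 = x0" "(t0, ?v0) \<in> D"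
    and \<sigma>: "\<And>t v. (t, v) \<in> D \<Longrightarrow> join (y t) (\<sigma> t v) = \<Xi> (join (y t) v) \<and> \<theta> t (\<sigma> t v) = v"
    by (rule local_section[OF q0]) (rule that)
  obtain X where X: "open X" "(t0, x0) \<in> X" "\<And>t' x'. (t', x') \<in> X \<Longrightarrow> t' \<in> T \<and> join (y t') x' \<in> U \<and> energy t' x' = energy t0 x0"
    by (rule energy_locally_constant[OF q0]) (rule that)
  have z0: "\<Theta> ?q0 = join (y t0) ?v0" by (simp add: \<Theta>_def)
  have in_ball: "join (y t0) v \<in> ball (\<Theta> ?q0) r" if "dist v ?v0 < r" for v
    using that unfolding z0 by (simp add: dist_join dist_commute)
  have c1: "isCont (\<lambda>(t, v). \<sigma> t v) (t0, ?v0)"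
    using D continuous_on_eq_continuous_at by metis
  have c2: "isCont (\<lambda>v. (t0, v)) ?v0" by (intro continuous_intros)
  have "isCont (\<lambda>v. \<sigma> t0 v) ?v0" using isCont_o2[OF c2 c1] by simp
  then have "isCont (\<lambda>v. (t0, \<sigma> t0 v)) ?v0" by (rule isCont_Pair[OF continuous_const])
  then have "((\<lambda>v. (t0, \<sigma> t0 v)) \<longlongrightarrow> (t0, \<sigma> t0 ?v0)) (nhds ?v0)"
    unfolding isCont_def by (rule tendsto_at_iff_tendsto_nhds[THEN iffD1])
  then have "((\<lambda>v. (t0, \<sigma> t0 v)) \<longlongrightarrow> (t0, x0)) (nhds ?v0)"
    by (simp only: D(3))
  moreover have "open (X \<inter> N)" "(t0, x0) \<in> X \<inter> N"
    using X(1,2) N tx by (auto simp: moving_chart_def)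
  ultimately have "\<forall>\<^sub>F v in nhds ?v0. (t0, \<sigma> t0 v) \<in> X \<inter> N"
    by (rule topological_tendstoD)
  then obtain d where d: "d > 0" "\<And>v. dist v ?v0 < d \<Longrightarrow> (t0, \<sigma> t0 v) \<in> X \<inter> N"
    unfolding eventually_nhds_metric by blast
  define \<rho> where "\<rho> = min d r"
  define e where "e = (\<lambda>b c. join (y t0) (?v0 + (c - ?v0 $ b) *\<^sub>R axis b 1))"
  have e: "e b c \<in> ball (\<Theta> ?q0) r" if "c \<in> {?v0 $ b - \<rho><..<?v0 $ b + \<rho>}" for b c
    unfolding e_def using that
    by (intro in_ball) (auto simp: dist_norm norm_axis_1 \<rho>_def)
  have smooth_e: "smooth_on {?v0 $ b - \<rho><..<?v0 $ b + \<rho>} (e b)" for b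
    unfolding e_def diff_conv_add_uminus
    by (intro smooth_on_join smooth_on_add smooth_on_const
        smooth_on_bounded_linear[OF _ bounded_linear_scaleR_left] smooth_on_linear bounded_linear_ident) auto
  define \<rho>I where "\<rho>I = (\<lambda>b. {?v0 $ b - \<rho><..<?v0 $ b + \<rho>})"
  have smooth: "smooth_on {?v0 $ b - \<rho><..<?v0 $ b + \<rho>} (\<lambda>c. h (\<Xi> (e b c)))"
    if h: "smooth_on U h" for b and h :: "real^('m + 'n) \<Rightarrow> real"
  proof -
    have "smooth_on {?v0 $ b - \<rho><..<?v0 $ b + \<rho>} (\<lambda>c. \<Xi> (e b c))"
      by (rule smooth_on_compose[OF _ open_ball r(2) smooth_e e]) auto
    then show ?thesis
      by (intro smooth_on_compose[OF _ open_U h]) (use \<Xi> e in auto)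
  qed
  show thesis
  proof (rule that)
    show "\<rho> > 0" using d(1) r(1) by (simp add: \<rho>_def)
    show "smooth_on {?v0 $ b - \<rho><..<?v0 $ b + \<rho>} (\<lambda>c. \<Phi> b (\<Xi> (e b c)))" for b
      by (rule smooth[OF smooth_\<Phi>])
    show "smooth_on {?v0 $ b - \<rho><..<?v0 $ b + \<rho>} (\<lambda>c. \<phi> b (\<Xi> (e b c)))" for b
      by (rule smooth[OF smooth_\<phi>])
    show "\<Phi> b (\<Xi> (e b c)) \<noteq> 0" if "c \<in> {?v0 $ b - \<rho><..<?v0 $ b + \<rho>}" for b c
      using \<Phi>_nz \<Xi>[OF e[OF that]] by blast
    fix v assume v: "v \<in> ball ?v0 \<rho>"
    then have dv: "dist v ?v0 < d" "dist v ?v0 < r" by (simp_all add: \<rho>_def dist_commute)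
    have vD: "(t0, v) \<in> D" using in_ball[OF dv(2)] q0(1) by (simp add: D_eq)
    have vb: "v $ b \<in> {?v0 $ b - \<rho><..<?v0 $ b + \<rho>}" for b
    proof -
      have "\<bar>(v - ?v0) $ b\<bar> < \<rho>"
        using component_le_norm_cart[of "v - ?v0" b] v by (simp add: dist_norm norm_minus_commute)
      then show ?thesis by auto
    qed
    have same: "h (join (y t0) (\<sigma> t0 v)) = h (\<Xi> (e b (v $ b)))"
      if "smooth_on U h" "\<And>q v. q \<in> U \<Longrightarrow> w b q \<bullet> v = 0 \<Longrightarrow> dd h q v = 0" for b and h :: "real^('m + 'n) \<Rightarrow> real"
      unfolding conjunct1[OF \<sigma>[OF vD]]
      by (rule chart_factor[where b = b, OF r(2) _ that(1) _ in_ball[OF dv(2)] e[OF vb]])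
         (use \<Xi> that(2) in \<open>blast | simp add: e_def join_nth\<close>)+
    show "\<exists>x. (t0, x) \<in> N \<and> \<theta> t0 x = v \<and> energy t0 x = energy t0 x0 \<and>
       (\<forall>b. \<Phi> b (join (y t0) x) = \<Phi> b (\<Xi> (e b (v $ b))) \<and> \<phi> b (join (y t0) x) = \<phi> b (\<Xi> (e b (v $ b))))"
    proof (intro exI[of _ "\<sigma> t0 v"] conjI allI)
      show "(t0, \<sigma> t0 v) \<in> N" "energy t0 (\<sigma> t0 v) = energy t0 x0" using d(2)[OF dv(1)] X(3) by blast+
      show "\<theta> t0 (\<sigma> t0 v) = v" using \<sigma>[OF vD] by (rule conjunct2)
      show "\<Phi> b (join (y t0) (\<sigma> t0 v)) = \<Phi> b (\<Xi> (e b (v $ b)))" for b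
        by (rule same[OF smooth_\<Phi> dd_\<Phi>_kernel])
      show "\<phi> b (join (y t0) (\<sigma> t0 v)) = \<phi> b (\<Xi> (e b (v $ b)))" for b
        by (rule same[OF smooth_\<phi> dd_\<phi>_kernel])
    qed
  qed
qed

end

section \<open>Interpolation and separation of the Hamilton--Jacobi equation\<close>

text \<open>Lagrange's basis polynomial for the node \<open>- v $ b\<close>, not normalised. The
  nodes are negative because the integrals are generated by \<open>J + a P2\<close> and the roots
  belong to \<open>J - u P2\<close>.\<close>

definition node_poly :: "(real^'n::finite) \<Rightarrow> 'n \<Rightarrow> real poly" where
  "node_poly v b = (\<Prod>d\<in>UNIV - {b}. [:v $ d, 1:])"

lemma poly_node_poly: "poly (node_poly v b) c = (\<Prod>d\<in>UNIV - {b}. v $ d + c)"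
  by (simp add: node_poly_def poly_prod)

lemma degree_node_poly: "degree (node_poly (v :: real^'n::finite) b) < CARD('n)"
proof -
  have "degree (node_poly v b) = card (UNIV - {b})"
    unfolding node_poly_def by (rule degree_prod_linear) simp
  also have "\<dots> < CARD('n)" by (rule psubset_card_mono) auto
  finally show ?thesis .
qed

lemma node_poly_other: "c \<noteq> b \<Longrightarrow> poly (node_poly v b) (- v $ c) = 0"
  unfolding poly_node_poly by (rule prod_zero) auto

lemma node_poly_self: "inj (($) v) \<Longrightarrow> poly (node_poly v b) (- v $ b) \<noteq> 0"
  by (auto simp: poly_node_poly dest: injD)

lemma degree_smult_node_poly: "degree (smult a (node_poly (v :: real^'n::finite) b)) < CARD('n)"
  using degree_smult_le degree_node_poly by (rule le_less_trans)

lemma degree_sum_node_poly: "degree (\<Sum>b\<in>UNIV. smult (a b) (node_poly (v :: real^'n::finite) b)) < CARD('n)"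
proof (rule degree_sum_less)
  show "degree (smult (a b) (node_poly v b)) < CARD('n)" for b by (rule degree_smult_node_poly)
qed simp

lemma poly_eq_nodes:
  fixes v :: "real^'n::finite"
  assumes "inj (($) v)" "degree p < CARD('n)" "degree r < CARD('n)" "\<And>b. poly p (- v $ b) = poly r (- v $ b)"
  shows "p = r"
proof (rule poly_eqI_degree)
  have "card (range (\<lambda>b. - v $ b)) = CARD('n)"
    using assms(1) by (intro card_image) (auto simp: inj_def)
  then show "degree p < card (range (\<lambda>b. - v $ b))" "degree r < card (range (\<lambda>b. - v $ b))"
    using assms(2,3) by simp_all
qed (use assms(4) in auto)

text \<open>The weights of Lagrange interpolation; \<open>i - 1\<close> because the i-th integral is
  the coefficient at degree \<open>i - 1\<close>.\<close>

definition interp_coeff :: "nat \<Rightarrow> 'n \<Rightarrow> real^'n::finite \<Rightarrow> real" where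
  "interp_coeff i b v = coeff (node_poly v b) (i - 1) / poly (node_poly v b) (- v $ b)"

lemma interp_coeff_poly:
  fixes v :: "real^'n::finite"
  assumes v: "inj (($) v)" and p: "degree p < CARD('n)"
  shows "coeff p (i - 1) = (\<Sum>b\<in>UNIV. interp_coeff i b v * poly p (- v $ b))"
proof -
  let ?r = "\<Sum>b\<in>UNIV. smult (poly p (- v $ b) / poly (node_poly v b) (- v $ b)) (node_poly v b)"
  have "poly ?r (- v $ c) = poly p (- v $ c)" for c
  proof -
    have "poly ?r (- v $ c) = (\<Sum>b\<in>UNIV. if b = c then poly p (- v $ c) else 0)"
      unfolding poly_sum by (rule sum.cong) (auto simp: node_poly_other node_poly_self[OF v])
    then show ?thesis by simp
  qed
  then have "p = ?r"
    by (intro poly_eq_nodes[OF v p degree_sum_node_poly]) simp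
  then have "coeff p (i - 1) = coeff ?r (i - 1)" by simp
  then show ?thesis by (simp add: interp_coeff_def coeff_sum mult.commute)
qed

text \<open>The n nodes determine only n coefficients, so the top one is treated as known and moved
  to the values at the nodes.\<close>

lemma interp_coeff_sum:
  fixes v :: "real^'n::finite" and H :: "nat \<Rightarrow> real"
  assumes v: "inj (($) v)" and i: "i \<in> {1..CARD('n)}"
    and H: "\<And>b. (\<Sum>i=1..CARD('n) + 1. (- v $ b) ^ (i - 1) * H i) = z b"
  shows "H i = (\<Sum>b\<in>UNIV. interp_coeff i b v * (z b - H (CARD('n) + 1) * (- v $ b) ^ CARD('n)))"
proof -
  let ?p = "\<Sum>i=1..CARD('n). monom (H i) (i - 1)"
  have "degree ?p < CARD('n)"
    by (rule degree_sum_less) (auto intro: le_less_trans[OF degree_monom_le])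
  moreover have "poly ?p (- v $ b) = z b - H (CARD('n) + 1) * (- v $ b) ^ CARD('n)" for b
    using H[of b] by (simp add: poly_sum poly_monom mult.commute)
  moreover have "coeff ?p (i - 1) = (\<Sum>k=1..CARD('n). if k = i then H k else 0)"
    unfolding coeff_sum using i by (intro sum.cong) auto
  then have "coeff ?p (i - 1) = H i" using i by simp
  ultimately show ?thesis using interp_coeff_poly[OF v, of ?p i] by simp
qed

text \<open>Written as an integral over a fixed interval, the antiderivative depends smoothly on parameters
  by \<open>smooth_on_integral\<close>.\<close>

lemma has_derivative_primitive:
  fixes \<gamma> :: "real \<Rightarrow> real"
  assumes \<gamma>: "continuous_on {l<..<r} \<gamma>" and c: "c \<in> {l<..<r}" and x: "x \<in> {l<..<r}"
  shows "((\<lambda>x. (x - c) * integral {0..1} (\<lambda>s. \<gamma> (c + s * (x - c)))) has_real_derivative \<gamma> x) (at x)"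
proof -
  obtain a b where ab: "l < a" "a < c" "a < x" "c < b" "x < b" "b < r"
    using c x dense[of l "min c x"] dense[of "max c x" r] by auto
  have cont: "continuous_on {a..b} \<gamma>" by (rule continuous_on_subset[OF \<gamma>]) (use ab in auto)
  define G where "G = (\<lambda>z. integral {a..z} \<gamma>)"
  have G: "(G has_vector_derivative \<gamma> z) (at z within {a..b})" if "z \<in> {a..b}" for z
    unfolding G_def by (rule integral_has_vector_derivative[OF cont that])
  have eq: "(z - c) * integral {0..1} (\<lambda>s. \<gamma> (c + s * (z - c))) = G z - G c" if z: "z \<in> {a<..<b}" for z
  proof -
    let ?k = "\<lambda>s. c + s * (z - c)"
    have k: "?k s \<in> {a<..<b}" if "s \<in> {0..1}" for s
      using convexD_alt[of "{a<..<b}" c z s] that ab z by (simp add: algebra_simps)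
    have "((\<lambda>s. (z - c) * \<gamma> (?k s)) has_integral (G (?k 1) - G (?k 0))) {0..1}"
    proof (rule fundamental_theorem_of_calculus)
      fix s :: real assume s: "s \<in> {0..1}"
      have 1: "(G has_vector_derivative \<gamma> (?k s)) (at (?k s))"
        using G[of "?k s"] k[OF s] by (simp add: at_within_Icc_at)
      have 2: "(?k has_vector_derivative (z - c)) (at s within {0..1})"
        by (auto intro!: derivative_eq_intros simp: has_real_derivative_iff_has_vector_derivative[symmetric])
      have "((G \<circ> ?k) has_vector_derivative (z - c) *\<^sub>R \<gamma> (?k s)) (at s within {0..1})"
        by (rule vector_derivative_diff_chain_within[OF 2
              has_derivative_at_withinI[OF 1[unfolded has_vector_derivative_def]]])
      then show "((\<lambda>s. G (?k s)) has_vector_derivative (z - c) * \<gamma> (?k s)) (at s within {0..1})"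
        by (simp add: o_def)
    qed simp
    from integral_unique[OF this] show ?thesis by simp
  qed
  have "(G has_vector_derivative \<gamma> x) (at x)"
    using G[of x] ab by (simp add: at_within_Icc_at)
  then have "((\<lambda>z. G z - G c) has_real_derivative \<gamma> x) (at x)"
    by (auto intro!: derivative_eq_intros simp: has_real_derivative_iff_has_vector_derivative[symmetric])
  then show ?thesis
    by (rule has_field_derivative_transform_within_open[where S = "{a<..<b}"]) (use ab eq in auto)
qed

lemma smooth_on_fst: "open X \<Longrightarrow> smooth_on X f \<Longrightarrow> smooth_on X (\<lambda>z. fst (f z))"
  and smooth_on_snd: "open X \<Longrightarrow> smooth_on X f \<Longrightarrow> smooth_on X (\<lambda>z. snd (f z))"
  for f :: "'a::euclidean_space \<Rightarrow> 'b::euclidean_space \<times> 'c::euclidean_space"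
  by (rule smooth_on_bounded_linear[OF _ bounded_linear_fst], assumption+)
     (rule smooth_on_bounded_linear[OF _ bounded_linear_snd], assumption+)

lemma smooth_on_ident: "open X \<Longrightarrow> smooth_on X (\<lambda>z. z)"
  by (rule smooth_on_linear[OF _ bounded_linear_ident])

lemma smooth_on_Pair:
  fixes f :: "'a::euclidean_space \<Rightarrow> 'b::euclidean_space" and h :: "'a \<Rightarrow> 'c::euclidean_space"
  assumes "open X" "smooth_on X f" "smooth_on X h"
  shows "smooth_on X (\<lambda>z. (f z, h z))"
proof -
  have "smooth_on X (\<lambda>z. (f z, 0) + (0, h z))"
    by (intro smooth_on_add smooth_on_bounded_linear[OF _ bounded_linear_Pair[OF bounded_linear_ident bounded_linear_zero]]
        smooth_on_bounded_linear[OF _ bounded_linear_Pair[OF bounded_linear_zero bounded_linear_ident]] assms)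
  then show ?thesis by simp
qed

text \<open>If the brackets are the values of one polynomial of degree below n at the nodes, then by
  \<open>interp_coeff_poly\<close> the sum is its coefficient at degree n - 1, a constant. Each
  bracket involves \<open>v $ b\<close> and \<open>s $ b\<close> only, so it becomes a separate
  equation for one variable.\<close>

lemma HJ_separable_staeckel:
  fixes h :: "real^'n::finite \<Rightarrow> real^'n \<Rightarrow> real"
  assumes inj: "\<And>v. v \<in> X \<Longrightarrow> inj (($) v)"
    and loc: "\<And>v0. v0 \<in> X \<Longrightarrow> \<exists>\<rho>>0. \<exists>f \<psi> E. ball v0 \<rho> \<subseteq> X \<and>
      (\<forall>b. smooth_on {v0 $ b - \<rho><..<v0 $ b + \<rho>} (f b) \<and> smooth_on {v0 $ b - \<rho><..<v0 $ b + \<rho>} (\<psi> b) \<and>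
        (\<forall>c\<in>{v0 $ b - \<rho><..<v0 $ b + \<rho>}. f b c \<noteq> 0)) \<and>
      (\<forall>v\<in>ball v0 \<rho>. \<forall>s. h v s = (\<Sum>b\<in>UNIV. interp_coeff CARD('n) b v *
        ((1/2) * (s $ b)\<^sup>2 * f b (v $ b) + \<psi> b (v $ b) - E * (- v $ b) ^ CARD('n))))"
  shows "HJ_separable X h"
  unfolding HJ_separable_def
proof
  fix v0 assume v0: "v0 \<in> X"
  obtain \<rho> f \<psi> E where \<rho>: "\<rho> > 0" "ball v0 \<rho> \<subseteq> X"
    and f\<psi>: "\<forall>b. smooth_on {v0 $ b - \<rho><..<v0 $ b + \<rho>} (f b) \<and> smooth_on {v0 $ b - \<rho><..<v0 $ b + \<rho>} (\<psi> b) \<and>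
        (\<forall>c\<in>{v0 $ b - \<rho><..<v0 $ b + \<rho>}. f b c \<noteq> 0)"
    and h': "\<forall>v\<in>ball v0 \<rho>. \<forall>s. h v s = (\<Sum>b\<in>UNIV. interp_coeff CARD('n) b v *
        ((1/2) * (s $ b)\<^sup>2 * f b (v $ b) + \<psi> b (v $ b) - E * (- v $ b) ^ CARD('n)))"
    using loc[OF v0] by blast
  have f: "smooth_on {v0 $ b - \<rho><..<v0 $ b + \<rho>} (f b)"
    and \<psi>: "smooth_on {v0 $ b - \<rho><..<v0 $ b + \<rho>} (\<psi> b)" for b
    using f\<psi> by blast+
  have f_nz: "f b c \<noteq> 0" if "c \<in> {v0 $ b - \<rho><..<v0 $ b + \<rho>}" for b c
    using f\<psi> that by blast
  have h: "h v s = (\<Sum>b\<in>UNIV. interp_coeff CARD('n) b v *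
        ((1/2) * (s $ b)\<^sup>2 * f b (v $ b) + \<psi> b (v $ b) - E * (- v $ b) ^ CARD('n)))"
    if "v \<in> ball v0 \<rho>" for v s
    using h' that by blast
  define I where "I = (\<lambda>b. {v0 $ b - \<rho><..<v0 $ b + \<rho>})"
  \<comment> \<open>The parameters are coordinates in the node basis at \<open>v0\<close> instead of
    coefficients, so the value at each node of \<open>v0\<close> can be adjusted separately.
    \<open>arg\<close> then solves the bracket equation for the squared momentum.\<close>
  define Q where "Q = (\<lambda>\<beta>::real^'n. \<Sum>b\<in>UNIV. smult (\<beta> $ b) (node_poly v0 b))"
  define arg where "arg = (\<lambda>b (x, \<beta>). 2 * (poly (Q \<beta>) (- x) + E * (- x) ^ CARD('n) - \<psi> b x) / f b x)"
  define Y where "Y = (\<lambda>b. {z \<in> I b \<times> UNIV. arg b z > 0})"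
  define G where "G = (\<lambda>b z. sqrt (arg b z))"
  have poly_Q: "poly (Q \<beta>) c = (\<Sum>b\<in>UNIV. \<beta> $ b * poly (node_poly v0 b) c)" for \<beta> c
    by (simp add: Q_def poly_sum)
  have open_I: "open (I b \<times> (UNIV :: (real^'n) set))" for b by (simp add: I_def open_Times)
  have smooth_arg: "smooth_on (I b \<times> UNIV) (arg b)" for b
  proof -
    have fst: "smooth_on (I b \<times> (UNIV :: (real^'n) set)) fst"
      using smooth_on_fst[OF open_I smooth_on_ident[OF open_I]] by simp
    have snd: "smooth_on (I b \<times> (UNIV :: (real^'n) set)) (\<lambda>z. snd z $ a)" for a
      using smooth_on_vec_nth[OF open_I smooth_on_snd[OF open_I smooth_on_ident[OF open_I]]] by simp
    have f': "smooth_on (I b \<times> (UNIV :: (real^'n) set)) (\<lambda>z. f b (fst z))"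
      by (rule smooth_on_compose[OF open_I _ f fst]) (simp_all add: I_def mem_Times_iff)
    have \<psi>': "smooth_on (I b \<times> (UNIV :: (real^'n) set)) (\<lambda>z. \<psi> b (fst z))"
      by (rule smooth_on_compose[OF open_I _ \<psi> fst]) (simp_all add: I_def mem_Times_iff)
    have neg: "smooth_on (I b \<times> (UNIV :: (real^'n) set)) (\<lambda>z. - fst z)"
      by (rule smooth_on_uminus[OF open_I fst])
    have "smooth_on (I b \<times> UNIV) (\<lambda>z. 2 * ((\<Sum>a\<in>UNIV. snd z $ a * (\<Prod>d\<in>UNIV - {a}. v0 $ d + - fst z))
        + E * (- fst z) ^ CARD('n) - \<psi> b (fst z)) / f b (fst z))"
      by (intro smooth_on_divide smooth_on_mult smooth_on_diff smooth_on_add smooth_on_sum smooth_on_prod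
          smooth_on_power smooth_on_const open_I snd neg f' \<psi>') (use f_nz in \<open>auto simp: I_def\<close>)
    then show ?thesis
      by (rule smooth_on_cong[OF open_I, rotated]) (auto simp: arg_def poly_Q poly_node_poly)
  qed
  have open_Y: "open (Y b)" for b
  proof -
    have "Y b = arg b -` {0<..} \<inter> (I b \<times> UNIV)" by (auto simp: Y_def)
    then show ?thesis
      using continuous_on_open_vimage[OF open_I] smooth_on_continuous_on[OF smooth_arg]
      by (metis open_greaterThan)
  qed
  have smooth_G: "smooth_on (Y b) (G b)" for b
    unfolding G_def
    by (rule smooth_on_compose[OF open_Y _ smooth_on_sqrt smooth_on_subset[OF smooth_arg]]) (auto simp: Y_def)
  \<comment> \<open>chosen such that all radicands are 1 at \<open>v0\<close>, whatever the signs of the \<open>f b\<close>\<close>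
  define \<alpha>0 where "\<alpha>0 = (\<chi> b. (\<psi> b (v0 $ b) - E * (- v0 $ b) ^ CARD('n) + f b (v0 $ b) / 2)
      / poly (node_poly v0 b) (- v0 $ b))"
  have v0_I: "v0 $ b \<in> I b" for b using \<rho>(1) by (simp add: I_def)
  have "(v0 $ b, \<alpha>0) \<in> Y b" for b
  proof -
    have "poly (Q \<alpha>0) (- v0 $ b) = (\<Sum>a\<in>UNIV. if a = b then \<alpha>0 $ b * poly (node_poly v0 b) (- v0 $ b) else 0)"
      unfolding poly_Q by (rule sum.cong) (auto simp: node_poly_other)
    also have "\<dots> = \<psi> b (v0 $ b) - E * (- v0 $ b) ^ CARD('n) + f b (v0 $ b) / 2"
      using node_poly_self[OF inj[OF v0]] by (simp add: \<alpha>0_def)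
    finally have "arg b (v0 $ b, \<alpha>0) = 1"
      using f_nz[of "v0 $ b" b] \<rho>(1) by (simp add: arg_def)
    then show ?thesis using v0_I by (simp add: Y_def)
  qed
  then have "\<exists>e>0. \<forall>b. ball (v0 $ b) e \<times> ball \<alpha>0 e \<subseteq> Y b"
  proof -
    have "\<exists>e>0. ball (v0 $ b) e \<times> ball \<alpha>0 e \<subseteq> Y b" for b
    proof -
      obtain A' B' where AB: "open A'" "open B'" "(v0 $ b, \<alpha>0) \<in> A' \<times> B'" "A' \<times> B' \<subseteq> Y b"
        using open_Y \<open>(v0 $ b, \<alpha>0) \<in> Y b\<close> by (rule open_prod_elim)
      obtain e1 e2 where "e1 > 0" "ball (v0 $ b) e1 \<subseteq> A'" "e2 > 0" "ball \<alpha>0 e2 \<subseteq> B'"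
        using AB openE by (metis mem_Times_iff fst_conv snd_conv)
      then show ?thesis using AB(4) by (intro exI[of _ "min e1 e2"]) fastforce
    qed
    then obtain e where e: "\<And>b. e b > 0" "\<And>b. ball (v0 $ b) (e b) \<times> ball \<alpha>0 (e b) \<subseteq> Y b" by metis
    have "Min (range e) > 0" "\<And>b. Min (range e) \<le> e b" using e(1) by auto
    then show ?thesis using e(2) by (intro exI[of _ "Min (range e)"]) fastforce
  qed
  then obtain e where e: "e > 0" "\<And>b. ball (v0 $ b) e \<times> ball \<alpha>0 e \<subseteq> Y b" by blast
  obtain l r where lr: "v0 \<in> box l r" "box l r \<subseteq> ball v0 (min e \<rho>)"
    using rational_boxes[of "min e \<rho>" v0] e(1) \<rho>(1) by auto
  define B where "B = box l r"
  define P where "P = ball \<alpha>0 e"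
  define S where "S = (\<lambda>a x \<beta>. (x - v0 $ a) * integral {0..1} (\<lambda>s. G a (v0 $ a + s * (x - v0 $ a), \<beta>)))"
  have B: "v \<in> ball v0 \<rho>" "v $ a \<in> ball (v0 $ a) e" "v $ a \<in> I a" if "v \<in> B" for v a
  proof -
    have v: "dist v0 v < min e \<rho>" using that lr(2) by (auto simp: B_def)
    then show "v \<in> ball v0 \<rho>" by simp
    have "\<bar>(v0 - v) $ a\<bar> < min e \<rho>"
      using component_le_norm_cart[of "v0 - v" a] v by (simp add: dist_norm)
    then show "v $ a \<in> ball (v0 $ a) e" "v $ a \<in> I a" by (auto simp: I_def dist_real_def)
  qed
  have in_Y: "(x, \<beta>) \<in> Y a" if "x \<in> ball (v0 $ a) e" "\<beta> \<in> P" for x \<beta> a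
    using e(2)[of a] that unfolding P_def by blast
  have open_Z: "open (B \<times> P)" by (simp add: B_def P_def open_Times open_box)
  have "smooth_on (B \<times> P) (\<lambda>z. \<Sum>a\<in>UNIV. S a (fst z $ a) (snd z))"
  proof (rule smooth_on_sum[OF open_Z])
    fix a
    \<comment> \<open>The path from \<open>v0 $ a\<close> to \<open>v $ a\<close> together with the
      parameters, with the integration variable first as in
      \<open>smooth_on_integral\<close>.\<close>
    define \<kappa> where "\<kappa> = (\<lambda>z::real \<times> (real^'n) \<times> (real^'n). (v0 $ a + fst z * (fst (snd z) $ a + - v0 $ a), snd (snd z)))"
    have smooth_\<kappa>: "smooth_on UNIV \<kappa>"
      unfolding \<kappa>_def
      by (intro smooth_on_Pair smooth_on_add smooth_on_mult smooth_on_const smooth_on_vec_nth smooth_on_fst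
          smooth_on_snd smooth_on_ident open_UNIV)
    have open_X: "open (\<kappa> -` Y a)"
      using open_vimage[OF open_Y smooth_on_continuous_on[OF smooth_\<kappa>]] .
    have "smooth_on (\<kappa> -` Y a) (\<lambda>z. G a (\<kappa> z))"
      by (rule smooth_on_compose[OF open_X open_Y smooth_G smooth_on_subset[OF smooth_\<kappa>]]) auto
    moreover have "{0..1} \<times> (B \<times> P) \<subseteq> \<kappa> -` Y a"
    proof clarify
      fix s :: real and v \<beta> assume s: "s \<in> {0..1}" and v: "v \<in> B" and \<beta>: "\<beta> \<in> P"
      have "\<bar>s * (v $ a - v0 $ a)\<bar> \<le> \<bar>v $ a - v0 $ a\<bar>"
        using s by (simp add: abs_mult mult_left_le_one_le)
      then have "v0 $ a + s * (v $ a - v0 $ a) \<in> ball (v0 $ a) e"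
        using B(2)[OF v, of a] by (simp add: dist_real_def)
      then show "(s, v, \<beta>) \<in> \<kappa> -` Y a" using in_Y[OF _ \<beta>] by (simp add: \<kappa>_def)
    qed
    ultimately have "smooth_on (B \<times> P) (\<lambda>z. integral {0..1} (\<lambda>s. G a (\<kappa> (s, z))))"
      by (rule smooth_on_integral[OF open_X _ open_Z])
    then have "smooth_on (B \<times> P) (\<lambda>z. (fst z $ a + - v0 $ a) * integral {0..1} (\<lambda>s. G a (\<kappa> (s, z))))"
      by (intro smooth_on_mult smooth_on_add smooth_on_const smooth_on_vec_nth smooth_on_fst smooth_on_ident open_Z)
    then show "smooth_on (B \<times> P) (\<lambda>z. S a (fst z $ a) (snd z))"
      by (simp add: S_def \<kappa>_def)
  qed
  then have smooth: "smooth_on (B \<times> P) (\<lambda>(v, \<beta>). \<Sum>a\<in>UNIV. S a (v $ a) \<beta>)"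
    by (simp only: case_prod_beta')
  have pd_S: "pd a (\<lambda>w. \<Sum>a\<in>UNIV. S a (w $ a) \<beta>) v = G a (v $ a, \<beta>)" if v: "v \<in> B" and \<beta>: "\<beta> \<in> P" for v \<beta> a
  proof -
    have "((\<lambda>x. S a x \<beta>) has_real_derivative G a (v $ a, \<beta>)) (at (v $ a))" for a
      unfolding S_def
    proof (rule has_derivative_primitive)
      show "continuous_on {v0 $ a - e<..<v0 $ a + e} (\<lambda>x. G a (x, \<beta>))"
        by (rule continuous_on_compose2[OF smooth_on_continuous_on[OF smooth_G[of a]]])
           (use in_Y[OF _ \<beta>] in \<open>auto intro!: continuous_intros simp: dist_real_def\<close>)
      show "v0 $ a \<in> {v0 $ a - e<..<v0 $ a + e}" "v $ a \<in> {v0 $ a - e<..<v0 $ a + e}"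
        using e(1) B(2)[OF v, of a] by (auto simp: dist_real_def)
    qed
    then have "((\<lambda>w. S a (w $ a) \<beta>) has_derivative (\<lambda>d. G a (v $ a, \<beta>) * d $ a)) (at v)" for a
      using has_derivative_compose[OF bounded_linear_imp_has_derivative[OF bounded_linear_vec_nth]]
      unfolding has_field_derivative_def by blast
    then have "((\<lambda>w. \<Sum>a\<in>UNIV. S a (w $ a) \<beta>) has_derivative (\<lambda>d. \<Sum>a\<in>UNIV. G a (v $ a, \<beta>) * d $ a)) (at v)"
      by (intro has_derivative_sum)
    from fun_cong[OF frechet_derivative_at[OF this, symmetric], of "axis a 1"] show ?thesis
      by (simp add: pd_def axis_def if_distrib[of "(*) _"] cong: if_cong)
  qed
  have HJ: "h v (df (\<lambda>w. \<Sum>a\<in>UNIV. S a (w $ a) \<beta>) v) = coeff (Q \<beta>) (CARD('n) - 1)"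
    if v: "v \<in> B" and \<beta>: "\<beta> \<in> P" for v \<beta>
  proof -
    have "(1/2) * (G b (v $ b, \<beta>))\<^sup>2 * f b (v $ b) + \<psi> b (v $ b) - E * (- v $ b) ^ CARD('n) = poly (Q \<beta>) (- v $ b)" for b
    proof -
      have "arg b (v $ b, \<beta>) > 0" using in_Y[OF B(2)[OF v] \<beta>, of b] by (simp add: Y_def)
      then have "(G b (v $ b, \<beta>))\<^sup>2 = arg b (v $ b, \<beta>)" by (simp add: G_def)
      moreover have "f b (v $ b) \<noteq> 0" using B(3)[OF v, of b] f_nz unfolding I_def by blast
      ultimately show ?thesis by (simp add: arg_def field_simps)
    qed
    moreover have "degree (Q \<beta>) < CARD('n)" unfolding Q_def by (rule degree_sum_node_poly)
    moreover have "inj (($) v)" using inj B(1)[OF v] \<rho>(2) by blast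
    ultimately show ?thesis
      unfolding h[OF B(1)[OF v]] by (simp add: df_def pd_S[OF v \<beta>] interp_coeff_poly del: One_nat_def)
  qed
  \<comment> \<open>Up to nonzero row factors the entries are
    \<open>poly (node_poly v0 b) (- v $ a)\<close>. A kernel vector \<open>z\<close> makes
    \<open>Q z\<close> vanish at the n nodes of \<open>v\<close>, hence identically, and evaluation
    at the nodes of \<open>v0\<close> gives \<open>z = 0\<close>.\<close>
  have dets: "det (\<chi> a b. pd b (\<lambda>\<beta>. pd a (\<lambda>w. \<Sum>a\<in>UNIV. S a (w $ a) \<beta>) v) \<alpha>) \<noteq> 0"
    if v: "v \<in> B" and \<alpha>: "\<alpha> \<in> P" for v \<alpha>
  proof -
    define k where "k = (\<lambda>a. inverse (f a (v $ a) * G a (v $ a, \<alpha>)))"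
    have pos: "arg a (v $ a, \<alpha>) > 0" and nz: "f a (v $ a) \<noteq> 0" for a
      using in_Y[OF B(2)[OF v] \<alpha>, of a] B(3)[OF v, of a] f_nz unfolding Y_def I_def by blast+
    have pd2: "pd b (\<lambda>\<beta>. pd a (\<lambda>w. \<Sum>a\<in>UNIV. S a (w $ a) \<beta>) v) \<alpha> = k a * poly (node_poly v0 b) (- v $ a)" for a b
    proof -
      let ?x = "v $ a"
      have "((\<lambda>\<beta>. poly (Q \<beta>) (- ?x)) has_derivative (\<lambda>d. poly (Q d) (- ?x))) (at \<alpha>)"
        unfolding poly_Q
        by (intro has_derivative_sum has_derivative_mult_left bounded_linear_imp_has_derivative bounded_linear_vec_nth)
      then have "((\<lambda>\<beta>. arg a (?x, \<beta>)) has_derivative (\<lambda>d. 2 * poly (Q d) (- ?x) / f a ?x)) (at \<alpha>)"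
        unfolding arg_def case_prod_conv by (auto intro!: derivative_eq_intros simp: nz)
      then have "((\<lambda>\<beta>. sqrt (arg a (?x, \<beta>))) has_derivative
          (\<lambda>d. inverse (sqrt (arg a (?x, \<alpha>))) / 2 * (2 * poly (Q d) (- ?x) / f a ?x))) (at \<alpha>)"
        by (rule has_derivative_compose) (rule DERIV_real_sqrt[OF pos[of a], unfolded has_field_derivative_def])
      moreover have "inverse (sqrt (arg a (?x, \<alpha>))) / 2 * (2 * c / f a ?x) = k a * c" for c
        by (simp add: k_def G_def divide_inverse[of _ "f a (v $ a)"] mult_ac)
      ultimately have "((\<lambda>\<beta>. G a (?x, \<beta>)) has_derivative (\<lambda>d. k a * poly (Q d) (- ?x))) (at \<alpha>)"
        by (simp only: G_def)
      then have "((\<lambda>\<beta>. pd a (\<lambda>w. \<Sum>a\<in>UNIV. S a (w $ a) \<beta>) v) has_derivative (\<lambda>d. k a * poly (Q d) (- ?x))) (at \<alpha>)"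
        by (rule has_derivative_transform_within_open[where s = P]) (use \<alpha> pd_S[OF v] in \<open>auto simp: P_def\<close>)
      from fun_cong[OF frechet_derivative_at[OF this, symmetric], of "axis b 1"] show ?thesis
        by (simp add: pd_def poly_Q axis_def if_distrib[of "\<lambda>x. x * _"] cong: if_cong)
    qed
    let ?M = "(\<chi> a b. k a * poly (node_poly v0 b) (- v $ a)) :: real^'n^'n"
    have k: "k a \<noteq> 0" for a using pos[of a] nz[of a] by (simp add: k_def G_def)
    have "z = 0" if z: "?M *v z = 0" for z
    proof -
      have "k a * poly (Q z) (- v $ a) = 0" for a
        using arg_cong[OF z, of "\<lambda>x. x $ a"]
        by (simp add: matrix_vector_mult_def poly_Q sum_distrib_left mult_ac)
      then have "poly (Q z) (- v $ a) = 0" for a using k by simp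
      then have "Q z = 0"
        by (intro poly_eq_nodes[of v]) (use inj B(1)[OF v] \<rho>(2) degree_sum_node_poly in \<open>auto simp: Q_def\<close>)
      have "z $ b = 0" for b
      proof -
        have "poly (Q z) (- v0 $ b) = (\<Sum>a\<in>UNIV. if a = b then z $ b * poly (node_poly v0 b) (- v0 $ b) else 0)"
          unfolding poly_Q by (rule sum.cong) (auto simp: node_poly_other)
        then show ?thesis using \<open>Q z = 0\<close> node_poly_self[OF inj[OF v0], of b] by simp
      qed
      then show ?thesis by (simp add: vec_eq_iff)
    qed
    then have "det ?M \<noteq> 0"
      using matrix_left_invertible_ker invertible_left_inverse invertible_det_nz by blast
    then show ?thesis unfolding pd2 .
  qed
  have "complete_solution B P h (\<lambda>v \<alpha>. \<Sum>a\<in>UNIV. S a (v $ a) \<alpha>)"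
    unfolding complete_solution_def using smooth HJ dets by blast
  moreover have "v0 \<in> B" "B \<subseteq> X" using lr(1) B(1) \<rho>(2) by (auto simp: B_def)
  moreover have "open P" "P \<noteq> {}" using e(1) by (auto simp: P_def)
  ultimately show "\<exists>B P S. (\<exists>l r. B = box l r) \<and> v0 \<in> B \<and> B \<subseteq> X \<and> open P \<and> P \<noteq> {} \<and>
      complete_solution B P h (\<lambda>v \<alpha>. \<Sum>a\<in>UNIV. S a (v $ a) \<alpha>)"
    unfolding B_def by blast
qed

section \<open>The quadratic integrals in the coordinates (u, s)\<close>

context driven_motion
begin

abbreviation "H i t x s \<equiv> quadratic_integral g (A i) (W i) (join (y t) x)
  (join (p t) (driven_momentum J u (pt t) (join (y t) x) s))"

lemma integral_interpolation:
  assumes t: "t \<in> T" and q: "join (y t) x \<in> U" and i: "i \<in> {1..CARD('n)}"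
  shows "H i t x s = (\<Sum>b\<in>UNIV. interp_coeff i b (\<theta> t x) *
    ((1/2) * (s $ b)\<^sup>2 * \<Phi> b (join (y t) x) + \<phi> b (join (y t) x)
      - energy t x * (- \<theta> t x $ b) ^ CARD('n)))"
proof -
  have P: "join (p t) (driven_momentum J u (pt t) (join (y t) x) s) = momentum (join (y t) x) (\<eta> t) s"
    using momentum_eq[OF q, of "pt t" s] pt t by (simp add: \<eta>_def)
  have "H (CARD('n) + 1) t x s = energy t x"
    unfolding P integral_top[OF q P2_\<eta>] energy_def ..
  moreover have "(\<Sum>i=1..CARD('n) + 1. (- \<theta> t x $ b) ^ (i - 1) * H i t x s)
    = (1/2) * (s $ b)\<^sup>2 * \<Phi> b (join (y t) x) + \<phi> b (join (y t) x)" for b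
    unfolding P by (rule sum_integrals_root[OF q P2_\<eta>])
  from interp_coeff_sum[OF distinct_roots[OF q] i this] have
    "H i t x s = (\<Sum>b\<in>UNIV. interp_coeff i b (\<theta> t x) *
      ((1/2) * (s $ b)\<^sup>2 * \<Phi> b (join (y t) x) + \<phi> b (join (y t) x)
        - H (CARD('n) + 1) t x s * (- \<theta> t x $ b) ^ CARD('n)))" .
  ultimately show ?thesis by (simp only:)
qed

lemma integrals_separable:
  assumes N: "moving_chart T U u y N"
  shows "\<exists>h :: nat \<Rightarrow> real^'n \<Rightarrow> real^'n \<Rightarrow> real.
    (\<forall>i\<in>{1..CARD('n)}. \<forall>(t, x)\<in>N. \<forall>s. H i t x s = h i (\<theta> t x) s) \<and>
    HJ_separable ((\<lambda>(t, x). \<theta> t x) ` N) (h CARD('n)) \<and>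
    orthogonal_on ((\<lambda>(t, x). \<theta> t x) ` N) (h CARD('n))"
proof -
  have NU: "t \<in> T" "join (y t) x \<in> U" if "(t, x) \<in> N" for t x
    using N that by (auto simp: moving_chart_def)
  let ?X = "(\<lambda>(t, x). \<theta> t x) ` N"
  \<comment> \<open>An arbitrary point of the fibre over \<open>v\<close>. Constancy of
    \<open>\<Phi> b\<close>, \<open>\<phi> b\<close> and \<open>energy\<close> on fibres makes the
    integrals independent of the choice.\<close>
  define sel where "sel = (\<lambda>v. SOME z. z \<in> N \<and> \<theta> (fst z) (snd z) = v)"
  have sel: "(fst (sel v), snd (sel v)) \<in> N" "\<theta> (fst (sel v)) (snd (sel v)) = v" if "v \<in> ?X" for v
  proof -
    have "\<exists>z. z \<in> N \<and> \<theta> (fst z) (snd z) = v" using that by force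
    from someI_ex[OF this] show "(fst (sel v), snd (sel v)) \<in> N" "\<theta> (fst (sel v)) (snd (sel v)) = v"
      unfolding sel_def by simp_all
  qed
  define h where "h = (\<lambda>i v s. H i (fst (sel v)) (snd (sel v)) s)"
  have h_sel: "h i v s = (\<Sum>b\<in>UNIV. interp_coeff i b v *
      ((1/2) * (s $ b)\<^sup>2 * \<Phi> b (join (y (fst (sel v))) (snd (sel v))) + \<phi> b (join (y (fst (sel v))) (snd (sel v)))
        - energy (fst (sel v)) (snd (sel v)) * (- v $ b) ^ CARD('n)))"
    if "v \<in> ?X" "i \<in> {1..CARD('n)}" for i v s
    using integral_interpolation[OF NU[OF sel(1)[OF that(1)]] that(2), of s]
    unfolding sel(2)[OF that(1)] h_def .
  have h_N: "h i (\<theta> t x) s = (\<Sum>b\<in>UNIV. interp_coeff i b (\<theta> t x) *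
      ((1/2) * (s $ b)\<^sup>2 * \<Phi> b (join (y t) x) + \<phi> b (join (y t) x) - energy t x * (- \<theta> t x $ b) ^ CARD('n)))"
    if tx: "(t, x) \<in> N" and i: "i \<in> {1..CARD('n)}" for i t x s
  proof -
    have X: "\<theta> t x \<in> ?X" using tx by force
    note same = sel(1)[OF X] tx sel(2)[OF X]
    have "\<Phi> b (join (y (fst (sel (\<theta> t x)))) (snd (sel (\<theta> t x)))) = \<Phi> b (join (y t) x)" for b
      by (rule root_function_fibre_constant[OF N smooth_\<Phi> dd_\<Phi>_kernel same])
    moreover have "\<phi> b (join (y (fst (sel (\<theta> t x)))) (snd (sel (\<theta> t x)))) = \<phi> b (join (y t) x)" for b
      by (rule root_function_fibre_constant[OF N smooth_\<phi> dd_\<phi>_kernel same])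
    moreover have "energy (fst (sel (\<theta> t x))) (snd (sel (\<theta> t x))) = energy t x"
      by (rule energy_fibre_constant[OF N same])
    ultimately show ?thesis using h_sel[OF X i, of s] by (simp only:)
  qed
  have n: "CARD('n) \<in> {1..CARD('n)}" using zero_less_card_finite[where 'a = 'n] by simp
  have "H i t x s = h i (\<theta> t x) s" if "i \<in> {1..CARD('n)}" "(t, x) \<in> N" for i t x s
    using h_N[OF that(2,1)] integral_interpolation[OF NU[OF that(2)] that(1)] by simp
  moreover have "HJ_separable ?X (h CARD('n))"
  proof (rule HJ_separable_staeckel)
    fix v assume "v \<in> ?X"
    then show "inj (($) v)" using NU distinct_roots by force
  next
    fix v0 assume "v0 \<in> ?X"
    then obtain t0 x0 where tx: "(t0, x0) \<in> N" and v0: "v0 = \<theta> t0 x0" by auto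
    obtain \<rho> f \<psi> where \<rho>: "\<rho> > 0"
      and f: "\<And>b. smooth_on {v0 $ b - \<rho><..<v0 $ b + \<rho>} (f b)"
      and \<psi>: "\<And>b. smooth_on {v0 $ b - \<rho><..<v0 $ b + \<rho>} (\<psi> b)"
      and f_nz: "\<And>b c. c \<in> {v0 $ b - \<rho><..<v0 $ b + \<rho>} \<Longrightarrow> f b c \<noteq> 0"
      and ex: "\<And>v. v \<in> ball v0 \<rho> \<Longrightarrow> \<exists>x. (t0, x) \<in> N \<and> \<theta> t0 x = v \<and> energy t0 x = energy t0 x0 \<and>
       (\<forall>b. \<Phi> b (join (y t0) x) = f b (v $ b) \<and> \<phi> b (join (y t0) x) = \<psi> b (v $ b))"
      by (rule local_normal_form[OF N tx, folded v0]) (rule that)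
    have main: "v \<in> ?X \<and> (\<forall>s. h CARD('n) v s = (\<Sum>b\<in>UNIV. interp_coeff CARD('n) b v *
        ((1/2) * (s $ b)\<^sup>2 * f b (v $ b) + \<psi> b (v $ b) - energy t0 x0 * (- v $ b) ^ CARD('n))))"
      if v: "v \<in> ball v0 \<rho>" for v
    proof -
      obtain x where x: "(t0, x) \<in> N" "\<theta> t0 x = v" "energy t0 x = energy t0 x0"
        "\<And>b. \<Phi> b (join (y t0) x) = f b (v $ b)" "\<And>b. \<phi> b (join (y t0) x) = \<psi> b (v $ b)"
        using ex[OF v] by blast
      have "v \<in> ?X" using x(1,2) by force
      then show ?thesis using h_N[OF x(1) n] by (simp only: x(2-5)) simp
    qed
    have sub: "ball v0 \<rho> \<subseteq> ?X" using main by blast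
    have form: "\<forall>v\<in>ball v0 \<rho>. \<forall>s. h CARD('n) v s = (\<Sum>b\<in>UNIV. interp_coeff CARD('n) b v *
        ((1/2) * (s $ b)\<^sup>2 * f b (v $ b) + \<psi> b (v $ b) - energy t0 x0 * (- v $ b) ^ CARD('n)))"
      using main by blast
    have smooth: "\<forall>b. smooth_on {v0 $ b - \<rho><..<v0 $ b + \<rho>} (f b) \<and> smooth_on {v0 $ b - \<rho><..<v0 $ b + \<rho>} (\<psi> b) \<and>
        (\<forall>c\<in>{v0 $ b - \<rho><..<v0 $ b + \<rho>}. f b c \<noteq> 0)"
      using f \<psi> f_nz by blast
    show "\<exists>\<rho>>0. \<exists>f \<psi> E. ball v0 \<rho> \<subseteq> ?X \<and>
      (\<forall>b. smooth_on {v0 $ b - \<rho><..<v0 $ b + \<rho>} (f b) \<and> smooth_on {v0 $ b - \<rho><..<v0 $ b + \<rho>} (\<psi> b) \<and>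
        (\<forall>c\<in>{v0 $ b - \<rho><..<v0 $ b + \<rho>}. f b c \<noteq> 0)) \<and>
      (\<forall>v\<in>ball v0 \<rho>. \<forall>s. h CARD('n) v s = (\<Sum>b\<in>UNIV. interp_coeff CARD('n) b v *
        ((1/2) * (s $ b)\<^sup>2 * f b (v $ b) + \<psi> b (v $ b) - E * (- v $ b) ^ CARD('n))))"
      by (rule exI[of _ \<rho>], rule conjI[OF \<rho>], rule exI[of _ f], rule exI[of _ \<psi>],
          rule exI[of _ "energy t0 x0"]) (intro conjI sub smooth form)
  qed
  moreover have "orthogonal_on ?X (h CARD('n))"
    unfolding orthogonal_on_def
  proof (intro exI ballI allI)
    fix v s assume v: "v \<in> ?X"
    let ?q = "\<lambda>v. join (y (fst (sel v))) (snd (sel v))"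
    show "h CARD('n) v s = (\<Sum>a\<in>UNIV. (interp_coeff CARD('n) a v * (\<Phi> a (?q v) / 2)) * (s $ a)\<^sup>2)
        + (\<Sum>a\<in>UNIV. 0 * s $ a)
        + (\<Sum>a\<in>UNIV. interp_coeff CARD('n) a v * (\<phi> a (?q v) - energy (fst (sel v)) (snd (sel v)) * (- v $ a) ^ CARD('n)))"
      unfolding h_sel[OF v n] by (simp add: sum.distrib[symmetric] algebra_simps)
  qed
  ultimately show ?thesis by (intro exI[of _ h]) blast
qed

end

theorem mainTheorem7:
  fixes U :: "(real^('m::finite + 'n::finite)) set"
    and g J :: "real^('m + 'n) \<Rightarrow> real^('m + 'n)^('m + 'n)"
    and \<mu> :: "real^('m + 'n) \<Rightarrow> real^('m + 'n)"
    and V :: "real^('m + 'n) \<Rightarrow> real"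
    and g1 J1 :: "real^'m \<Rightarrow> real^'m^'m"
    and g2 :: "real^'n \<Rightarrow> real^'n^'n"
    and Q1 :: "real^'m \<Rightarrow> real^'m"
    and u :: "real^('m + 'n) \<Rightarrow> real^'n"
    and A :: "nat \<Rightarrow> real^('m + 'n) \<Rightarrow> real^('m + 'n)^('m + 'n)"
    and W :: "nat \<Rightarrow> real^('m + 'n) \<Rightarrow> real"
    and T :: "real set"
    and y p pt :: "real \<Rightarrow> real^'m"
  assumes driven: "driven_cofactor_system U g \<mu> J g1 g2 Q1 V"
    and J1: "\<forall>q\<in>U. \<forall>i j. J q $ Inl i $ Inl j = J1 (ypart q) $ i $ j"
    and J1_nonsing: "\<forall>q\<in>U. det (J1 (ypart q)) \<noteq> 0"
    and u_smooth: "smooth_on U u"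
    and u_roots: "\<forall>q\<in>U. \<forall>a. det (J q - u q $ a *\<^sub>R P2) = 0"
    and u_indep: "\<forall>q\<in>U. det ((\<chi> a b. pd (Inr b) (\<lambda>z. u z $ a) q) :: real^'n^'n) \<noteq> 0"
    and A: "\<forall>q\<in>U. \<forall>c. cof (J q + c *\<^sub>R P2) = (\<Sum>i=1..CARD('n) + 1. c ^ (i - 1) *\<^sub>R A i q)"
    and W: "\<forall>i\<in>{1..CARD('n) + 1}. smooth_on U (W i) \<and> (\<forall>q\<in>U. \<mu> q v* A i q = - df (W i) q)"
    and T: "open T" "is_interval T"
    and driving: "lagrange_solution T (ypart ` U) g1 Q1 y p"
    and pt: "\<forall>t\<in>T. p t = pt t v* J1 (y t)"
  shows "(\<forall>t\<in>T. \<forall>x. join (y t) x \<in> U \<longrightarrow> (\<exists>N. moving_chart T U u y N \<and> (t, x) \<in> N)) \<and>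
    (\<forall>N. moving_chart T U u y N \<longrightarrow>
      (\<exists>h :: nat \<Rightarrow> real^'n \<Rightarrow> real^'n \<Rightarrow> real.
        (\<forall>i\<in>{1..CARD('n)}. \<forall>(t, x)\<in>N. \<forall>s.
           quadratic_integral g (A i) (W i) (join (y t) x)
             (join (p t) (driven_momentum J u (pt t) (join (y t) x) s))
           = h i (u (join (y t) x)) s) \<and>
        HJ_separable ((\<lambda>(t, x). u (join (y t) x)) ` N) (h CARD('n)) \<and>
        orthogonal_on ((\<lambda>(t, x). u (join (y t) x)) ` N) (h CARD('n))))"
proof -
  interpret driven_motion U g J \<mu> V g1 J1 g2 Q1 u A W T y p pt
    by unfold_locales fact+
  show ?thesis
    using moving_chart_exists integrals_separable by blast
qed

end
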